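(* Assume that $\mathrm{div}(A\nabla u)=\mathrm{div}(\bar{A}\nabla v)=0$ in $\mathbb{R}^n$, where $A,\bar{A}$ are two constant positive definite $n\times n$ matrices, and that $Z(v)\subset Z(u)$. If $u$ is a polynomial, then $v$ is also a polynomial.
   Context: $Z(u)=\{x:u(x)=0\}$ is the nodal set of $u$, and likewise $Z(v)=\{x:v(x)=0\}$.
   Formalization: The formal statement additionally assumes that u is not identically zero; without this the claim fails, e.g. u = 0, v = e^x sin y in R^2 with both matrices the identity. *)

theory Defs
  imports "HOL-Analysis.Analysis"
begin

text \<open>No symmetry is required. Since \<open>div (A \<nabla>u)\<close> only involves the symmetric part of a
  constant matrix \<open>A\<close>, this covers both conventions for ``positive definite''.\<close>

definition positive_definite :: "real ^ 'n ^ 'n \<Rightarrow> bool" where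
  "positive_definite A \<longleftrightarrow> (\<forall>x. x \<noteq> 0 \<longrightarrow> x \<bullet> (A *v x) > 0)"

definition gradient :: "(real ^ 'n \<Rightarrow> real) \<Rightarrow> real ^ 'n \<Rightarrow> real ^ 'n" where
  "gradient u x = (THE D. GDERIV u x :> D)"

definition divergence :: "(real ^ 'n \<Rightarrow> real ^ 'n) \<Rightarrow> real ^ 'n \<Rightarrow> real" where
  "divergence F x = trace (jacobian F (at x))"

definition continuously_differentiable ::
    "('a :: real_normed_vector \<Rightarrow> 'b :: real_normed_vector) \<Rightarrow> bool" where
  "continuously_differentiable f \<longleftrightarrow>
     (\<exists>f' :: 'a \<Rightarrow> 'a \<Rightarrow>\<^sub>L 'b.
        (\<forall>x. (f has_derivative blinfun_apply (f' x)) (at x)) \<and> continuous_on UNIV f')"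

text \<open>Classical (\<open>C\<^sup>2\<close>) solutions of \<open>div (A \<nabla>u) = 0\<close> on the whole space. For constant elliptic
  \<open>A\<close>, by Weyl's lemma, these are the same as weak solutions (taken as continuous functions).\<close>

definition divergence_form_solution :: "real ^ 'n ^ 'n \<Rightarrow> (real ^ 'n \<Rightarrow> real) \<Rightarrow> bool" where
  "divergence_form_solution A u \<longleftrightarrow>
     continuously_differentiable u \<and> continuously_differentiable (gradient u) \<and>
     (\<forall>x. divergence (\<lambda>y. A *v gradient u y) x = 0)"

definition nodal_set :: "(real ^ 'n \<Rightarrow> real) \<Rightarrow> (real ^ 'n) set" where
  "nodal_set u = {x. u x = 0}"

lemma gradient_eqI:
  assumes "GDERIV u x :> D"
  shows "gradient u x = D"
  unfolding gradient_def
proof (rule the_equality)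
  fix D' assume "GDERIV u x :> D'"
  then have "(\<lambda>h. h \<bullet> D') = (\<lambda>h. h \<bullet> D)"
    using assms has_derivative_unique unfolding gderiv_def by blast
  then have "\<forall>h. h \<bullet> D' = h \<bullet> D"
    by (rule fun_cong[THEN allI])
  then show "D' = D"
    by (rule vector_eq_ldot[THEN iffD1])
qed (fact assms)

end

theory Submission
  imports Defs "HOL-Computational_Algebra.Polynomial"
begin

text \<open>Let \<open>Q\<close> be the quadratic form of the inverse of the symmetric part of \<open>A'\<close>. For the weight
  \<open>w = max 0 (1 - Q) ^ 2\<close>, Green's identity shows that the integral of \<open>v (y + a x) * v (y + b x) * w x\<close>
  depends on \<open>a\<close> and \<open>b\<close> only through \<open>a * b\<close>; this yields mean values, three-balls inequalities, and the
  log-convexity in \<open>t\<close> of the mean \<open>\<Phi> t\<close> of \<open>v (exp (t / 2) x) ^ 2\<close>. If the slopes of \<open>ln \<Phi>\<close> are bounded,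
  \<open>v\<close> grows polynomially and a Liouville theorem applies. Otherwise there are \<open>t\<close> and small \<open>h\<close> such that
  \<open>ln \<Phi>\<close> is almost affine, with a large slope comparable to \<open>1 / h\<close>, on a window of length comparable to \<open>h\<close>,
  so that \<open>v (exp h * x)\<close> is \<open>L\<^sup>2\<close>-close to \<open>\<mu> * v x\<close> at that scale, for a large constant \<open>\<mu>\<close>. But every ball of radius comparable
  to \<open>h\<close> contains a ball of comparable radius without zeros of \<open>u\<close>, hence of \<open>v\<close>, because \<open>u\<close> is a
  polynomial; there Harnack's inequality makes \<open>v (exp h * x)\<close> much smaller than \<open>\<mu> * v x\<close>, and
  the three-balls inequality gives a contradiction.\<close>

section \<open>A compactly supported kernel built from a quadratic form\<close>

text \<open>Behind the dependence on \<open>a * b\<close> lies an orthogonality. When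
  \<open>A'\<close> is the identity, split \<open>v\<close> about \<open>y\<close> into homogeneous
  harmonic parts: parts of different degree are orthogonal for the radial weight, so the integral is
  a power series in \<open>a * b\<close> whose coefficients are the weighted square norms of the
  parts. The slope of \<open>ln \<Phi>\<close> at \<open>t\<close> is then an average of the degrees
  present in \<open>v\<close>, weighted by their share at scale \<open>exp (t / 2)\<close>; a
  transcendental \<open>v\<close> is one with unbounded slopes. The obstacle is that
  \<open>u\<close> and \<open>v\<close> solve different equations, so the inclusion of nodal sets
  relates no values of \<open>u\<close> and \<open>v\<close>. What passes from \<open>u\<close> to
  \<open>v\<close> is only a supply of zero-free balls of proportional size at every place and
  scale. The inverse of the slope is the scale at which \<open>v\<close> grows by a constant factor,
  and Harnack's inequality limits such factors. However, the growth is known only in mean square on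
  a region of unit size, and \<open>v\<close> could be tiny near a particular zero-free ball. Hence
  a centre is needed around which \<open>v\<close> is not small compared with its mean on a larger
  ball, nor with the deviation from homogeneous growth.\<close>

lemma integrable_bounded_support:
  fixes f :: "'a::euclidean_space \<Rightarrow> real"
  assumes "continuous_on UNIV f" and "\<And>x. norm x > R \<Longrightarrow> f x = 0"
  shows "integrable lborel f"
proof -
  have "integrable lborel (\<lambda>x. indicator (cball 0 R) x *\<^sub>R f x)"
    by (rule borel_integrable_compact) (auto intro: continuous_on_subset[OF assms(1)])
  also have "(\<lambda>x. indicator (cball 0 R) x *\<^sub>R f x) = f"
    using assms(2) by (force simp: indicator_def not_le)
  finally show ?thesis .
qed

lemma integral_lborel_affine:
  fixes f :: "'a::euclidean_space \<Rightarrow> real"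
  assumes [measurable]: "f \<in> borel_measurable borel" and "c > 0"
  shows "(\<integral>x. f x \<partial>lborel) = c ^ DIM('a) * (\<integral>x. f (t + c *\<^sub>R x) \<partial>lborel)"
proof -
  have "(\<integral>x. f x \<partial>lborel) = (\<integral>x. f x \<partial>(density (distr lborel borel (\<lambda>x. t + c *\<^sub>R x)) (\<lambda>_. \<bar>c\<bar>^DIM('a))))"
    using lborel_affine[of c t] \<open>c > 0\<close> by simp
  also have "\<dots> = c ^ DIM('a) * (\<integral>x. f (t + c *\<^sub>R x) \<partial>lborel)"
    using \<open>c > 0\<close> by (subst integral_density) (auto simp: integral_distr)
  finally show ?thesis .
qed

lemma integral_lborel_bounded_support:
  fixes f :: "'a::euclidean_space \<Rightarrow> real"
  assumes "continuous_on UNIV f" and "\<And>x. x \<notin> cbox a b \<Longrightarrow> f x = 0"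
  shows "(\<integral>x. f x \<partial>lborel) = integral (cbox a b) f"
proof -
  obtain R where R: "cbox a b \<subseteq> cball 0 R"
    using bounded_cbox[of a b] by (auto simp: bounded_pos subset_eq)
  have "integrable lborel f"
    by (rule integrable_bounded_support[OF assms(1), of R]) (use assms(2) R in force)
  then have "(\<integral>x. f x \<partial>lborel) = integral UNIV f"
    by (simp add: integral_lborel)
  also have "\<dots> = integral (cbox a b) f"
  proof -
    have "(\<lambda>x. if x \<in> cbox a b then f x else 0) = f"
      using assms(2) by auto
    then show ?thesis
      using integral_restrict_UNIV[of "cbox a b" f] by simp
  qed
  finally show ?thesis .
qed

text \<open>At the kink the difference quotient is bounded by a positive power of
  \<open>\<bar>h\<bar>\<close>, since the exponent is at least 2. The case \<open>k = 0\<close>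
  differentiates the weight \<open>w\<close>, the case \<open>k = 1\<close> the potential
  \<open>\<psi>\<close> in \<open>J_Green\<close>.\<close>

lemma has_real_derivative_max_power:
  fixes s :: real
  shows "((\<lambda>s. max 0 s ^ Suc (Suc k)) has_real_derivative of_nat (Suc (Suc k)) * max 0 s ^ Suc k) (at s)"
proof -
  consider "s > 0" | "s < 0" | "s = 0" by linarith
  then show ?thesis
  proof cases
    case 1
    have "((\<lambda>s. s ^ Suc (Suc k)) has_real_derivative of_nat (Suc (Suc k)) * s ^ Suc k) (at s)"
      by (rule derivative_eq_intros | simp)+
    moreover have "\<forall>\<^sub>F x in nhds s. max 0 x ^ Suc (Suc k) = x ^ Suc (Suc k)"
      using eventually_nhds_in_open[of "{0<..}" s] 1 by (auto elim!: eventually_mono)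
    ultimately show ?thesis
      using 1 DERIV_cong_ev[of s s "\<lambda>s. max 0 s ^ Suc (Suc k)" "\<lambda>s. s ^ Suc (Suc k)"] by simp
  next
    case 2
    have "\<forall>\<^sub>F x in nhds s. max 0 x ^ Suc (Suc k) = 0"
      using eventually_nhds_in_open[of "{..<0}" s] 2 by (auto elim!: eventually_mono)
    then show ?thesis
      using 2 DERIV_cong_ev[of s s "\<lambda>s. max 0 s ^ Suc (Suc k)" "\<lambda>s. 0"] by simp
  next
    case 3
    have "((\<lambda>h. max 0 h ^ Suc (Suc k) / h) \<longlongrightarrow> 0) (at (0::real))"
    proof (rule Lim_null_comparison[where g="\<lambda>h. \<bar>h\<bar> ^ Suc k"])
      show "\<forall>\<^sub>F x in at (0::real). norm (max 0 x ^ Suc (Suc k) / x) \<le> \<bar>x\<bar> ^ Suc k"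
        proof (rule always_eventually, rule allI)
        fix x :: real
        show "norm (max 0 x ^ Suc (Suc k) / x) \<le> \<bar>x\<bar> ^ Suc k"
          by (cases "0 \<le> x") (simp_all add: max_def, metis abs_ge_zero abs_of_neg mult_nonneg_nonneg not_le zero_le_power mult_minus_left neg_0_le_iff_le)
      qed
      have "((\<lambda>h. \<bar>h\<bar> ^ Suc k) \<longlongrightarrow> \<bar>0\<bar> ^ Suc k) (at (0::real))"
        by (intro tendsto_intros)
      then show "((\<lambda>h. \<bar>h\<bar> ^ Suc k) \<longlongrightarrow> 0) (at (0::real))" by simp
    qed
    then show ?thesis
      using 3 by (simp add: DERIV_def)
  qed
qed

text \<open>The lower bound places the ellipsoid where \<open>Q\<close> is at most 1 inside the
  Euclidean unit ball, so that supports and integration boxes can be fixed once and for all.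
  \<open>\<Lambda>\<close> bounds the distortion between \<open>Q\<close> and the Euclidean
  norm.\<close>

locale quadratic_kernel =
  fixes B :: "real ^ 'n ^ 'n" and \<Lambda> :: real
  assumes B_sym: "\<And>x y. x \<bullet> (B *v y) = y \<bullet> (B *v x)"
    and Q_lower: "\<And>x. (norm x)\<^sup>2 \<le> x \<bullet> (B *v x)"
    and Q_upper: "\<And>x. x \<bullet> (B *v x) \<le> \<Lambda> * (norm x)\<^sup>2"
begin

definition Q :: "real ^ 'n \<Rightarrow> real" where "Q x = x \<bullet> (B *v x)"
definition w :: "real ^ 'n \<Rightarrow> real" where "w x = (max 0 (1 - Q x))\<^sup>2"
definition J :: "(real ^ 'n \<Rightarrow> real) \<Rightarrow> real" where "J f = (\<integral>x. f x * w x \<partial>lborel)"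
text \<open>On the Euclidean ball of radius \<open>\<kappa>\<close> the form \<open>Q\<close> is at
  most 1/4, which keeps \<open>w\<close> away from 0. Comparing weighted means on different balls
  costs this ratio of radii.\<close>

definition \<kappa> :: real where "\<kappa> = 1 / (2 * sqrt \<Lambda>)"

lemma \<Lambda>_ge_1: "\<Lambda> \<ge> 1"
proof -
  obtain e :: "real ^ 'n" where "norm e = 1"
    using vector_choose_size[of 1] by auto
  then show ?thesis using Q_lower[of e] Q_upper[of e] by simp
qed

lemma \<kappa>_pos: "0 < \<kappa>" and \<kappa>_le: "\<kappa> \<le> 1 / 2"
  using \<Lambda>_ge_1 by (auto simp: \<kappa>_def field_simps)

lemma Q_nonneg: "0 \<le> Q x"
  using Q_lower[of x] unfolding Q_def by (smt (verit) zero_le_power2)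

lemma Q_scale: "Q (c *\<^sub>R x) = c\<^sup>2 * Q x"
  by (simp add: Q_def power2_eq_square matrix_vector_mult_scaleR)

lemma Q_add: "Q (x + y) = Q x + 2 * (x \<bullet> (B *v y)) + Q y"
  using B_sym[of y x] by (simp add: Q_def algebra_simps inner_simps matrix_vector_right_distrib)

lemma continuous_on_Q [continuous_intros]: 
  "continuous_on S f \<Longrightarrow> continuous_on S (\<lambda>x. Q (f x))"
  unfolding Q_def
  by (intro continuous_intros continuous_on_compose2[OF matrix_vector_mult_linear_continuous_on[of UNIV]]) auto

lemma has_derivative_Q: "(Q has_derivative (\<lambda>e. 2 * (e \<bullet> (B *v x)))) (at x)"
proof -
  have "((\<lambda>x. x \<bullet> (B *v x)) has_derivative (\<lambda>e. x \<bullet> (B *v e) + e \<bullet> (B *v x))) (at x)"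
    by (intro derivative_intros bounded_linear.has_derivative[OF matrix_vector_mul_bounded_linear])
  then show ?thesis
    using B_sym[of x] by (simp add: Q_def[abs_def])
qed

lemma has_derivative_max_Q:
  "((\<lambda>x. max 0 (1 - Q x) ^ Suc (Suc k)) has_derivative
     (\<lambda>e. - 2 * real (Suc (Suc k)) * max 0 (1 - Q x) ^ Suc k * (e \<bullet> (B *v x)))) (at x)"
proof -
  have 1: "((\<lambda>x. 1 - Q x) has_derivative (\<lambda>e. - 2 * (e \<bullet> (B *v x)))) (at x)"
    using has_derivative_diff[OF has_derivative_const has_derivative_Q] by simp
  show ?thesis
    by (rule has_derivative_eq_rhs[OF DERIV_compose_FDERIV[OF has_real_derivative_max_power 1]])
       (simp add: fun_eq_iff algebra_simps)
qed

lemma w_nonneg [simp]: "0 \<le> w x" by (simp add: w_def)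

lemma w_le_1: "w x \<le> 1"
  using Q_nonneg[of x] by (auto simp: w_def max_def intro!: power_le_one)

lemma w_eq_0: "1 \<le> norm x \<Longrightarrow> w x = 0"
proof -
  assume "1 \<le> norm x"
  then have "1 \<le> Q x" using Q_lower[of x] one_le_power[of "norm x" 2] unfolding Q_def by linarith
  then show ?thesis by (simp add: w_def)
qed

lemma continuous_on_w [continuous_intros]:
  "continuous_on S f \<Longrightarrow> continuous_on S (\<lambda>x. w (f x))"
  unfolding w_def by (intro continuous_intros)

lemma w_ge_half: assumes "norm x \<le> \<kappa>" shows "1 / 2 \<le> w x"
proof -
  have "(norm x)\<^sup>2 \<le> \<kappa>\<^sup>2" using assms by (simp add: power_mono)
  then have "\<Lambda> * (norm x)\<^sup>2 \<le> \<Lambda> * \<kappa>\<^sup>2" using \<Lambda>_ge_1 by simp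
  also have "\<dots> = 1 / 4" using \<Lambda>_ge_1 by (simp add: \<kappa>_def power_divide power_mult_distrib)
  finally have "Q x \<le> 1 / 4" using Q_upper[of x] by (simp add: Q_def)
  then have "(3/4)\<^sup>2 \<le> w x" unfolding w_def by (intro power_mono) auto
  then show ?thesis by (simp add: power2_eq_square)
qed

lemma w_shrink: assumes "0 \<le> c" "c \<le> 1" shows "w x \<le> w (c *\<^sub>R x)"
proof -
  have "c\<^sup>2 * Q x \<le> 1 * Q x" using assms Q_nonneg[of x] by (intro mult_right_mono) (auto simp: power_le_one)
  then show ?thesis unfolding w_def Q_scale by (intro power_mono) auto
qed

text \<open>Convexity of \<open>Q\<close>: the point \<open>(x + z) / (1 + 2\<sigma>)\<close> is a convex combination of \<open>x\<close> and
  of \<open>z / (2\<sigma>)\<close>, where \<open>Q \<le> 1\<close>.\<close>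
lemma w_shift:
  assumes "sqrt \<Lambda> * norm z \<le> \<sigma>" "0 < \<sigma>" "2 * \<sigma> \<le> 1"
  shows "w x \<le> 4 * w ((1 / (1 + 2 * \<sigma>)) *\<^sub>R (x + z))"
proof -
  define \<theta> where "\<theta> = 1 / (1 + 2 * \<sigma>)"
  define y where "y = (1 / (2 * \<sigma>)) *\<^sub>R z"
  have \<theta>: "1/2 \<le> \<theta>" "\<theta> \<le> 1" "1 - \<theta> = 2 * \<sigma> * \<theta>" using assms by (auto simp: \<theta>_def field_simps)
  have "\<theta> *\<^sub>R (x + z) = \<theta> *\<^sub>R x + (1 - \<theta>) *\<^sub>R y"
    using \<open>0 < \<sigma>\<close> by (simp add: \<theta>(3) y_def scaleR_right_distrib)
  moreover have "Q (\<theta> *\<^sub>R x + (1 - \<theta>) *\<^sub>R y) = \<theta> * Q x + (1 - \<theta>) * Q y - \<theta> * (1 - \<theta>) * Q (x + (-1) *\<^sub>R y)"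
    unfolding Q_add Q_scale using B_sym[of x y] matrix_vector_mult_scaleR[of B "-1" y]
    by (simp add: matrix_vector_mult_scaleR) (simp add: algebra_simps power2_eq_square)
  moreover have "0 \<le> \<theta> * (1 - \<theta>) * Q (x + (-1) *\<^sub>R y)" using \<theta> Q_nonneg by (intro mult_nonneg_nonneg) auto
  ultimately have *: "Q (\<theta> *\<^sub>R (x + z)) \<le> \<theta> * Q x + (1 - \<theta>) * Q y" by simp
  have "(sqrt \<Lambda> * norm z)\<^sup>2 \<le> \<sigma>\<^sup>2" using assms \<Lambda>_ge_1 by (intro power_mono) auto
  then have "\<Lambda> * (norm z)\<^sup>2 \<le> \<sigma>\<^sup>2" using \<Lambda>_ge_1 by (simp add: power_mult_distrib)
  then have "Q z \<le> \<sigma>\<^sup>2" using Q_upper[of z] by (simp add: Q_def)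
  then have "Q y \<le> 1" using \<open>0 < \<sigma>\<close> unfolding y_def Q_scale by (simp add: power_divide field_simps) (smt (verit) zero_le_power2)
  then have "(1 - \<theta>) * Q y \<le> (1 - \<theta>) * 1" using \<theta> by (intro mult_left_mono) auto
  then have **: "\<theta> * (1 - Q x) \<le> 1 - Q (\<theta> *\<^sub>R (x + z))" using * by (simp add: algebra_simps)
  \<comment> \<open>Since \<open>\<theta>\<close> is at least 1/2, the convex combination loses at
    most a factor 2, which squaring turns into 4.\<close>
  have "max 0 (1 - Q x) \<le> 2 * max 0 (1 - Q (\<theta> *\<^sub>R (x + z)))"
  proof (cases "0 \<le> 1 - Q x")
    case True
    then have "(1/2) * (1 - Q x) \<le> \<theta> * (1 - Q x)" using \<theta> by (intro mult_right_mono) auto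
    then have "(1/2) * (1 - Q x) \<le> 1 - Q (\<theta> *\<^sub>R (x + z))" using ** by (rule order_trans)
    then show ?thesis using True by auto
  qed auto
  then have "(max 0 (1 - Q x))\<^sup>2 \<le> (2 * max 0 (1 - Q (\<theta> *\<^sub>R (x + z))))\<^sup>2" by (intro power_mono) auto
  then show ?thesis unfolding w_def \<theta>_def by (simp add: power_mult_distrib)
qed

section \<open>The weighted integral \<open>J\<close> and changes of centre and radius\<close>

lemma integrable_mult_w: "continuous_on UNIV f \<Longrightarrow> integrable lborel (\<lambda>x. f x * w x)"
  by (rule integrable_bounded_support[where R=1]) (auto intro!: continuous_intros simp: w_eq_0)

lemma J_cbox:
  assumes "continuous_on UNIV f"
  shows "J f = integral (cbox (- One) One) (\<lambda>x. f x * w x)"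
  unfolding J_def
proof (rule integral_lborel_bounded_support)
  show "continuous_on UNIV (\<lambda>x. f x * w x)" by (intro continuous_intros assms)
  fix x :: "real ^ 'n" assume "x \<notin> cbox (- One) One"
  then obtain b where "b \<in> Basis" "1 < \<bar>x \<bullet> b\<bar>" by (force simp: mem_box abs_if split: if_splits)
  then have "1 \<le> norm x" using Basis_le_norm[of b x] by linarith
  then show "f x * w x = 0" by (simp add: w_eq_0)
qed

lemma J_add: "continuous_on UNIV f \<Longrightarrow> continuous_on UNIV g \<Longrightarrow> J (\<lambda>x. f x + g x) = J f + J g"
  unfolding J_def by (simp add: integrable_mult_w distrib_right)

lemma J_diff: "continuous_on UNIV f \<Longrightarrow> continuous_on UNIV g \<Longrightarrow> J (\<lambda>x. f x - g x) = J f - J g"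
  unfolding J_def by (simp add: integrable_mult_w left_diff_distrib)

lemma J_cmult: "J (\<lambda>x. c * f x) = c * J f"
  unfolding J_def by (simp add: mult.assoc)

lemma J_mono:
  assumes "continuous_on UNIV f" "continuous_on UNIV g" "\<And>x. norm x < 1 \<Longrightarrow> f x \<le> g x"
  shows "J f \<le> J g"
  unfolding J_def
proof (rule integral_mono)
  fix x show "f x * w x \<le> g x * w x"
    using assms(3)[of x] w_eq_0[of x] by (cases "norm x < 1") (auto intro: mult_right_mono)
qed (auto intro!: integrable_mult_w assms)

lemma J_nonneg: "(\<And>x. norm x < 1 \<Longrightarrow> 0 \<le> f x) \<Longrightarrow> 0 \<le> J f"
  unfolding J_def by (rule integral_nonneg_AE, rule AE_I2) (metis mult_nonneg_nonneg mult_zero_right not_le order_refl w_eq_0 w_nonneg)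

lemma J_pos:
  assumes "continuous_on UNIV f" "\<And>x. 0 \<le> f x" "f 0 > 0"
  shows "0 < J f"
proof (rule ccontr)
  assume "\<not> 0 < J f"
  then have "J f = 0" using J_nonneg[of f] assms(2) by force
  then have "integral (cbox (- One) One) (\<lambda>x. f x * w x) = 0"
    using J_cbox[OF assms(1)] by simp
  moreover have c: "continuous_on (cbox (- One) One) (\<lambda>x. f x * w x)"
    by (intro continuous_intros continuous_on_subset[OF assms(1)]) auto
  ultimately have "((\<lambda>x. f x * w x) has_integral 0) (cbox (- One) One)"
    using integrable_integral[OF integrable_continuous[OF c]] by simp
  then have "f 0 * w 0 = 0"
    by (intro has_integral_0_cbox_imp_0[OF c, of 0]) (auto simp: assms(2) mem_box box_eq_empty)
  moreover have "1 / 2 \<le> w 0" using \<kappa>_pos by (intro w_ge_half) auto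
  ultimately show False using assms(3) by auto
qed

lemma J_one_pos: "0 < J (\<lambda>_. 1)"
  by (intro J_pos continuous_intros) auto

lemma J_const: "J (\<lambda>_. c) = c * J (\<lambda>_. 1)"
  using J_cmult[of c "\<lambda>_. 1"] by simp

lemma J_Cauchy_Schwarz:
  assumes "continuous_on UNIV f" "continuous_on UNIV g"
  shows "(J (\<lambda>x. f x * g x))\<^sup>2 \<le> J (\<lambda>x. (f x)\<^sup>2) * J (\<lambda>x. (g x)\<^sup>2)"
proof -
  note [continuous_intros] = assms
  define a b c where "a = J (\<lambda>x. (f x)\<^sup>2)" and "b = J (\<lambda>x. f x * g x)" and "c = J (\<lambda>x. (g x)\<^sup>2)"
  have quad: "0 \<le> s\<^sup>2 * a - 2 * s * t * b + t\<^sup>2 * c" for s t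
  proof -
    have "0 \<le> J (\<lambda>x. (s * f x - t * g x)\<^sup>2)" by (rule J_nonneg) simp
    also have "(\<lambda>x. (s * f x - t * g x)\<^sup>2) = (\<lambda>x. (s\<^sup>2 * (f x)\<^sup>2 - (2 * s * t) * (f x * g x)) + t\<^sup>2 * (g x)\<^sup>2)"
      by (rule ext) (simp add: power2_eq_square algebra_simps)
    also have "J \<dots> = s\<^sup>2 * a - 2 * s * t * b + t\<^sup>2 * c"
      unfolding a_def b_def c_def
      by (subst J_add J_diff, (intro continuous_intros)+)+ (simp only: J_cmult)
    finally show ?thesis .
  qed
  have "0 \<le> a" "0 \<le> c" unfolding a_def c_def by (auto intro: J_nonneg)
  \<comment> \<open>The usual choice \<open>(c, b)\<close> is useless when \<open>c = 0\<close>;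
    there the pair \<open>(b, a + 1)\<close> forces \<open>b = 0\<close>.\<close>
  have "b\<^sup>2 \<le> a * c"
  proof (cases "c = 0")
    case True
    have "2 * b * (a + 1) * b \<le> b\<^sup>2 * a" using quad[of b "a + 1"] True by (simp add: algebra_simps)
    then have "b\<^sup>2 * (a + 2) \<le> 0" by (simp add: algebra_simps power2_eq_square)
    then have "b\<^sup>2 \<le> 0" using \<open>0 \<le> a\<close> by (simp add: mult_le_0_iff)
    then show ?thesis using True by simp
  next
    case False
    have "0 \<le> c * (a * c - b\<^sup>2)" using quad[of c b] by (simp add: algebra_simps power2_eq_square)
    then show ?thesis using False \<open>0 \<le> c\<close> by (simp add: zero_le_mult_iff)
  qed
  then show ?thesis unfolding a_def b_def c_def .
qed

lemma J_affine:
  assumes "continuous_on UNIV f" "0 < s"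
  shows "s ^ CARD('n) * J (\<lambda>x. f (y + s *\<^sub>R x)) = (\<integral>x. f x * w ((1 / s) *\<^sub>R (x - y)) \<partial>lborel)"
proof -
  have "continuous_on UNIV (\<lambda>x. f x * w ((1 / s) *\<^sub>R (x - y)))"
    by (intro continuous_intros assms)
  then have "(\<lambda>x. f x * w ((1 / s) *\<^sub>R (x - y))) \<in> borel_measurable borel"
    by (rule borel_measurable_continuous_onI)
  from integral_lborel_affine[OF this \<open>0 < s\<close>, of y] show ?thesis
    using \<open>0 < s\<close> by (simp add: J_def)
qed

lemma integrable_mult_w_affine:
  assumes "continuous_on UNIV f" "0 < s"
  shows "integrable lborel (\<lambda>x. f x * w ((1 / s) *\<^sub>R (x - y)))"
proof (rule integrable_bounded_support[where R="norm y + s"])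
  show "continuous_on UNIV (\<lambda>x. f x * w ((1 / s) *\<^sub>R (x - y)))"
    by (intro continuous_intros assms)
  fix x :: "real ^ 'n" assume "norm y + s < norm x"
  then have "s \<le> norm (x - y)" using norm_triangle_ineq2[of x y] by linarith
  then have "1 \<le> norm ((1 / s) *\<^sub>R (x - y))" using \<open>0 < s\<close> by simp
  then show "f x * w ((1 / s) *\<^sub>R (x - y)) = 0" by (simp add: w_eq_0)
qed

text \<open>The distance condition puts the small ball inside the part of the large one where
  \<open>w\<close> is at least 1/2, while \<open>w\<close> is at most 1 everywhere. The sign of
  \<open>f\<close> is required only on the large ball, as Harnack's inequality demands.\<close>

lemma J_ball_le:
  fixes x y :: "real ^ 'n"
  assumes "continuous_on UNIV f" and f: "\<And>x. norm (x - y) < s \<Longrightarrow> 0 \<le> f x"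
    and "0 < r" "norm (x - y) + r \<le> \<kappa> * s"
  shows "r ^ CARD('n) * J (\<lambda>z. f (x + r *\<^sub>R z)) \<le> 2 * s ^ CARD('n) * J (\<lambda>z. f (y + s *\<^sub>R z))"
proof -
  have "0 < \<kappa> * s" using assms(3,4) norm_ge_zero[of "x - y"] by linarith
  then have s: "0 < s" using \<kappa>_pos by (simp add: zero_less_mult_iff)
  have "\<kappa> * s \<le> s" using \<kappa>_le s by simp
  have le: "f z * w ((1 / r) *\<^sub>R (z - x)) \<le> 2 * (f z * w ((1 / s) *\<^sub>R (z - y)))" for z
  proof (cases "norm (z - x) < r")
    case True
    have *: "norm (z - y) \<le> \<kappa> * s"
      using norm_triangle_ineq[of "z - x" "x - y"] True assms(4) by simp
    then have "norm ((1 / s) *\<^sub>R (z - y)) \<le> \<kappa>" using s by (simp only: norm_scaleR) (simp add: field_simps)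
    then have "w ((1 / r) *\<^sub>R (z - x)) \<le> 2 * w ((1 / s) *\<^sub>R (z - y))"
      using w_ge_half[of "(1 / s) *\<^sub>R (z - y)"] w_le_1[of "(1 / r) *\<^sub>R (z - x)"] by linarith
    moreover have "0 \<le> f z" 
    proof (rule f)
      have "\<kappa> * s < s" using \<kappa>_le s by simp
      then show "norm (z - y) < s" using * by simp
    qed
    ultimately show ?thesis using mult_left_mono by fastforce
  next
    case False
    then have "w ((1 / r) *\<^sub>R (z - x)) = 0" using \<open>0 < r\<close> by (intro w_eq_0) simp
    moreover have "0 \<le> f z * w ((1 / s) *\<^sub>R (z - y))"
    proof (cases "norm (z - y) < s")
      case False
      then have "w ((1 / s) *\<^sub>R (z - y)) = 0" using s by (intro w_eq_0) simp
      then show ?thesis by simp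
    qed (simp add: f)
    ultimately show ?thesis by simp
  qed
  have "r ^ CARD('n) * J (\<lambda>z. f (x + r *\<^sub>R z)) \<le> (\<integral>z. 2 * (f z * w ((1 / s) *\<^sub>R (z - y))) \<partial>lborel)"
    unfolding J_affine[OF assms(1,3)]
    by (intro integral_mono le integrable_mult_w_affine integrable_mult_right assms s)
  also have "\<dots> = 2 * s ^ CARD('n) * J (\<lambda>z. f (y + s *\<^sub>R z))"
    using J_affine[OF assms(1) s, of y] by simp
  finally show ?thesis .
qed

end

section \<open>Constant coefficient equations in divergence form\<close>

text \<open>The integral of \<open>F\<close> shifted by \<open>t *\<^sub>R e\<close> does not depend
  on \<open>t\<close>, so its derivative under the integral sign vanishes at 0. A box of half-width
  2 contains every support shifted by a vector of length at most 1.\<close>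

lemma integral_directional_derivative_eq_0:
  fixes F D :: "'a::euclidean_space \<Rightarrow> real"
  assumes "continuous_on UNIV F" "continuous_on UNIV D"
    and deriv: "\<And>x t. ((\<lambda>t. F (x + t *\<^sub>R e)) has_real_derivative D (x + t *\<^sub>R e)) (at t)"
    and F0: "\<And>x. 1 \<le> norm x \<Longrightarrow> F x = 0" and D0: "\<And>x. 1 \<le> norm x \<Longrightarrow> D x = 0"
    and e: "norm e \<le> 1"
  shows "(\<integral>x. D x \<partial>lborel) = 0"
proof -
  let ?K = "cbox (- (2 *\<^sub>R One)) (2 *\<^sub>R One) :: 'a set"
  have K: "2 \<le> norm x" if "x \<notin> ?K" for x :: 'a
  proof -
    have "\<not> (\<forall>b\<in>Basis. \<bar>x \<bullet> b\<bar> \<le> 2)" 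
    proof
      assume *: "\<forall>b\<in>Basis. \<bar>x \<bullet> b\<bar> \<le> 2"
      have "x \<in> ?K" unfolding mem_box
      proof (intro ballI conjI)
        fix b :: 'a assume b: "b \<in> Basis"
        with * have "\<bar>x \<bullet> b\<bar> \<le> 2" by blast
        then show "- (2 *\<^sub>R One) \<bullet> b \<le> x \<bullet> b" "x \<bullet> b \<le> 2 *\<^sub>R One \<bullet> b" using b by (simp_all add: abs_le_iff)
      qed
      with that show False by blast
    qed
    then obtain b where "b \<in> Basis" "2 < \<bar>x \<bullet> b\<bar>" by (auto simp: not_le)
    then show ?thesis using Basis_le_norm[of b x] by linarith
  qed
  have const: "integral ?K (\<lambda>x. F (x + t *\<^sub>R e)) = (\<integral>x. F x \<partial>lborel)" if "t \<in> {-1..1}" for t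
  proof -
    have c: "continuous_on UNIV (\<lambda>x. F (x + t *\<^sub>R e))"
      by (intro continuous_on_compose2[OF assms(1)] continuous_intros) auto
    have "norm (t *\<^sub>R e) \<le> 1" using that e by (simp add: abs_le_iff mult_le_one)
    then have "F (x + t *\<^sub>R e) = 0" if "x \<notin> ?K" for x
      using K[OF that] norm_triangle_ineq2[of x "- (t *\<^sub>R e)"] by (intro F0) simp
    then have "integral ?K (\<lambda>x. F (x + t *\<^sub>R e)) = (\<integral>x. F (x + t *\<^sub>R e) \<partial>lborel)"
      using integral_lborel_bounded_support[OF c] by metis
    also have "\<dots> = (\<integral>x. F x \<partial>lborel)"
      using integral_lborel_affine[OF borel_measurable_continuous_onI[OF assms(1)], of 1 "t *\<^sub>R e"]
      by (simp add: add.commute)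
    finally show ?thesis .
  qed
  have "((\<lambda>t. integral ?K (\<lambda>x. F (x + t *\<^sub>R e))) has_field_derivative integral ?K (\<lambda>x. D (x + 0 *\<^sub>R e))) (at 0 within {-1..1})"
  proof (rule leibniz_rule_field_derivative)
    show "continuous_on ({-1..1} \<times> ?K) (\<lambda>(t, x). D (x + t *\<^sub>R e))"
      unfolding split_beta
      by (intro continuous_on_compose2[OF assms(2)] continuous_intros) auto
    show "(\<lambda>x. F (x + t *\<^sub>R e)) integrable_on ?K" for t
      by (intro integrable_continuous continuous_on_compose2[OF assms(1)] continuous_intros) auto
  qed (auto intro: deriv has_field_derivative_at_within)
  moreover have "((\<lambda>t. integral ?K (\<lambda>x. F (x + t *\<^sub>R e))) has_field_derivative 0) (at 0 within {-1..1})"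
    
    unfolding has_field_derivative_def
  proof (rule has_derivative_transform)
    show "((\<lambda>_. (\<integral>x. F x \<partial>lborel)) has_derivative (*) 0) (at 0 within {-1..1})"
      by (rule DERIV_const[unfolded has_field_derivative_def])
  qed (auto simp: const)
  moreover have "at (0::real) within {-1..1} = at 0" by (rule at_within_interior) simp
  ultimately have "integral ?K (\<lambda>x. D (x + 0 *\<^sub>R e)) = 0"
    by (metis (no_types, lifting) DERIV_unique)
  then have "integral ?K D = 0" by simp
  moreover have "D x = 0" if "x \<notin> ?K" for x using K[OF that] by (intro D0) simp
  ultimately show ?thesis using integral_lborel_bounded_support[OF assms(2)] by metis
qed

text \<open>The double difference of \<open>v\<close> is a value of the second derivative, whichever of the two
  directions is treated first.\<close>
lemma double_difference_eq_second_derivative: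
  fixes v :: "real ^ 'n \<Rightarrow> real"
  assumes v: "\<And>x. (v has_derivative (\<lambda>h. h \<bullet> g x)) (at x)"
    and g: "\<And>x. (g has_derivative (\<lambda>h. H x *v h)) (at x)"
    and "norm a \<le> 1" "norm b \<le> 1" "0 < h"
  obtains p where "norm (p - x) \<le> 2 * h"
    and "v (x + h *\<^sub>R a + h *\<^sub>R b) - v (x + h *\<^sub>R a) - v (x + h *\<^sub>R b) + v x = h\<^sup>2 * (a \<bullet> (H p *v b))"
proof -
  have dv: "((\<lambda>s. v (z + s *\<^sub>R a)) has_real_derivative a \<bullet> g (z + s *\<^sub>R a)) (at s)" for z s
    unfolding has_field_derivative_def
    by (rule has_derivative_eq_rhs[OF has_derivative_compose[OF _ v]])
       (auto intro!: derivative_eq_intros simp: fun_eq_iff)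
  have dg: "((\<lambda>t. a \<bullet> g (z + t *\<^sub>R b)) has_real_derivative a \<bullet> (H (z + t *\<^sub>R b) *v b)) (at t)" for z t
    unfolding has_field_derivative_def
    by (rule has_derivative_eq_rhs[OF has_derivative_inner_right[OF has_derivative_compose[OF _ g]]])
       (auto intro!: derivative_eq_intros simp: fun_eq_iff matrix_vector_mult_scaleR)
  let ?\<phi> = "\<lambda>s. v ((x + h *\<^sub>R b) + s *\<^sub>R a) - v (x + s *\<^sub>R a)"
  have "\<exists>\<xi>. 0 < \<xi> \<and> \<xi> < h \<and> ?\<phi> h - ?\<phi> 0 = (h - 0) * (a \<bullet> g ((x + h *\<^sub>R b) + \<xi> *\<^sub>R a) - a \<bullet> g (x + \<xi> *\<^sub>R a))"
    by (rule MVT2) (auto intro!: DERIV_diff dv \<open>0 < h\<close>)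
  then obtain \<xi> where \<xi>: "0 < \<xi>" "\<xi> < h" and
    1: "?\<phi> h - ?\<phi> 0 = h * (a \<bullet> g ((x + h *\<^sub>R b) + \<xi> *\<^sub>R a) - a \<bullet> g (x + \<xi> *\<^sub>R a))" by auto
  have "\<exists>\<eta>. 0 < \<eta> \<and> \<eta> < h \<and> a \<bullet> g ((x + \<xi> *\<^sub>R a) + h *\<^sub>R b) - a \<bullet> g ((x + \<xi> *\<^sub>R a) + 0 *\<^sub>R b)
      = (h - 0) * (a \<bullet> (H ((x + \<xi> *\<^sub>R a) + \<eta> *\<^sub>R b) *v b))"
    by (rule MVT2) (auto intro!: dg \<open>0 < h\<close>)
  then obtain \<eta> where \<eta>: "0 < \<eta>" "\<eta> < h" and
    2: "a \<bullet> g ((x + \<xi> *\<^sub>R a) + h *\<^sub>R b) - a \<bullet> g (x + \<xi> *\<^sub>R a)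
      = h * (a \<bullet> (H ((x + \<xi> *\<^sub>R a) + \<eta> *\<^sub>R b) *v b))" by auto
  show thesis
  proof
    have "norm (\<xi> *\<^sub>R a + \<eta> *\<^sub>R b) \<le> \<xi> * norm a + \<eta> * norm b"
      using norm_triangle_ineq[of "\<xi> *\<^sub>R a" "\<eta> *\<^sub>R b"] \<xi> \<eta> by simp
    also have "\<dots> \<le> h * 1 + h * 1" using \<xi> \<eta> assms by (intro add_mono mult_mono) auto
    finally show "norm ((x + \<xi> *\<^sub>R a) + \<eta> *\<^sub>R b - x) \<le> 2 * h" by (simp add: add.assoc)
    show "v (x + h *\<^sub>R a + h *\<^sub>R b) - v (x + h *\<^sub>R a) - v (x + h *\<^sub>R b) + v x
        = h\<^sup>2 * (a \<bullet> (H ((x + \<xi> *\<^sub>R a) + \<eta> *\<^sub>R b) *v b))"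
      using 1 2 by (simp add: power2_eq_square add_ac mult.assoc)
  qed
qed

lemma continuous_on_matrix_vector_mult [continuous_intros]:
  fixes H :: "'a::topological_space \<Rightarrow> real ^ 'n ^ 'm"
  assumes "continuous_on S H" "continuous_on S f"
  shows "continuous_on S (\<lambda>x. H x *v f x)"
  unfolding matrix_vector_mult_def by (intro continuous_intros assms)

text \<open>The two orders of treating the directions express one double difference by second
  derivatives at two points, and both points tend to \<open>x\<close> with the step size. This
  symmetry is what lets \<open>A\<close> be replaced by its symmetric part.\<close>

lemma second_derivative_symmetric:
  fixes v :: "real ^ 'n \<Rightarrow> real"
  assumes v: "\<And>x. (v has_derivative (\<lambda>h. h \<bullet> g x)) (at x)"
    and g: "\<And>x. (g has_derivative (\<lambda>h. H x *v h)) (at x)"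
    and H: "continuous_on UNIV H" and "norm a \<le> 1" "norm b \<le> 1"
  shows "a \<bullet> (H x *v b) = b \<bullet> (H x *v a)"
proof -
  define h where "h n = 1 / real (Suc n)" for n
  have h0: "0 < h n" for n by (simp add: h_def)
  have "\<exists>p q. norm (p - x) \<le> 2 * h n \<and> norm (q - x) \<le> 2 * h n \<and> a \<bullet> (H p *v b) = b \<bullet> (H q *v a)" for n
  proof -
    obtain p where p: "norm (p - x) \<le> 2 * h n"
      "v (x + h n *\<^sub>R a + h n *\<^sub>R b) - v (x + h n *\<^sub>R a) - v (x + h n *\<^sub>R b) + v x = (h n)\<^sup>2 * (a \<bullet> (H p *v b))"
      using double_difference_eq_second_derivative[OF v g assms(4,5) h0] by blast
    obtain q where q: "norm (q - x) \<le> 2 * h n"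
      "v (x + h n *\<^sub>R b + h n *\<^sub>R a) - v (x + h n *\<^sub>R b) - v (x + h n *\<^sub>R a) + v x = (h n)\<^sup>2 * (b \<bullet> (H q *v a))"
      using double_difference_eq_second_derivative[OF v g assms(5,4) h0] by blast
    have "(h n)\<^sup>2 * (a \<bullet> (H p *v b)) = (h n)\<^sup>2 * (b \<bullet> (H q *v a))"
      unfolding p(2)[symmetric] q(2)[symmetric] by (simp add: add_ac)
    then show ?thesis using p(1) q(1) h0[of n] by auto
  qed
  then obtain p q where p: "\<And>n. norm (p n - x) \<le> 2 * h n" and q: "\<And>n. norm (q n - x) \<le> 2 * h n"
    and eq: "\<And>n. a \<bullet> (H (p n) *v b) = b \<bullet> (H (q n) *v a)" by metis
  have h: "(\<lambda>n. 2 * h n) \<longlonglongrightarrow> 0"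
    using tendsto_mult_left[OF LIMSEQ_inverse_real_of_nat, of 2] by (simp add: h_def field_simps)
  have "p \<longlonglongrightarrow> x" "q \<longlonglongrightarrow> x"
    using Lim_null_comparison[OF always_eventually h, of "\<lambda>n. p n - x"] p
      Lim_null_comparison[OF always_eventually h, of "\<lambda>n. q n - x"] q
    by (auto simp: Lim_null[symmetric])
  moreover have "continuous_on UNIV (\<lambda>y. a \<bullet> (H y *v b))" "continuous_on UNIV (\<lambda>y. b \<bullet> (H y *v a))"
    by (intro continuous_intros H)+
  then have "isCont (\<lambda>y. a \<bullet> (H y *v b)) x" "isCont (\<lambda>y. b \<bullet> (H y *v a)) x"
    by (simp_all add: continuous_on_eq_continuous_at)
  ultimately have "(\<lambda>n. a \<bullet> (H (p n) *v b)) \<longlonglongrightarrow> a \<bullet> (H x *v b)" "(\<lambda>n. b \<bullet> (H (q n) *v a)) \<longlonglongrightarrow> b \<bullet> (H x *v a)"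
    by (auto intro: isCont_tendsto_compose[where g="\<lambda>y. a \<bullet> (H y *v b)"] isCont_tendsto_compose[where g="\<lambda>y. b \<bullet> (H y *v a)"])
  then show ?thesis unfolding eq by (rule LIMSEQ_unique)
qed

section \<open>The symmetric part of the matrix and its adapted quadratic form\<close>

definition symmetric_part :: "real ^ 'n ^ 'n \<Rightarrow> real ^ 'n ^ 'n" where
  "symmetric_part A = (1 / 2) *\<^sub>R (A + transpose A)"

lemma symmetric_part_inner_commute: "x \<bullet> (symmetric_part A *v y) = y \<bullet> (symmetric_part A *v x)"
proof -
  have "symmetric_part A *v z = (1 / 2) *\<^sub>R (A *v z + transpose A *v z)" for z
    by (simp add: symmetric_part_def scaleR_matrix_vector_assoc[symmetric] matrix_vector_mult_add_rdistrib)
  moreover have "x \<bullet> (transpose A *v y) = y \<bullet> (A *v x)" for x y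
    by (metis dot_lmul_matrix inner_commute transpose_matrix_vector)
  ultimately show ?thesis by (simp add: inner_add_right)
qed

lemma symmetric_part_quadratic_form: "x \<bullet> (symmetric_part A *v x) = x \<bullet> (A *v x)"
proof -
  have "symmetric_part A *v x = (1 / 2) *\<^sub>R (A *v x + transpose A *v x)"
    by (simp add: symmetric_part_def scaleR_matrix_vector_assoc[symmetric] matrix_vector_mult_add_rdistrib)
  moreover have "x \<bullet> (transpose A *v x) = x \<bullet> (A *v x)"
    by (metis dot_lmul_matrix inner_commute transpose_matrix_vector)
  ultimately show ?thesis by (simp add: inner_add_right)
qed

text \<open>\<open>B\<close> is the inverse of the symmetric part, divided by the minimum
  \<open>\<mu>\<close> of its form on the unit sphere; this normalises the lower bound of
  \<open>Q\<close> to 1 and gives \<open>m = 1 / \<mu>\<close>.\<close>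

lemma exists_quadratic_kernel:
  fixes A :: "real ^ 'n ^ 'n"
  assumes "positive_definite A"
  obtains B \<Lambda> m where "quadratic_kernel B \<Lambda>" "0 < m" "\<And>x. symmetric_part A *v (B *v x) = m *\<^sub>R x"
proof -
  let ?S = "symmetric_part A"
  have pos: "0 < x \<bullet> (?S *v x)" if "x \<noteq> 0" for x
    using assms that by (simp add: symmetric_part_quadratic_form positive_definite_def)
  then have "\<forall>x. ?S *v x = 0 \<longrightarrow> x = 0" by force
  then obtain B0 where "B0 ** ?S = mat 1" using matrix_left_invertible_ker[of ?S] by auto
  then have "?S ** B0 = mat 1" using matrix_left_right_inverse by blast
  then have B0: "?S *v (B0 *v x) = x" for x
    by (simp add: matrix_vector_mul_assoc)
  have sym: "x \<bullet> (B0 *v y) = y \<bullet> (B0 *v x)" for x y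
    using symmetric_part_inner_commute[of "B0 *v x" A "B0 *v y"] by (simp add: B0 inner_commute)
  have pos0: "0 < x \<bullet> (B0 *v x)" if "x \<noteq> 0" for x
  proof -
    have "B0 *v x \<noteq> 0" using B0[of x] that by auto
    from pos[OF this] show ?thesis by (simp add: B0 inner_commute)
  qed
  have "compact (sphere (0::real^'n) 1)" "sphere (0::real^'n) 1 \<noteq> {}" by auto
  moreover have "continuous_on (sphere 0 1) (\<lambda>x. x \<bullet> (B0 *v x))" by (intro continuous_intros)
  ultimately obtain x0 where x0: "x0 \<in> sphere 0 1" "\<And>x. x \<in> sphere 0 1 \<Longrightarrow> x0 \<bullet> (B0 *v x0) \<le> x \<bullet> (B0 *v x)"
    using continuous_attains_inf[of "sphere (0::real^'n) 1" "\<lambda>x. x \<bullet> (B0 *v x)"] by blast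
  define \<mu> where "\<mu> = x0 \<bullet> (B0 *v x0)"
  have "0 < \<mu>" unfolding \<mu>_def using x0(1) by (intro pos0) auto
  have lower: "\<mu> * (norm x)\<^sup>2 \<le> x \<bullet> (B0 *v x)" for x
  proof (cases "x = 0")
    case False
    have "\<mu> \<le> ((1 / norm x) *\<^sub>R x) \<bullet> (B0 *v ((1 / norm x) *\<^sub>R x))"
      unfolding \<mu>_def using False by (intro x0(2)) auto
    also have "\<dots> = (x \<bullet> (B0 *v x)) / (norm x)\<^sup>2"
      by (simp add: matrix_vector_mult_scaleR power2_eq_square)
    finally show ?thesis using False by (simp add: pos_le_divide_eq)
  qed auto
  obtain b where b: "\<And>x. norm (B0 *v x) \<le> norm x * b"
    using bounded_linear.bounded[OF matrix_vector_mul_bounded_linear] by blast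
  have upper: "x \<bullet> (B0 *v x) \<le> b * (norm x)\<^sup>2" for x
  proof -
    have "x \<bullet> (B0 *v x) \<le> norm x * norm (B0 *v x)" by (rule norm_cauchy_schwarz)
    also have "\<dots> \<le> norm x * (norm x * b)" by (intro mult_left_mono b) auto
    finally show ?thesis by (simp add: power2_eq_square mult_ac)
  qed
  show thesis
  proof
    have *: "((1 / \<mu>) *\<^sub>R B0) *v x = (1 / \<mu>) *\<^sub>R (B0 *v x)" for x by (simp add: scaleR_matrix_vector_assoc)
    show "quadratic_kernel ((1 / \<mu>) *\<^sub>R B0) (b / \<mu>)"
    proof
      fix x y
      show "x \<bullet> ((1 / \<mu>) *\<^sub>R B0 *v y) = y \<bullet> ((1 / \<mu>) *\<^sub>R B0 *v x)"
        unfolding * using sym[of x y] by simp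
      show "(norm x)\<^sup>2 \<le> x \<bullet> ((1 / \<mu>) *\<^sub>R B0 *v x)"
        unfolding * using lower[of x] \<open>0 < \<mu>\<close> by (simp add: field_simps)
      show "x \<bullet> ((1 / \<mu>) *\<^sub>R B0 *v x) \<le> b / \<mu> * (norm x)\<^sup>2"
        unfolding * using upper[of x] \<open>0 < \<mu>\<close> by (simp add: divide_right_mono)
    qed
    show "0 < 1 / \<mu>" using \<open>0 < \<mu>\<close> by simp
    show "?S *v ((1 / \<mu>) *\<^sub>R B0 *v x) = (1 / \<mu>) *\<^sub>R x" for x
      unfolding * by (simp add: matrix_vector_mult_scaleR B0)
  qed
qed

text \<open>Gradient and Hessian are explicit arguments, so that rescaled copies and affine
  functions can enter Green's identity by writing their derivatives down.\<close>

definition classical_solution ::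
    "real ^ 'n ^ 'n \<Rightarrow> (real ^ 'n \<Rightarrow> real) \<Rightarrow> (real ^ 'n \<Rightarrow> real ^ 'n) \<Rightarrow> (real ^ 'n \<Rightarrow> real ^ 'n ^ 'n) \<Rightarrow> bool" where
  "classical_solution S v g H \<longleftrightarrow>
     (\<forall>x. (v has_derivative (\<lambda>h. h \<bullet> g x)) (at x)) \<and>
     (\<forall>x. (g has_derivative (\<lambda>h. H x *v h)) (at x)) \<and>
     continuous_on UNIV H \<and> (\<forall>x. trace (S ** H x) = 0)"

lemma divergence_form_solutionE:
  fixes A :: "real ^ 'n ^ 'n"
  assumes "divergence_form_solution A v"
  obtains g H where "classical_solution (symmetric_part A) v g H"
proof -
  obtain f' where f': "\<And>x. (v has_derivative blinfun_apply (f' x)) (at x)"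
    using assms unfolding divergence_form_solution_def continuously_differentiable_def by blast
  obtain G where G: "\<And>x. (gradient v has_derivative blinfun_apply (G x)) (at x)" and contG: "continuous_on UNIV G"
    using assms unfolding divergence_form_solution_def continuously_differentiable_def by blast
  have grad: "(v has_derivative (\<lambda>h. h \<bullet> gradient v x)) (at x)" for x
  proof -
    \<comment> \<open>The adjoint at 1 is the Riesz representative of the derivative, a witness for
      the definite description in \<open>gradient\<close>.\<close>
    define D where "D = adjoint (blinfun_apply (f' x)) 1"
    have "blinfun_apply (f' x) h = h \<bullet> D" for h
      unfolding D_def using adjoint_works[of "blinfun_apply (f' x)" h 1]
      by (simp add: linear_conv_bounded_linear blinfun.bounded_linear_right)
    then have "GDERIV v x :> D" using f'[of x] unfolding gderiv_def by (metis (no_types, lifting) ext)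
    then show ?thesis using gradient_eqI unfolding gderiv_def by metis
  qed
  define H where "H x = matrix (blinfun_apply (G x))" for x
  have HG: "H x *v h = blinfun_apply (G x) h" for x h
    unfolding H_def 
    by (intro matrix_works) (simp only: linear_matrix_vector_mul_eq bounded_linear.linear[OF blinfun.bounded_linear_right])
  have gH: "(gradient v has_derivative (\<lambda>h. H x *v h)) (at x)" for x using G[of x] HG by (metis (no_types, lifting) ext)
  have contH: "continuous_on UNIV H"
  proof -
    have "continuous_on UNIV (\<lambda>x. \<chi> i j. blinfun_apply (G x) (axis j 1) $ i)"
      by (intro continuous_intros contG)
    then show ?thesis unfolding H_def matrix_def .
  qed
  have symH: "transpose (H x) = H x" for x
  proof -
    have "H x $ i $ j = H x $ j $ i" for i j
      using second_derivative_symmetric[OF grad gH contH, of "axis i 1" "axis j 1" x]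
      by (simp add: matrix_vector_mult_basis inner_axis' column_def)
    then show ?thesis by (simp add: transpose_def vec_eq_iff)
  qed
  have tr: "trace (A ** H x) = 0" for x
  proof -
    have "((\<lambda>y. A *v gradient v y) has_derivative (\<lambda>h. A *v (H x *v h))) (at x)"
      by (rule bounded_linear.has_derivative[OF matrix_vector_mul_bounded_linear gH])
    then have "(\<lambda>h. A *v (H x *v h)) = frechet_derivative (\<lambda>y. A *v gradient v y) (at x)"
      by (rule frechet_derivative_at)
    then have "frechet_derivative (\<lambda>y. A *v gradient v y) (at x) = (\<lambda>h. (A ** H x) *v h)"
      by (simp add: matrix_vector_mul_assoc)
    then have "divergence (\<lambda>y. A *v gradient v y) x = trace (A ** H x)"
      by (simp add: divergence_def jacobian_def)
    then show ?thesis using assms unfolding divergence_form_solution_def by simp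
  qed
  \<comment> \<open>Transposing a product of matrices keeps its trace; as \<open>H x\<close> is
    symmetric, the trace with \<open>transpose A\<close> equals the one with
    \<open>A\<close>.\<close>
  have "trace (symmetric_part A ** H x) = 0" for x
  proof -
    have "trace (transpose A ** H x) = trace (transpose (transpose A ** H x))" by (simp add: trace_def transpose_def)
    also have "\<dots> = trace (H x ** A)" by (simp add: matrix_transpose_mul symH)
    also have "\<dots> = trace (A ** H x)" by (rule trace_mul_sym)
    finally have "trace (transpose A ** H x) = 0" using tr by simp
    then show ?thesis using tr
      unfolding symmetric_part_def trace_def matrix_matrix_mult_def
      by (simp add: distrib_right sum.distrib sum_divide_distrib[symmetric])
  qed
  then have "classical_solution (symmetric_part A) v (gradient v) H"
    unfolding classical_solution_def using grad gH contH by blast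
  then show thesis by (rule that)
qed

section \<open>Green's identity and the mean value property\<close>

lemma classical_solution_rescale:
  assumes "classical_solution S v g H"
  shows "classical_solution S (\<lambda>x. v (y + s *\<^sub>R x)) (\<lambda>x. s *\<^sub>R g (y + s *\<^sub>R x)) (\<lambda>x. s\<^sup>2 *\<^sub>R H (y + s *\<^sub>R x))"
proof -
  have v: "(v has_derivative (\<lambda>h. h \<bullet> g x)) (at x)" and g: "(g has_derivative (\<lambda>h. H x *v h)) (at x)"
    and H: "continuous_on UNIV H" and tr: "trace (S ** H x) = 0" for x
    using assms unfolding classical_solution_def by blast+
  have affine: "((\<lambda>x. y + s *\<^sub>R x) has_derivative (\<lambda>h. s *\<^sub>R h)) (at x)" for x :: "real ^ 'a"
    by (auto intro!: derivative_eq_intros)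
  have "((\<lambda>x. v (y + s *\<^sub>R x)) has_derivative (\<lambda>h. h \<bullet> s *\<^sub>R g (y + s *\<^sub>R x))) (at x)" for x
    by (rule has_derivative_eq_rhs[OF has_derivative_compose[OF affine v]]) (simp add: fun_eq_iff)
  moreover have "((\<lambda>x. s *\<^sub>R g (y + s *\<^sub>R x)) has_derivative (\<lambda>h. s\<^sup>2 *\<^sub>R H (y + s *\<^sub>R x) *v h)) (at x)" for x
    by (rule has_derivative_eq_rhs[OF has_derivative_scaleR_right[OF has_derivative_compose[OF affine g]]])
       (simp add: fun_eq_iff matrix_vector_mult_scaleR scaleR_matrix_vector_assoc[symmetric] power2_eq_square)
  moreover have "continuous_on UNIV (\<lambda>x. s\<^sup>2 *\<^sub>R H (y + s *\<^sub>R x))"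
    by (intro continuous_intros continuous_on_compose2[OF H]) auto
  moreover have "trace (S ** (s\<^sup>2 *\<^sub>R H (y + s *\<^sub>R x))) = 0" for x
  proof -
    have "trace (c *\<^sub>R M) = c * trace M" for c and M :: "real ^ 'a ^ 'a"
      by (simp add: trace_def sum_distrib_left)
    moreover have "S ** (s\<^sup>2 *\<^sub>R H (y + s *\<^sub>R x)) = s\<^sup>2 *\<^sub>R (S ** H (y + s *\<^sub>R x))"
      unfolding matrix_scalar_ac scalar_matrix_assoc by (rule refl)
    ultimately show ?thesis using tr by (simp only: mult_zero_right)
  qed
  ultimately show ?thesis unfolding classical_solution_def by blast
qed

lemma classical_solution_linear: "classical_solution S (\<lambda>x. a + x \<bullet> b) (\<lambda>x. b) (\<lambda>x. 0)"
  unfolding classical_solution_def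
  by (auto intro!: derivative_eq_intros continuous_intros simp: trace_def matrix_matrix_mult_def)

lemma classical_solution_continuous:
  assumes "classical_solution S v g H"
  shows "continuous_on UNIV v" "continuous_on UNIV g" "continuous_on UNIV H"
  using assms has_derivative_continuous unfolding classical_solution_def
  by (auto simp: continuous_on_eq_continuous_within) blast+

lemma sum_axis_inner_mult: "(\<Sum>i\<in>UNIV. (axis i 1 \<bullet> a) * b $ i) = (a::real^'n) \<bullet> b"
  by (simp add: inner_axis') (simp add: inner_vec_def)

lemma sum_matrix_axis: "(\<Sum>i\<in>UNIV. (S *v (H *v axis i 1)) $ i) = trace (S ** (H::real^'n^'n))"
  unfolding matrix_vector_mul_assoc by (simp add: matrix_vector_mult_basis column_def trace_def)

context quadratic_kernel
begin

lemma J_has_derivative: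
  fixes f :: "real \<Rightarrow> real ^ 'n \<Rightarrow> real"
  assumes deriv: "\<And>t x. ((\<lambda>t. f t x) has_real_derivative f' t x) (at t)"
    and f: "\<And>t. continuous_on UNIV (f t)" and f': "continuous_on UNIV (\<lambda>(t, x). f' t x)"
  shows "((\<lambda>t. J (f t)) has_real_derivative J (f' t)) (at t)"
proof -
  have cf': "continuous_on S (\<lambda>x. f' t x)" for S t
  proof -
    have "continuous_on S (\<lambda>x. (\<lambda>(t, x). f' t x) (t, x))"
      by (rule continuous_on_compose2[OF f']) (auto intro!: continuous_intros)
    then show ?thesis by simp
  qed
  have "((\<lambda>t. integral (cbox (- One) One) (\<lambda>x. f t x * w x)) has_field_derivative
      integral (cbox (- One) One) (\<lambda>x. f' t x * w x)) (at t within UNIV)"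
  proof (rule leibniz_rule_field_derivative)
    show "((\<lambda>t. f t x * w x) has_field_derivative f' t x * w x) (at t within UNIV)" for t x
      using deriv by (rule DERIV_cmult_right)
    show "(\<lambda>x. f t x * w x) integrable_on cbox (- One) One" for t
      by (intro integrable_continuous continuous_intros continuous_on_subset[OF f]) auto
    have "continuous_on UNIV (\<lambda>p. (\<lambda>(t, x). f' t x) p * w (snd p))"
      by (intro continuous_intros f')
    then show "continuous_on (UNIV \<times> cbox (- One) One) (\<lambda>(t, x). f' t x * w x)"
      by (auto simp: split_beta intro: continuous_on_subset)
  qed auto
  then show ?thesis using J_cbox[OF f] J_cbox[OF cf'] by simp
qed

text \<open>Green's identity for the weight \<open>w\<close>: since \<open>x * w x\<close> is a multiple of
  \<open>S \<nabla>\<psi>\<close> with \<open>\<psi> = - max 0 (1 - Q) ^ 3 / 6\<close>, integrating by parts leaves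
  \<open>\<psi> div (k S \<nabla>f - f S \<nabla>k) = 0\<close>.\<close>
lemma J_Green:
  assumes f: "classical_solution S f gf Hf" and k: "classical_solution S k gk Hk"
    and S_sym: "\<And>x y. x \<bullet> (S *v y) = y \<bullet> (S *v x)" and SB: "\<And>x. S *v (B *v x) = m *\<^sub>R x" and "0 < m"
  shows "J (\<lambda>x. k x * (x \<bullet> gf x) - f x * (x \<bullet> gk x)) = 0"
proof -
  note [continuous_intros] = classical_solution_continuous[OF f] classical_solution_continuous[OF k]
  define \<psi> where "\<psi> x = - (1 / 6) * max 0 (1 - Q x) ^ Suc (Suc 1)" for x
  define V where "V x = k x *\<^sub>R (S *v gf x) - f x *\<^sub>R (S *v gk x)" for x
  define DV where "DV x h = (k x *\<^sub>R (S *v (Hf x *v h)) + (h \<bullet> gk x) *\<^sub>R (S *v gf x)) - 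
    (f x *\<^sub>R (S *v (Hk x *v h)) + (h \<bullet> gf x) *\<^sub>R (S *v gk x))" for x h
  \<comment> \<open>\<open>D i\<close> is the partial derivative of \<open>\<psi>\<close> times the
    \<open>i\<close>-th component of \<open>V\<close>, so the sum over \<open>i\<close> is the
    divergence of \<open>\<psi> V\<close>.\<close>
  define D where "D i x = \<psi> x * DV x (axis i 1) $ i + w x * (axis i 1 \<bullet> (B *v x)) * V x $ i" for i x
  have \<psi>: "(\<psi> has_derivative (\<lambda>h. w x * (h \<bullet> (B *v x)))) (at x)" for x
    unfolding \<psi>_def[abs_def] w_def
    by (rule has_derivative_eq_rhs[OF has_derivative_mult_right[OF has_derivative_max_Q]])
       (simp add: fun_eq_iff power2_eq_square)
  have V: "(V has_derivative DV x) (at x)" for x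
  proof -
    have "(f has_derivative (\<lambda>h. h \<bullet> gf x)) (at x)" "(k has_derivative (\<lambda>h. h \<bullet> gk x)) (at x)"
      "(gf has_derivative (\<lambda>h. Hf x *v h)) (at x)" "(gk has_derivative (\<lambda>h. Hk x *v h)) (at x)"
      using f k unfolding classical_solution_def by blast+
    then show ?thesis
      unfolding V_def[abs_def] DV_def[abs_def]
      by (intro has_derivative_diff has_derivative_scaleR bounded_linear.has_derivative[OF matrix_vector_mul_bounded_linear])
  qed
  have \<psi>0: "\<psi> x = 0" if "1 \<le> norm x" for x
    using w_eq_0[OF that] by (simp add: w_def \<psi>_def)
  have cont\<psi>: "continuous_on UNIV \<psi>" unfolding \<psi>_def[abs_def] by (intro continuous_intros) auto
  have contD: "continuous_on UNIV (D i)" for i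
    unfolding D_def[abs_def] DV_def V_def by (intro continuous_intros cont\<psi>)
  have zero: "(\<integral>x. D i x \<partial>lborel) = 0" for i
  proof (rule integral_directional_derivative_eq_0[where F="\<lambda>x. \<psi> x * V x $ i" and e="axis i 1"])
    show "continuous_on UNIV (\<lambda>x. \<psi> x * V x $ i)"
      unfolding V_def by (intro continuous_intros cont\<psi>)
    fix x :: "real ^ 'n" and t :: real
    have "((\<lambda>t. x + t *\<^sub>R axis i 1) has_derivative (\<lambda>s. s *\<^sub>R axis i 1)) (at t)"
      by (auto intro!: derivative_eq_intros)
    moreover have "((\<lambda>x. \<psi> x * V x $ i) has_derivative
      (\<lambda>h. \<psi> y * DV y h $ i + w y * (h \<bullet> (B *v y)) * V y $ i)) (at y)" for y
      by (intro has_derivative_mult \<psi> bounded_linear.has_derivative[OF bounded_linear_vec_nth V])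
    ultimately have "((\<lambda>t. \<psi> (x + t *\<^sub>R axis i 1) * V (x + t *\<^sub>R axis i 1) $ i) has_derivative
      (\<lambda>s. \<psi> (x + t *\<^sub>R axis i 1) * DV (x + t *\<^sub>R axis i 1) (s *\<^sub>R axis i 1) $ i +
         w (x + t *\<^sub>R axis i 1) * (s *\<^sub>R axis i 1 \<bullet> (B *v (x + t *\<^sub>R axis i 1))) * V (x + t *\<^sub>R axis i 1) $ i)) (at t)"
      by (rule has_derivative_compose)
    moreover have "DV y (s *\<^sub>R h) = s *\<^sub>R DV y h" for y s h
      by (simp add: DV_def matrix_vector_mult_scaleR scaleR_right_diff_distrib scaleR_right_distrib mult.commute mult.left_commute)
    ultimately show "((\<lambda>t. \<psi> (x + t *\<^sub>R axis i 1) * V (x + t *\<^sub>R axis i 1) $ i) has_real_derivative D i (x + t *\<^sub>R axis i 1)) (at t)"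
      unfolding has_field_derivative_def D_def
      by (elim has_derivative_eq_rhs) (simp add: fun_eq_iff distrib_left distrib_right mult_ac)
    show "continuous_on UNIV (D i)" by (rule contD)
  qed (auto simp: \<psi>0 w_eq_0 D_def)
  \<comment> \<open>The field \<open>V\<close> is divergence free: the trace terms vanish by the
    equations and the mixed gradient terms cancel by symmetry of \<open>S\<close>. Only the gradient
    of \<open>\<psi>\<close> contributes, and \<open>S\<close> undoes the \<open>B\<close> in
    it.\<close>
  have sumD: "(\<Sum>i\<in>UNIV. D i x) = m * ((k x * (x \<bullet> gf x) - f x * (x \<bullet> gk x)) * w x)" for x
  proof -
    have "trace (S ** Hf x) = 0" "trace (S ** Hk x) = 0"
      using f k unfolding classical_solution_def by blast+
    then have "(\<Sum>i\<in>UNIV. DV x (axis i 1) $ i) = gk x \<bullet> (S *v gf x) - gf x \<bullet> (S *v gk x)"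
      unfolding DV_def by (simp add: sum.distrib sum_subtractf sum_distrib_left[symmetric] sum_axis_inner_mult sum_matrix_axis)
    then have 1: "(\<Sum>i\<in>UNIV. DV x (axis i 1) $ i) = 0" using S_sym[of "gk x" "gf x"] by simp
    have "(B *v x) \<bullet> V x = k x * ((B *v x) \<bullet> (S *v gf x)) - f x * ((B *v x) \<bullet> (S *v gk x))"
      by (simp add: V_def inner_diff_right)
    also have "\<dots> = m * (k x * (x \<bullet> gf x) - f x * (x \<bullet> gk x))"
      unfolding S_sym[of "B *v x"] SB by (simp add: inner_commute algebra_simps)
    finally have 2: "(B *v x) \<bullet> V x = m * (k x * (x \<bullet> gf x) - f x * (x \<bullet> gk x))" .
    have "(\<Sum>i\<in>UNIV. D i x) = \<psi> x * (\<Sum>i\<in>UNIV. DV x (axis i 1) $ i) + w x * (\<Sum>i\<in>UNIV. (axis i 1 \<bullet> (B *v x)) * V x $ i)"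
      unfolding D_def sum.distrib sum_distrib_left by (simp add: mult.assoc)
    then show ?thesis unfolding 1 sum_axis_inner_mult 2 by simp
  qed
  have intD: "integrable lborel (D i)" for i
    by (rule integrable_bounded_support[OF contD, where R=1]) (auto simp: \<psi>0 w_eq_0 D_def)
  have "m * J (\<lambda>x. k x * (x \<bullet> gf x) - f x * (x \<bullet> gk x)) = (\<integral>x. (\<Sum>i\<in>UNIV. D i x) \<partial>lborel)"
    unfolding sumD J_def by simp
  also have "\<dots> = (\<Sum>i\<in>UNIV. (\<integral>x. D i x \<partial>lborel))"
    by (rule Bochner_Integration.integral_sum) (rule intD)
  finally show ?thesis using zero \<open>0 < m\<close> by simp
qed

text \<open>A solution is only assumed twice continuously differentiable, so its derivatives need
  not be solutions in the same sense. This property is closed under differentiation and itself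
  implies differentiability, which allows the induction in the Liouville theorem.\<close>

definition mean_value :: "(real ^ 'n \<Rightarrow> real) \<Rightarrow> bool" where
  "mean_value v \<longleftrightarrow> continuous_on UNIV v \<and> (\<forall>y s. J (\<lambda>x. v (y + s *\<^sub>R x)) = v y * J (\<lambda>_. 1))"

text \<open>The integrated form of orthogonality between homogeneous parts of different degree,
  stated without any expansion of \<open>v\<close>.\<close>

definition dilation_symmetric :: "(real ^ 'n \<Rightarrow> real) \<Rightarrow> bool" where
  "dilation_symmetric v \<longleftrightarrow> (\<forall>y a b c d. 0 < a \<longrightarrow> 0 < b \<longrightarrow> 0 < c \<longrightarrow> 0 < d \<longrightarrow> a * b = c * d \<longrightarrow>
     J (\<lambda>x. v (y + a *\<^sub>R x) * v (y + b *\<^sub>R x)) = J (\<lambda>x. v (y + c *\<^sub>R x) * v (y + d *\<^sub>R x)))"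

lemma has_real_derivative_along_line:
  assumes "classical_solution S v g H"
    and "(r has_real_derivative r') (at t)"
  shows "((\<lambda>t. v (y + r t *\<^sub>R x)) has_real_derivative r' * (x \<bullet> g (y + r t *\<^sub>R x))) (at t)"
proof -
  have "((\<lambda>t. y + r t *\<^sub>R x) has_derivative (\<lambda>h. (r' * h) *\<^sub>R x)) (at t)"
    using assms(2) unfolding has_field_derivative_def by (auto intro!: derivative_eq_intros)
  moreover have "(v has_derivative (\<lambda>h. h \<bullet> g (y + r t *\<^sub>R x))) (at (y + r t *\<^sub>R x))"
    using assms(1) unfolding classical_solution_def by blast
  ultimately show ?thesis
    unfolding has_field_derivative_def
    by (rule has_derivative_eq_rhs[OF has_derivative_compose]) (simp add: fun_eq_iff)
qed

text \<open>Differentiating the mean in the radius produces the integral of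
  \<open>x \<bullet> g (y + t *\<^sub>R x)\<close>, which Green's identity against the constant 1
  annihilates.\<close>

lemma classical_solution_mean_value:
  assumes v: "classical_solution S v g H"
    and S_sym: "\<And>x y. x \<bullet> (S *v y) = y \<bullet> (S *v x)" and SB: "\<And>x. S *v (B *v x) = m *\<^sub>R x" and "0 < m"
  shows "mean_value v"
  unfolding mean_value_def
proof (intro conjI allI)
  note [continuous_intros] = continuous_on_compose2[OF classical_solution_continuous(1)[OF v]]
     continuous_on_compose2[OF classical_solution_continuous(2)[OF v]]
  show "continuous_on UNIV v" by (rule classical_solution_continuous[OF v])
  fix y s
  have one: "classical_solution S (\<lambda>x. 1) (\<lambda>x. 0) (\<lambda>x. 0)"
    using classical_solution_linear[of S 1 0] by simp
  have "((\<lambda>t. J (\<lambda>x. v (y + t *\<^sub>R x))) has_real_derivative 0) (at t)" for t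
  proof -
    have "((\<lambda>t. J (\<lambda>x. v (y + t *\<^sub>R x))) has_real_derivative J (\<lambda>x. 1 * (x \<bullet> g (y + t *\<^sub>R x)))) (at t)"
      by (rule J_has_derivative[OF has_real_derivative_along_line[OF v]])
         (auto intro!: continuous_intros simp: split_beta)
    moreover have "J (\<lambda>x. x \<bullet> g (y + t *\<^sub>R x)) = 0"
    \<comment> \<open>At \<open>t = 0\<close> the rescaled solution is constant and Green's identity
      says nothing about \<open>g y\<close>; the linear function with gradient \<open>g y\<close>
      replaces it.\<close>
    proof (cases "t = 0")
      case True
      then show ?thesis using J_Green[OF classical_solution_linear[of S 0 "g y"] one S_sym SB \<open>0 < m\<close>] by simp
    next
      case False
      have "t * J (\<lambda>x. x \<bullet> g (y + t *\<^sub>R x)) = 0"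
        using J_Green[OF classical_solution_rescale[OF v] one S_sym SB \<open>0 < m\<close>, of t y]
        unfolding J_cmult[symmetric] by simp
      then show ?thesis using False by simp
    qed
    ultimately show ?thesis by simp
  qed
  then have "J (\<lambda>x. v (y + s *\<^sub>R x)) = J (\<lambda>x. v (y + 0 *\<^sub>R x))"
    by (intro DERIV_isconst_all) auto
  then show "J (\<lambda>x. v (y + s *\<^sub>R x)) = v y * J (\<lambda>_. 1)"
    using J_const[of "v y"] by simp
qed

text \<open>The path \<open>(a * exp t, b * exp (- t))\<close> keeps the product fixed and reaches
  \<open>(c, d)\<close> at \<open>t = ln (c / a)\<close>. Along it the derivative is exactly the
  Green expression for the copies of \<open>v\<close> dilated by the two factors.\<close>

lemma classical_solution_dilation_symmetric:
  assumes v: "classical_solution S v g H"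
    and S_sym: "\<And>x y. x \<bullet> (S *v y) = y \<bullet> (S *v x)" and SB: "\<And>x. S *v (B *v x) = m *\<^sub>R x" and "0 < m"
  shows "dilation_symmetric v"
  unfolding dilation_symmetric_def
proof (intro allI impI)
  note [continuous_intros] = continuous_on_compose2[OF classical_solution_continuous(1)[OF v]]
     continuous_on_compose2[OF classical_solution_continuous(2)[OF v]]
  fix y and a b c d :: real assume pos: "0 < a" "0 < b" "0 < c" "0 < d" and eq: "a * b = c * d"
  define p where "p t = a * exp t" for t
  define q where "q t = b * exp (- t)" for t
  have p: "(p has_real_derivative p t) (at t)" for t
    unfolding p_def[abs_def] by (auto intro!: derivative_eq_intros)
  have q: "(q has_real_derivative - q t) (at t)" for t
    unfolding q_def[abs_def] by (auto intro!: derivative_eq_intros)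
  have [continuous_intros]: "continuous_on X f \<Longrightarrow> continuous_on X (\<lambda>x. p (f x))" 
    "continuous_on X f \<Longrightarrow> continuous_on X (\<lambda>x. q (f x))" for X :: "'b::topological_space set" and f
    unfolding p_def q_def by (intro continuous_intros; assumption)+
  define F where "F t = (\<lambda>x. v (y + p t *\<^sub>R x) * v (y + q t *\<^sub>R x))" for t
  define F' where "F' t = (\<lambda>x. v (y + q t *\<^sub>R x) * (x \<bullet> (p t *\<^sub>R g (y + p t *\<^sub>R x))) - v (y + p t *\<^sub>R x) * (x \<bullet> (q t *\<^sub>R g (y + q t *\<^sub>R x))))" for t
  have "((\<lambda>t. J (F t)) has_real_derivative 0) (at t)" for t
  proof -
    have "((\<lambda>t. J (F t)) has_real_derivative J (F' t)) (at t)"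
    proof (rule J_has_derivative)
      show "((\<lambda>t. F t x) has_real_derivative F' t x) (at t)" for t x
        unfolding F_def F'_def
        by (rule DERIV_cong[OF DERIV_mult[OF has_real_derivative_along_line[OF v p] has_real_derivative_along_line[OF v q]]]) simp
      show "continuous_on UNIV (F t)" for t
        unfolding F_def by (intro continuous_intros) auto
      show "continuous_on UNIV (\<lambda>(t, x). F' t x)"
        unfolding F'_def split_beta by (intro continuous_intros) auto
    qed
    moreover have "J (F' t) = 0"
      unfolding F'_def
      by (rule J_Green[OF classical_solution_rescale[OF v] classical_solution_rescale[OF v] S_sym SB \<open>0 < m\<close>])
    ultimately show ?thesis by simp
  qed
  then have "J (F (ln (c / a))) = J (F 0)"
    by (intro DERIV_isconst_all) auto
  moreover have "p (ln (c / a)) = c" "p 0 = a" "q 0 = b" using pos by (auto simp: p_def q_def)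
  moreover have "q (ln (c / a)) = d" using pos eq by (simp add: q_def exp_minus field_simps)
  ultimately show "J (\<lambda>x. v (y + a *\<^sub>R x) * v (y + b *\<^sub>R x)) = J (\<lambda>x. v (y + c *\<^sub>R x) * v (y + d *\<^sub>R x))"
    by (simp add: F_def)
qed

end

section \<open>A Liouville theorem\<close>

text \<open>\<open>q k\<close> is the homogeneous part of degree \<open>k\<close>. Its vanishing
  beyond \<open>d\<close> is carried along so that products can be expanded by the Cauchy
  product.\<close>

lemma real_polynomial_function_homogeneous_expansion:
  fixes p :: "'a::real_normed_vector \<Rightarrow> real"
  assumes "real_polynomial_function p"
  shows "\<exists>d q. (\<forall>k. real_polynomial_function (q k)) \<and> (\<forall>k x. k > d \<longrightarrow> q k x = 0) \<and>
    (\<forall>x t. p (t *\<^sub>R x) = (\<Sum>k\<le>d. q k x * t ^ k))"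
  using assms
proof (induction rule: real_polynomial_function.induct)
  case (linear f)
  note f = real_polynomial_function.intros(1)[OF linear]
  interpret bounded_linear f by fact
  let ?q = "\<lambda>k::nat. if k = 1 then f else (\<lambda>_. 0)"
  have A: "real_polynomial_function (?q k)" for k
    by (cases "k = 1") (simp_all add: f real_polynomial_function.intros(2))
  have B: "?q k x = 0" if "k > 1" for k x
    using that by simp
  have C: "f (t *\<^sub>R x) = (\<Sum>k\<le>1. ?q k x * t ^ k)" for x t
    by (simp add: scaleR)
  show ?case
    by (intro exI[of _ "1"] exI[of _ ?q] conjI allI impI; (rule A | rule C | rule B; assumption))
next
  case (const c)
  let ?q = "\<lambda>(k::nat) (x::'a). if k = 0 then c else 0"
  have A: "real_polynomial_function (?q k)" for k
    by (rule real_polynomial_function.intros(2))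
  have B: "?q k x = 0" if "k > 0" for k x
    using that by simp
  have C: "c = (\<Sum>k\<le>0. ?q k x * t ^ k)" for x and t :: real
    by simp
  show ?case
    by (intro exI[of _ "0"] exI[of _ ?q] conjI allI impI; (rule A | rule C | rule B; assumption))
next
  case (add f g)
  obtain d1 q1 where
    q1: "\<And>k. real_polynomial_function (q1 k)" "\<And>k x. k > d1 \<Longrightarrow> q1 k x = 0" "\<And>x t. f (t *\<^sub>R x) = (\<Sum>k\<le>d1. q1 k x * t ^ k)"
    using add.IH(1) by blast
  obtain d2 q2 where
    q2: "\<And>k. real_polynomial_function (q2 k)" "\<And>k x. k > d2 \<Longrightarrow> q2 k x = 0" "\<And>x t. g (t *\<^sub>R x) = (\<Sum>k\<le>d2. q2 k x * t ^ k)"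
    using add.IH(2) by blast
  have 1: "f (t *\<^sub>R x) = (\<Sum>k\<le>max d1 d2. q1 k x * t ^ k)" for x t
    unfolding q1(3) by (rule sum.mono_neutral_left) (auto simp: q1(2))
  have 2: "g (t *\<^sub>R x) = (\<Sum>k\<le>max d1 d2. q2 k x * t ^ k)" for x t
    unfolding q2(3) by (rule sum.mono_neutral_left) (auto simp: q2(2))
  let ?q = "\<lambda>k x. q1 k x + q2 k x"
  have A: "real_polynomial_function (?q k)" for k
    by (intro real_polynomial_function.intros(3) q1 q2)
  have B: "?q k x = 0" if "k > max d1 d2" for k x
    using that by (simp add: q1(2) q2(2))
  have C: "f (t *\<^sub>R x) + g (t *\<^sub>R x) = (\<Sum>k\<le>max d1 d2. ?q k x * t ^ k)" for x t
    by (simp add: 1 2 sum.distrib distrib_right)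
  show ?case
    by (intro exI[of _ "max d1 d2"] exI[of _ ?q] conjI allI impI; (rule A | rule C | rule B; assumption))
next
  case (mult f g)
  obtain d1 q1 where
    q1: "\<And>k. real_polynomial_function (q1 k)" "\<And>k x. k > d1 \<Longrightarrow> q1 k x = 0" "\<And>x t. f (t *\<^sub>R x) = (\<Sum>k\<le>d1. q1 k x * t ^ k)"
    using mult.IH(1) by blast
  obtain d2 q2 where
    q2: "\<And>k. real_polynomial_function (q2 k)" "\<And>k x. k > d2 \<Longrightarrow> q2 k x = 0" "\<And>x t. g (t *\<^sub>R x) = (\<Sum>k\<le>d2. q2 k x * t ^ k)"
    using mult.IH(2) by blast
  have "q1 k x * q2 (r - k) x = 0" if "r > d1 + d2" for r k x
    using q1(2)[of k x] q2(2)[of "r - k" x] that by (cases "k > d1") auto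
  then have B: "(\<Sum>k\<le>r. q1 k x * q2 (r - k) x) = 0" if "r > d1 + d2" for r x
    using that by (intro sum.neutral) blast
  have C: "f (t *\<^sub>R x) * g (t *\<^sub>R x) = (\<Sum>r\<le>d1 + d2. (\<Sum>k\<le>r. q1 k x * q2 (r - k) x) * t ^ r)" for x t
    unfolding q1(3) q2(3) by (rule polynomial_product) (auto simp: q1(2) q2(2))
  have A: "real_polynomial_function (\<lambda>x. \<Sum>k\<le>r. q1 k x * q2 (r - k) x)" for r
    by (intro real_polynomial_function_sum real_polynomial_function.intros(4) q1 q2) auto
  show ?case
    by (intro exI[of _ "d1 + d2"] exI[of _ "\<lambda>r x. \<Sum>k\<le>r. q1 k x * q2 (r - k) x"] conjI allI impI; (rule A | rule C | rule B; assumption))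
qed

text \<open>\<open>D\<close> is the Euler derivative, the gradient of \<open>v\<close> paired with
  the position. Radial integration divides its part of degree \<open>k\<close> by \<open>k\<close>;
  \<open>D 0 = 0\<close> removes the degree 0 part, which would produce a logarithm.\<close>

lemma real_polynomial_function_radial_primitive:
  fixes v :: "'a::euclidean_space \<Rightarrow> real"
  assumes v: "continuous_on UNIV v" and D: "real_polynomial_function D" and "D 0 = 0"
    and deriv: "\<And>x t. t > 0 \<Longrightarrow> ((\<lambda>t. v (t *\<^sub>R x)) has_real_derivative D (t *\<^sub>R x) / t) (at t)"
  shows "real_polynomial_function v"
proof -
  obtain d q where q: "\<And>k. real_polynomial_function (q k)" "\<And>x t. D (t *\<^sub>R x) = (\<Sum>k\<le>d. q k x * t ^ k)"
    using real_polynomial_function_homogeneous_expansion[OF D] by metis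
  have "D (0 *\<^sub>R x) = q 0 x" for x unfolding q(2) by (subst sum.atMost_shift) simp
  then have q0: "q 0 x = 0" for x using \<open>D 0 = 0\<close> by simp
  define P where "P x t = (\<Sum>k\<in>{1..d}. q k x / real k * t ^ k)" for x t
  have P: "(P x has_real_derivative D (t *\<^sub>R x) / t) (at t)" if "t > 0" for x t
  proof -
    have "(P x has_real_derivative (\<Sum>k\<in>{1..d}. q k x / real k * (real k * t ^ (k - 1)))) (at t)"
      unfolding P_def[abs_def]
      by (rule DERIV_sum) (auto intro!: derivative_eq_intros)
    also have "(\<Sum>k\<in>{1..d}. q k x / real k * (real k * t ^ (k - 1))) = (\<Sum>k\<in>{1..d}. q k x * t ^ k / t)"
      using that by (intro sum.cong) (auto simp: power_diff)
    also have "\<dots> = D (t *\<^sub>R x) / t"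
      unfolding q(2) sum_divide_distrib
      by (rule sum.mono_neutral_left) (auto simp: q0 not_less_eq_eq Suc_le_eq)
    finally show ?thesis .
  qed
  have "v x = v 0 + P x 1" for x
  proof -
    have "v (1 *\<^sub>R x) - P x 1 = v (0 *\<^sub>R x) - P x 0"
    proof (rule DERIV_isconst_end[where f="\<lambda>t. v (t *\<^sub>R x) - P x t"])
      show "continuous_on {0..1} (\<lambda>t. v (t *\<^sub>R x) - P x t)"
        unfolding P_def by (intro continuous_intros continuous_on_compose2[OF v]) auto
      show "((\<lambda>t. v (t *\<^sub>R x) - P x t) has_real_derivative 0) (at t)" if "0 < t" "t < 1" for t
        using DERIV_diff[OF deriv[OF \<open>0 < t\<close>, of x] P[OF \<open>0 < t\<close>, of x]] by simp
    qed simp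
    moreover have "P x 0 = 0" unfolding P_def by (rule sum.neutral) auto
    ultimately show ?thesis by simp
  qed
  moreover have "real_polynomial_function (\<lambda>x. v 0 + P x 1)"
    unfolding P_def divide_inverse power_one mult_1_right
    by (intro real_polynomial_function_sum real_polynomial_function.intros q) auto
  ultimately show ?thesis by (metis (no_types, lifting) ext)
qed

section \<open>Derivatives of functions with the mean value property\<close>

context quadratic_kernel
begin

lemma has_derivative_w: "(w has_derivative (\<lambda>e. - 4 * max 0 (1 - Q x) * (e \<bullet> (B *v x)))) (at x)"
  unfolding w_def[abs_def] numeral_2_eq_2
  by (rule has_derivative_eq_rhs[OF has_derivative_max_Q]) (simp add: fun_eq_iff)

text \<open>The derivative of \<open>v\<close> along \<open>e\<close> with the differentiation moved
  onto the weight: up to the factor 4, the kernel is minus the derivative of \<open>w\<close> along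
  \<open>e\<close>.\<close>

definition directional :: "(real ^ 'n \<Rightarrow> real) \<Rightarrow> real ^ 'n \<Rightarrow> real ^ 'n \<Rightarrow> real" where
  "directional v e x = (4 / J (\<lambda>_. 1)) *
     integral (cbox (- One) One) (\<lambda>z. v (x + z) * (max 0 (1 - Q z) * (e \<bullet> (B *v z))))"

lemma mean_valueD: 
  assumes "mean_value v"
  shows "continuous_on UNIV v" and "J (\<lambda>x. v (y + s *\<^sub>R x)) = v y * J (\<lambda>_. 1)"
  using assms unfolding mean_value_def by auto

lemma max_Q_eq_0: "1 \<le> norm z \<Longrightarrow> max 0 (1 - Q z) = 0"
  using w_eq_0[of z] by (simp add: w_def)

lemma not_in_unit_cbox: "z \<notin> cbox (- One) One \<Longrightarrow> 1 \<le> norm (z :: real ^ 'n)"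
proof (erule contrapos_np)
  assume "\<not> 1 \<le> norm z"
  then have "\<bar>z \<bullet> i\<bar> \<le> 1" if "i \<in> Basis" for i
    using Basis_le_norm[OF that, of z] by linarith
  then show "z \<in> cbox (- One) One" by (simp add: mem_box abs_le_iff minus_le_iff)
qed

lemma continuous_on_directional:
  assumes "mean_value v"
  shows "continuous_on UNIV (directional v e)"
proof -
  have "continuous_on UNIV (\<lambda>x. integral (cbox (- One) One) (\<lambda>z. v (x + z) * (max 0 (1 - Q z) * (e \<bullet> (B *v z)))))"
    by (rule integral_continuous_on_param)
       (auto simp: split_beta intro!: continuous_intros continuous_on_compose2[OF mean_valueD(1)[OF assms]])
  then show ?thesis unfolding directional_def[abs_def] by (intro continuous_intros)
qed

text \<open>Translating the integration variable in the mean value identity at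
  \<open>x + t *\<^sub>R e\<close> leaves \<open>t\<close> only inside \<open>w\<close>, which is
  differentiable although \<open>v\<close> is merely known to be continuous.\<close>

lemma directional_has_derivative:
  assumes v: "mean_value v"
  shows "((\<lambda>t. v (x + t *\<^sub>R e)) has_real_derivative directional v e (x + t *\<^sub>R e)) (at t)"
proof -
  note contv = mean_valueD(1)[OF v]
  have main: "((\<lambda>t. v (x + t *\<^sub>R e)) has_real_derivative directional v e x) (at 0)" if "norm e \<le> 1" for x e
  proof -
    let ?K = "cbox (- (2 *\<^sub>R One)) (2 *\<^sub>R One) :: (real ^ 'n) set"
    have K: "2 \<le> norm z" if "z \<notin> ?K" for z
    proof -
      have "(1/2) *\<^sub>R z \<notin> cbox (- One) One" using that by (auto simp: mem_box)
      from not_in_unit_cbox[OF this] show ?thesis by simp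
    qed
    define I where "I t = integral ?K (\<lambda>z. v (x + z) * w (z - t *\<^sub>R e))" for t
    have I: "I t = v (x + t *\<^sub>R e) * J (\<lambda>_. 1)" if "t \<in> {-1..1}" for t
    proof -
      have "norm (t *\<^sub>R e) \<le> 1" using that \<open>norm e \<le> 1\<close> by (simp add: abs_le_iff mult_le_one)
      then have "w (z - t *\<^sub>R e) = 0" if "z \<notin> ?K" for z
        using K[OF that] norm_triangle_ineq2[of z "t *\<^sub>R e"] by (intro w_eq_0) simp
      then have "I t = (\<integral>z. v (x + z) * w (z - t *\<^sub>R e) \<partial>lborel)"
        unfolding I_def by (intro integral_lborel_bounded_support[symmetric])
          (auto intro!: continuous_intros continuous_on_compose2[OF contv])
      also have "\<dots> = (\<integral>z. v (x + (t *\<^sub>R e + z)) * w z \<partial>lborel)"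
        by (subst integral_lborel_affine[where c=1 and t="t *\<^sub>R e"])
           (auto intro!: borel_measurable_continuous_onI continuous_intros continuous_on_compose2[OF contv])
      also have "\<dots> = v (x + t *\<^sub>R e) * J (\<lambda>_. 1)"
        using mean_valueD(2)[OF v, of "x + t *\<^sub>R e" 1] by (simp add: J_def add.assoc)
      finally show ?thesis .
    qed
    let ?D = "\<lambda>t z. v (x + z) * (4 * max 0 (1 - Q (z - t *\<^sub>R e)) * (e \<bullet> (B *v (z - t *\<^sub>R e))))"
    have "(I has_field_derivative integral ?K (?D 0)) (at 0 within {-1..1})"
      unfolding I_def
    proof (rule leibniz_rule_field_derivative[where fx="?D"])
      fix t z
      have "((\<lambda>t. z - t *\<^sub>R e) has_derivative (\<lambda>h. - h *\<^sub>R e)) (at t within {-1..1})"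
        by (auto intro!: derivative_eq_intros)
      from has_derivative_compose[OF this has_derivative_w]
      have "((\<lambda>t. w (z - t *\<^sub>R e)) has_field_derivative (4 * max 0 (1 - Q (z - t *\<^sub>R e)) * (e \<bullet> (B *v (z - t *\<^sub>R e))))) (at t within {-1..1})"
        unfolding has_field_derivative_def by (rule has_derivative_eq_rhs) (simp add: fun_eq_iff)
      then show "((\<lambda>t. v (x + z) * w (z - t *\<^sub>R e)) has_field_derivative ?D t z) (at t within {-1..1})"
        by (rule DERIV_cmult)
    next
      show "continuous_on ({-1..1} \<times> ?K) (\<lambda>(t, z). ?D t z)"
        unfolding split_beta by (intro continuous_intros continuous_on_compose2[OF contv]) auto
      show "(\<lambda>z. v (x + z) * w (z - t *\<^sub>R e)) integrable_on ?K" for t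
        by (intro integrable_continuous continuous_intros continuous_on_compose2[OF contv]) auto
    qed auto
    also have "at (0::real) within {-1..1} = at 0" by (rule at_within_interior) simp
    finally have "(I has_field_derivative integral ?K (?D 0)) (at 0)" .
    then have "((\<lambda>t. v (x + t *\<^sub>R e) * J (\<lambda>_. 1)) has_field_derivative integral ?K (?D 0)) (at 0)"
      by (rule has_field_derivative_transform_within[where d=1]) (auto simp: I dist_real_def abs_less_iff)
    from DERIV_cdivide[OF this, of "J (\<lambda>_. 1)"]
    have "((\<lambda>t. v (x + t *\<^sub>R e)) has_field_derivative integral ?K (?D 0) / J (\<lambda>_. 1)) (at 0)"
      using J_one_pos by simp
    moreover have "integral ?K (?D 0) = 4 * integral (cbox (- One) One) (\<lambda>z. v (x + z) * (max 0 (1 - Q z) * (e \<bullet> (B *v z))))"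
    proof -
      have c: "continuous_on UNIV (\<lambda>z. v (x + z) * (max 0 (1 - Q z) * (e \<bullet> (B *v z))))"
        by (intro continuous_intros continuous_on_compose2[OF contv]) auto
      have "integral ?K (\<lambda>z. v (x + z) * (max 0 (1 - Q z) * (e \<bullet> (B *v z)))) = integral (cbox (- One) One) (\<lambda>z. v (x + z) * (max 0 (1 - Q z) * (e \<bullet> (B *v z))))"
        using integral_lborel_bounded_support[OF c, of "- (2 *\<^sub>R One)" "2 *\<^sub>R One"] K
          integral_lborel_bounded_support[OF c, of "- One" One] not_in_unit_cbox max_Q_eq_0
        by (smt (verit, ccfv_threshold) mult_eq_0_iff)
      moreover have "?D 0 = (\<lambda>z. 4 * (v (x + z) * (max 0 (1 - Q z) * (e \<bullet> (B *v z)))))"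
        by (simp add: fun_eq_iff)
      ultimately show ?thesis by (simp only: integral_mult_right)
    qed
    ultimately show ?thesis by (simp add: directional_def)
  qed
  \<comment> \<open>Short directions were needed to keep the shifted weights inside one box; both
    sides are homogeneous in \<open>e\<close>.\<close>
  have any: "((\<lambda>t. v (x + t *\<^sub>R e)) has_real_derivative directional v e x) (at 0)" for x
  proof (cases "e = 0")
    case True
    then show ?thesis by (simp add: directional_def)
  next
    case False
    define c where "c = norm e"
    have "c > 0" using False by (simp add: c_def)
    have "((\<lambda>t. v (x + t *\<^sub>R ((1 / c) *\<^sub>R e))) has_real_derivative directional v ((1 / c) *\<^sub>R e) x) (at (c * 0))"
      using main[of "(1 / c) *\<^sub>R e" x] False by (simp add: c_def)
    from DERIV_chain'[OF DERIV_cmult_Id this]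
    have "((\<lambda>t. v (x + t *\<^sub>R e)) has_real_derivative directional v ((1 / c) *\<^sub>R e) x * c) (at 0)"
      using \<open>c > 0\<close> by simp
    moreover have "directional v ((1 / c) *\<^sub>R e) x * c = directional v e x"
    proof -
      have "(\<lambda>z. v (x + z) * (max 0 (1 - Q z) * ((1 / c) *\<^sub>R e \<bullet> (B *v z)))) =
        (\<lambda>z. (1 / c) * (v (x + z) * (max 0 (1 - Q z) * (e \<bullet> (B *v z)))))" by (simp add: fun_eq_iff)
      then show ?thesis using \<open>c > 0\<close> by (simp only: directional_def integral_mult_right) simp
    qed
    ultimately show ?thesis by simp
  qed
  have "((\<lambda>h. v (x + (t + h) *\<^sub>R e)) has_real_derivative directional v e (x + t *\<^sub>R e)) (at 0)"
    using any[of "x + t *\<^sub>R e"] by (simp add: scaleR_left_distrib add.assoc)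
  then show ?thesis using DERIV_shift[of "\<lambda>t. v (x + t *\<^sub>R e)" _ 0 t] by (simp add: add.commute)
qed

text \<open>Shift the centre in the mean value identity of \<open>v\<close> along \<open>e\<close>
  and differentiate both sides at 0.\<close>

lemma mean_value_directional:
  assumes v: "mean_value v"
  shows "mean_value (directional v e)"
  unfolding mean_value_def
proof (intro conjI allI)
  show "continuous_on UNIV (directional v e)" by (rule continuous_on_directional[OF v])
  fix y s
  have "((\<lambda>t. J (\<lambda>x. v ((y + s *\<^sub>R x) + t *\<^sub>R e))) has_real_derivative J (\<lambda>x. directional v e ((y + s *\<^sub>R x) + 0 *\<^sub>R e))) (at 0)"
    by (rule J_has_derivative[OF directional_has_derivative[OF v]])
       (auto simp: split_beta intro!: continuous_intros continuous_on_compose2[OF mean_valueD(1)[OF v]] continuous_on_compose2[OF continuous_on_directional[OF v]])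
  also have "(\<lambda>t. J (\<lambda>x. v ((y + s *\<^sub>R x) + t *\<^sub>R e))) = (\<lambda>t. v (y + t *\<^sub>R e) * J (\<lambda>_. 1))"
    using mean_valueD(2)[OF v, of "y + _ *\<^sub>R e" s] by (simp add: fun_eq_iff add_ac)
  finally have "((\<lambda>t. v (y + t *\<^sub>R e) * J (\<lambda>_. 1)) has_real_derivative J (\<lambda>x. directional v e (y + s *\<^sub>R x))) (at 0)" by simp
  moreover have "((\<lambda>t. v (y + t *\<^sub>R e) * J (\<lambda>_. 1)) has_real_derivative directional v e (y + 0 *\<^sub>R e) * J (\<lambda>_. 1)) (at 0)"
    by (rule DERIV_cmult_right[OF directional_has_derivative[OF v]])
  ultimately show "J (\<lambda>x. directional v e (y + s *\<^sub>R x)) = directional v e y * J (\<lambda>_. 1)"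
    using DERIV_unique by fastforce
qed

lemma mean_value_rescale:
  assumes v: "mean_value v"
  shows "mean_value (\<lambda>x. v (y + s *\<^sub>R x))"
  unfolding mean_value_def
proof (intro conjI allI)
  show "continuous_on UNIV (\<lambda>x. v (y + s *\<^sub>R x))"
    by (intro continuous_intros continuous_on_compose2[OF mean_valueD(1)[OF v]]) auto
  show "J (\<lambda>x. v (y + s *\<^sub>R (z + t *\<^sub>R x))) = v (y + s *\<^sub>R z) * J (\<lambda>_. 1)" for z t
    using mean_valueD(2)[OF v, of "y + s *\<^sub>R z" "s * t"] by (simp add: scaleR_right_distrib add.assoc)
qed

text \<open>An interior gradient estimate: the kernel has finite mass at unit scale, and dilating by
  \<open>t\<close> gains the factor \<open>1 / t\<close>. The constant depends on \<open>e\<close>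
  but not on the function.\<close>

lemma directional_bound:
  obtains C where "0 \<le> C" and "\<And>v M x t. mean_value v \<Longrightarrow> 0 < t \<Longrightarrow> (\<And>z. norm z \<le> t \<Longrightarrow> \<bar>v (x + z)\<bar> \<le> M)
    \<Longrightarrow> \<bar>directional v e x\<bar> \<le> C * M / t"
proof
  define k where "k z = \<bar>max 0 (1 - Q z) * (e \<bullet> (B *v z))\<bar>" for z
  have contk: "continuous_on S k" for S unfolding k_def[abs_def] by (intro continuous_intros)
  define C where "C = (4 / J (\<lambda>_. 1)) * integral (cbox (- One) One) k"
  show "0 \<le> C" unfolding C_def using J_one_pos by (intro mult_nonneg_nonneg integral_nonneg integrable_continuous contk) (auto simp: k_def)
  have one: "\<bar>directional v e 0\<bar> \<le> C * M" if v: "mean_value v" and M: "\<And>z. norm z \<le> 1 \<Longrightarrow> \<bar>v z\<bar> \<le> M" for v M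
  proof -
    have "norm (integral (cbox (- One) One) (\<lambda>z. v (0 + z) * (max 0 (1 - Q z) * (e \<bullet> (B *v z))))) \<le> integral (cbox (- One) One) (\<lambda>z. M * k z)"
    proof (rule integral_norm_bound_integral)
      fix z :: "real ^ 'n"
      show "norm (v (0 + z) * (max 0 (1 - Q z) * (e \<bullet> (B *v z)))) \<le> M * k z"
      proof (cases "norm z \<le> 1")
        case True
        have "\<bar>v z\<bar> * k z \<le> M * k z" by (rule mult_right_mono[OF M[OF True]]) (simp add: k_def)
        then show ?thesis by (simp add: abs_mult k_def)
      qed (simp add: max_Q_eq_0 k_def)
    qed (auto intro!: integrable_continuous continuous_intros contk continuous_on_compose2[OF mean_valueD(1)[OF v]])
    then have "\<bar>directional v e 0\<bar> \<le> (4 / J (\<lambda>_. 1)) * (M * integral (cbox (- One) One) k)"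
      unfolding directional_def using J_one_pos by (simp add: abs_mult mult_left_mono divide_right_mono)
    then show ?thesis by (simp add: C_def mult_ac)
  qed
  fix v M x and t :: real
  assume v: "mean_value v" and "0 < t" and M: "\<And>z. norm z \<le> t \<Longrightarrow> \<bar>v (x + z)\<bar> \<le> M"
  let ?u = "\<lambda>z. v (x + t *\<^sub>R z)"
  have u: "mean_value ?u" by (rule mean_value_rescale[OF v])
  have "((\<lambda>s. v (x + t *\<^sub>R (0 + s *\<^sub>R e))) has_real_derivative directional ?u e (0 + 0 *\<^sub>R e)) (at 0)"
    by (rule directional_has_derivative[OF u])
  moreover have "((\<lambda>s. v (x + (t * s) *\<^sub>R e)) has_real_derivative directional v e (x + (t * 0) *\<^sub>R e) * t) (at 0)"
    by (rule DERIV_chain'[OF DERIV_cmult_Id directional_has_derivative[OF v]])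
  ultimately have "directional ?u e 0 = directional v e x * t"
    using DERIV_unique by fastforce
  moreover have "\<bar>directional ?u e 0\<bar> \<le> C * M"
    by (rule one[OF u]) (use M \<open>0 < t\<close> in simp)
  ultimately show "\<bar>directional v e x\<bar> \<le> C * M / t" using \<open>0 < t\<close> by (simp add: abs_mult pos_le_divide_eq)
qed

lemma directional_sum:
  assumes "mean_value v"
  shows "directional v x y = (\<Sum>i\<in>UNIV. x $ i * directional v (axis i 1) y)"
proof -
  let ?f = "\<lambda>i z. v (y + z) * (max 0 (1 - Q z) * (axis i 1 \<bullet> (B *v z)))"
  have "(\<lambda>z. v (y + z) * (max 0 (1 - Q z) * (x \<bullet> (B *v z)))) = (\<lambda>z. \<Sum>i\<in>UNIV. x $ i * ?f i z)"
    by (rule ext) (simp add: inner_axis' inner_vec_def[of x] sum_distrib_left mult_ac)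
  moreover have "integral (cbox (- One) One) (\<lambda>z. \<Sum>i\<in>UNIV. x $ i * ?f i z) = (\<Sum>i\<in>UNIV. integral (cbox (- One) One) (\<lambda>z. x $ i * ?f i z))"
    by (rule integral_sum) (auto intro!: integrable_continuous continuous_intros continuous_on_compose2[OF mean_valueD(1)[OF assms]])
  ultimately show ?thesis by (simp only: directional_def integral_mult_right) (simp add: sum_distrib_left mult_ac)
qed

text \<open>The gradient estimate on the ball of radius \<open>1 + norm x\<close> lowers the growth
  exponent by one. For exponent 0 letting the radius grow makes every derivative vanish.\<close>

lemma mean_value_polynomial_growth:
  assumes "mean_value v" and "\<And>x. \<bar>v x\<bar> \<le> C * (1 + norm x) ^ m"
  shows "real_polynomial_function v"
  using assms
proof (induction m arbitrary: v C)
  case 0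
  have C: "0 \<le> C" using "0.prems"(2)[of 0] by simp
  have "directional v e x = 0" for e x
  proof (rule ccontr)
    assume nz: "directional v e x \<noteq> 0"
    obtain K where K: "0 \<le> K" "\<And>v M x t. mean_value v \<Longrightarrow> 0 < t \<Longrightarrow> (\<And>z. norm z \<le> t \<Longrightarrow> \<bar>v (x + z)\<bar> \<le> M)
      \<Longrightarrow> \<bar>directional v e x\<bar> \<le> K * M / t" by (rule directional_bound[of e]) (rule that; blast)
    have bound: "\<bar>directional v e x\<bar> \<le> K * C / t" if "0 < t" for t
      by (rule K(2)[OF "0.prems"(1) that]) (use "0.prems"(2) in simp)
    \<comment> \<open>A radius large enough for the gradient bound \<open>K * C / t\<close> to drop
      below the supposedly nonzero derivative.\<close>
    define t where "t = (K * C + 1) / \<bar>directional v e x\<bar>"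
    have "0 < t" unfolding t_def using nz K(1) C by (intro divide_pos_pos) (auto intro: add_nonneg_pos)
    from bound[OF this] have "\<bar>directional v e x\<bar> * t \<le> K * C" using \<open>0 < t\<close> by (simp add: pos_le_divide_eq)
    then show False using nz by (simp add: t_def)
  qed
  then have "((\<lambda>t. v (0 + t *\<^sub>R x)) has_real_derivative 0) (at t)" for x t
    using directional_has_derivative[OF "0.prems"(1), of 0 x t] by simp
  then have "v (0 + 1 *\<^sub>R x) = v (0 + 0 *\<^sub>R x)" for x
    by (intro DERIV_isconst_all[of "\<lambda>t. v (0 + t *\<^sub>R x)"]) auto
  then have "v = (\<lambda>_. v 0)" by auto
  then show ?case by (metis real_polynomial_function.intros(2))
next
  case (Suc m)
  note v = Suc.prems(1)
  have C: "0 \<le> C" using Suc.prems(2)[of 0] by simp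
  have poly: "real_polynomial_function (directional v e)" for e
  proof -
    obtain K where K: "0 \<le> K" "\<And>v M x t. mean_value v \<Longrightarrow> 0 < t \<Longrightarrow> (\<And>z. norm z \<le> t \<Longrightarrow> \<bar>v (x + z)\<bar> \<le> M)
      \<Longrightarrow> \<bar>directional v e x\<bar> \<le> K * M / t" by (rule directional_bound[of e]) (rule that; blast)
    have "\<bar>directional v e x\<bar> \<le> (K * C * 2 ^ Suc m) * (1 + norm x) ^ m" for x
    proof -
      have pos: "0 < 1 + norm x" by (simp add: add_pos_nonneg)
      have "\<bar>directional v e x\<bar> \<le> K * (C * (2 * (1 + norm x)) ^ Suc m) / (1 + norm x)"
      proof (rule K(2)[OF v pos])
        fix z :: "real ^ 'n" assume z: "norm z \<le> 1 + norm x"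
        have "\<bar>v (x + z)\<bar> \<le> C * (1 + norm (x + z)) ^ Suc m" by (rule Suc.prems(2))
        also have "\<dots> \<le> C * (2 * (1 + norm x)) ^ Suc m"
          using z norm_triangle_ineq[of x z] C by (intro mult_left_mono power_mono) auto
        finally show "\<bar>v (x + z)\<bar> \<le> C * (2 * (1 + norm x)) ^ Suc m" .
      qed
      also have "\<dots> = (K * C * 2 ^ Suc m) * (1 + norm x) ^ m"
        using pos by (simp only: power_mult_distrib power_Suc) (simp add: divide_simps)
      finally show ?thesis .
    qed
    then show ?thesis by (rule Suc.IH[OF mean_value_directional[OF v]])
  qed
  show ?case
  \<comment> \<open>The Euler derivative is a polynomial because the partial derivatives are, by
    induction.\<close>
  proof (rule real_polynomial_function_radial_primitive[where D="\<lambda>x. \<Sum>i\<in>UNIV. x $ i * directional v (axis i 1) x"])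
    show "real_polynomial_function (\<lambda>x. \<Sum>i\<in>UNIV. x $ i * directional v (axis i 1) x)"
      by (intro real_polynomial_function_sum real_polynomial_function.intros(4) poly real_polynomial_function.intros(1) bounded_linear_vec_nth) auto
    fix x :: "real ^ 'n" and t :: real assume "t > 0"
    have "(\<Sum>i\<in>UNIV. (t *\<^sub>R x) $ i * directional v (axis i 1) (t *\<^sub>R x)) / t = directional v x (0 + t *\<^sub>R x)"
      unfolding directional_sum[OF v, of x] sum_divide_distrib using \<open>t > 0\<close> by (intro sum.cong) auto
    then show "((\<lambda>t. v (t *\<^sub>R x)) has_real_derivative (\<Sum>i\<in>UNIV. (t *\<^sub>R x) $ i * directional v (axis i 1) (t *\<^sub>R x)) / t) (at t)"
      using directional_has_derivative[OF v, of 0 x t] by simp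
  qed (use mean_valueD(1)[OF v] in auto)
qed

end

section \<open>Zeros of polynomials and slopes of convex functions\<close>

text \<open>One degree bound serves all lines; this makes the porosity constant independent of place
  and scale.\<close>

lemma real_polynomial_function_along_line:
  fixes p :: "'a::real_normed_vector \<Rightarrow> real"
  assumes "real_polynomial_function p"
  shows "\<exists>d. \<forall>x e. \<exists>q. degree q \<le> d \<and> (\<forall>t. p (x + t *\<^sub>R e) = poly q t)"
  using assms
proof (induction rule: real_polynomial_function.induct)
  case (linear f)
  have "f (x + t *\<^sub>R e) = poly [:f x, f e:] t" for x e t
    using linear by (simp add: linear_simps bounded_linear.linear linear_add linear_scale)
  moreover have "degree [:f x, f e:] \<le> 1" for x e by simp
  ultimately show ?case by blast
next
  case (const c)
  have "c = poly [:c:] t" for t by simp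
  moreover have "degree [:c:] \<le> 0" by simp
  ultimately show ?case by blast
next
  case (add f g)
  then obtain d1 d2 where
    1: "\<And>x e. \<exists>q. degree q \<le> d1 \<and> (\<forall>t. f (x + t *\<^sub>R e) = poly q t)" and
    2: "\<And>x e. \<exists>q. degree q \<le> d2 \<and> (\<forall>t. g (x + t *\<^sub>R e) = poly q t)" by blast
  have "\<exists>q. degree q \<le> max d1 d2 \<and> (\<forall>t. f (x + t *\<^sub>R e) + g (x + t *\<^sub>R e) = poly q t)" for x e
  proof -
    obtain q1 q2 where "degree q1 \<le> d1" "\<And>t. f (x + t *\<^sub>R e) = poly q1 t"
      "degree q2 \<le> d2" "\<And>t. g (x + t *\<^sub>R e) = poly q2 t"
      using 1[of x e] 2[of x e] by blast
    then show ?thesis by (intro exI[of _ "q1 + q2"]) (auto intro: degree_add_le)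
  qed
  then show ?case by blast
next
  case (mult f g)
  then obtain d1 d2 where
    1: "\<And>x e. \<exists>q. degree q \<le> d1 \<and> (\<forall>t. f (x + t *\<^sub>R e) = poly q t)" and
    2: "\<And>x e. \<exists>q. degree q \<le> d2 \<and> (\<forall>t. g (x + t *\<^sub>R e) = poly q t)" by blast
  have "\<exists>q. degree q \<le> d1 + d2 \<and> (\<forall>t. f (x + t *\<^sub>R e) * g (x + t *\<^sub>R e) = poly q t)" for x e
  proof -
    obtain q1 q2 where "degree q1 \<le> d1" "\<And>t. f (x + t *\<^sub>R e) = poly q1 t"
      "degree q2 \<le> d2" "\<And>t. g (x + t *\<^sub>R e) = poly q2 t"
      using 1[of x e] 2[of x e] by blast
    then show ?thesis
      by (intro exI[of _ "q1 * q2"]) (auto intro: order.trans[OF degree_mult_le] add_mono)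
  qed
  then show ?case by blast
qed

text \<open>In the induction step \<open>p t - 2 ^ Suc d * p (t / 2)\<close> has no term of degree \<open>Suc d\<close>, and its
  other coefficients are at least as large as those of \<open>p\<close>.\<close>
lemma coefficients_bounded_by_sup:
  "\<exists>C\<ge>0. \<forall>(a::nat \<Rightarrow> real) M. (\<forall>t\<in>{0..1}. \<bar>\<Sum>k\<le>d. a k * t ^ k\<bar> \<le> M) \<longrightarrow> (\<forall>k\<le>d. \<bar>a k\<bar> \<le> C * M)"
proof (induction d)
  case 0
  show ?case by (intro exI[of _ 1]) auto
next
  case (Suc d)
  then obtain C where C: "C \<ge> 0" and
    IH: "\<And>a M k. (\<forall>t\<in>{0..1::real}. \<bar>\<Sum>k\<le>d. a k * t ^ k\<bar> \<le> M) \<Longrightarrow> k \<le> d \<Longrightarrow> \<bar>a k\<bar> \<le> C * M"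
    by blast
  define C' where "C' = C * (1 + 2 ^ Suc d)"
  have "C' \<ge> 0" using C by (simp add: C'_def)
  have "\<bar>a k\<bar> \<le> (1 + (real d + 2) * C') * M"
    if M: "\<forall>t\<in>{0..1}. \<bar>\<Sum>k\<le>Suc d. a k * t ^ k\<bar> \<le> M" and "k \<le> Suc d" for a :: "nat \<Rightarrow> real" and M k
  proof -
    have "0 \<le> M" using M[rule_format, of 0] abs_ge_zero order_trans by fastforce
    define p where "p t = (\<Sum>k\<le>Suc d. a k * t ^ k)" for t
    define b where "b k = a k * (1 - 2 ^ Suc d / 2 ^ k)" for k
    have low: "\<bar>a k\<bar> \<le> C' * M" if "k \<le> d" for k
    proof -
      have "(\<Sum>k\<le>d. b k * t ^ k) = p t - 2 ^ Suc d * p (t / 2)" for t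
      proof -
        have "p t - 2 ^ Suc d * p (t / 2) = (\<Sum>k\<le>Suc d. b k * t ^ k)"
          unfolding p_def b_def sum_distrib_left sum_subtractf[symmetric]
          by (intro sum.cong) (auto simp: power_divide algebra_simps)
        then show ?thesis by (simp add: b_def)
      qed
      moreover have "\<bar>p t - 2 ^ Suc d * p (t / 2)\<bar> \<le> (1 + 2 ^ Suc d) * M" if "t \<in> {0..1}" for t
      proof -
        have "t / 2 \<in> {0..1}" using that by auto
        then have "\<bar>p t\<bar> \<le> M" "\<bar>p (t / 2)\<bar> \<le> M" using M that unfolding p_def by blast+
        then have "\<bar>p t\<bar> + 2 ^ Suc d * \<bar>p (t / 2)\<bar> \<le> M + 2 ^ Suc d * M" by (intro add_mono mult_left_mono) auto
        moreover have "\<bar>p t - 2 ^ Suc d * p (t / 2)\<bar> \<le> \<bar>p t\<bar> + 2 ^ Suc d * \<bar>p (t / 2)\<bar>"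
          using abs_triangle_ineq4[of "p t" "2 ^ Suc d * p (t / 2)"] by (simp add: abs_mult)
        ultimately show ?thesis by (simp add: algebra_simps)
      qed
      ultimately have "\<bar>b k\<bar> \<le> C * ((1 + 2 ^ Suc d) * M)"
        using IH[of b "(1 + 2 ^ Suc d) * M" k] \<open>k \<le> d\<close> by simp
      moreover have "\<bar>a k\<bar> * 1 \<le> \<bar>a k\<bar> * \<bar>1 - 2 ^ Suc d / 2 ^ k\<bar>"
      proof (rule mult_left_mono)
        have "(2::real) * 2 ^ k \<le> 2 ^ Suc d" using \<open>k \<le> d\<close> by simp
        then have "(2::real) \<le> 2 ^ Suc d / 2 ^ k" by (simp add: pos_le_divide_eq)
        then show "(1::real) \<le> \<bar>1 - 2 ^ Suc d / 2 ^ k\<bar>" by linarith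
      qed simp
      ultimately show ?thesis by (simp add: b_def C'_def abs_mult mult.assoc)
    qed
    have CM: "0 \<le> C' * M" using \<open>0 \<le> C'\<close> \<open>0 \<le> M\<close> by simp
    show ?thesis
    proof (cases "k \<le> d")
      case True
      have "C' * M \<le> (1 + (real d + 2) * C') * M"
        using \<open>0 \<le> M\<close> CM mult_nonneg_nonneg[OF _ CM, of "real d"] by (simp add: algebra_simps)
      then show ?thesis using low[OF True] by linarith
    next
      case False
      then have k: "k = Suc d" using \<open>k \<le> Suc d\<close> by simp
      have "\<bar>p 1\<bar> \<le> M" using M[rule_format, of 1] unfolding p_def by simp
      moreover have "\<bar>\<Sum>k\<le>d. a k\<bar> \<le> (real d + 1) * (C' * M)"
      proof -
        have "\<bar>\<Sum>k\<le>d. a k\<bar> \<le> (\<Sum>k\<le>d. \<bar>a k\<bar>)" by (rule sum_abs)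
        also have "\<dots> \<le> (\<Sum>k\<le>d. C' * M)" by (intro sum_mono low) simp
        finally show ?thesis by (simp add: algebra_simps)
      qed
      moreover have "p 1 = (\<Sum>k\<le>d. a k) + a k" by (simp add: p_def k)
      ultimately have "\<bar>a k\<bar> \<le> M + (real d + 1) * (C' * M)" by linarith
      then show ?thesis using CM by (simp add: algebra_simps)
    qed
  qed
  moreover have "0 \<le> 1 + (real d + 2) * C'" using \<open>0 \<le> C'\<close> by simp
  ultimately show ?case by blast
qed

text \<open>The growth bound carries control from a ball to a larger one, the oscillation bound is a
  Lipschitz estimate at the endpoint 0. Both are proportional to \<open>M\<close>, hence insensitive
  to rescaling \<open>u\<close>.\<close>

lemma poly_bounds_from_unit_interval:
  "\<exists>C\<ge>0. \<forall>(q::real poly) M. degree q \<le> d \<longrightarrow> (\<forall>t\<in>{0..1}. \<bar>poly q t\<bar> \<le> M) \<longrightarrow>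
    (\<forall>t\<ge>0. \<bar>poly q t\<bar> \<le> C * M * (1 + t) ^ d) \<and> (\<forall>t\<in>{0..1}. \<bar>poly q t - poly q 0\<bar> \<le> C * M * t)"
proof -
  obtain C where C: "C \<ge> 0" and
    coeff: "\<And>a M k. (\<forall>t\<in>{0..1::real}. \<bar>\<Sum>k\<le>d. a k * t ^ k\<bar> \<le> M) \<Longrightarrow> k \<le> d \<Longrightarrow> \<bar>a k\<bar> \<le> C * M"
    using coefficients_bounded_by_sup[of d] by blast
  have "(\<forall>t\<ge>0. \<bar>poly q t\<bar> \<le> ((real d + 1) * C) * M * (1 + t) ^ d) \<and> (\<forall>t\<in>{0..1}. \<bar>poly q t - poly q 0\<bar> \<le> ((real d + 1) * C) * M * t)"
    if "degree q \<le> d" and M: "\<forall>t\<in>{0..1}. \<bar>poly q t\<bar> \<le> M" for q :: "real poly" and M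
  proof (intro conjI allI impI ballI)
    have sum: "poly q t = (\<Sum>k\<le>d. coeff q k * t ^ k)" for t
      unfolding poly_altdef using \<open>degree q \<le> d\<close>
      by (intro sum.mono_neutral_left) (auto simp: coeff_eq_0)
    have ck: "\<bar>coeff q k\<bar> \<le> C * M" if "k \<le> d" for k
      by (rule coeff[OF _ that]) (use M sum in simp)
    have "0 \<le> M" using M[rule_format, of 0] abs_ge_zero order_trans by fastforce
    then have CM: "0 \<le> C * M" using C by simp
    {
      fix t :: real assume "t \<ge> 0"
      have "\<bar>poly q t\<bar> \<le> (\<Sum>k\<le>d. \<bar>coeff q k * t ^ k\<bar>)" unfolding sum by (rule sum_abs)
      also have "\<dots> \<le> (\<Sum>k\<le>d. C * M * (1 + t) ^ d)"
      proof (rule sum_mono)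
        fix k assume "k \<in> {..d}"
        have "t ^ k \<le> (1 + t) ^ k" using \<open>t \<ge> 0\<close> by (intro power_mono) auto
        also have "\<dots> \<le> (1 + t) ^ d" using \<open>t \<ge> 0\<close> \<open>k \<in> {..d}\<close> by (intro power_increasing) auto
        finally show "\<bar>coeff q k * t ^ k\<bar> \<le> C * M * (1 + t) ^ d"
          unfolding abs_mult using ck[of k] \<open>k \<in> {..d}\<close> \<open>t \<ge> 0\<close> CM by (intro mult_mono) (auto simp: power_abs)
      qed
      also have "\<dots> = ((real d + 1) * C) * M * (1 + t) ^ d" by (simp add: algebra_simps)
      finally show "\<bar>poly q t\<bar> \<le> ((real d + 1) * C) * M * (1 + t) ^ d" .
    next
      fix t :: real assume t: "t \<in> {0..1}"
      have "poly q t - poly q 0 = (\<Sum>k\<le>d. coeff q k * (t ^ k - 0 ^ k))"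
        unfolding sum sum_subtractf[symmetric] by (simp add: right_diff_distrib)
      also have "\<bar>\<dots>\<bar> \<le> (\<Sum>k\<le>d. \<bar>coeff q k * (t ^ k - 0 ^ k)\<bar>)" by (rule sum_abs)
      also have "\<dots> \<le> (\<Sum>k\<le>d. C * M * t)"
      proof (rule sum_mono)
        fix k assume "k \<in> {..d}"
        have "\<bar>t ^ k - 0 ^ k\<bar> \<le> t"
        proof (cases k)
          case (Suc j)
          have "t * t ^ j \<le> t * 1" using t by (intro mult_left_mono power_le_one) auto
          then show ?thesis using t Suc by simp
        qed (use t in simp)
        then show "\<bar>coeff q k * (t ^ k - 0 ^ k)\<bar> \<le> C * M * t"
          unfolding abs_mult using ck[of k] \<open>k \<in> {..d}\<close> CM by (intro mult_mono) auto
      qed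
      also have "\<dots> = ((real d + 1) * C) * M * t" by (simp add: algebra_simps)
      finally show "\<bar>poly q t - poly q 0\<bar> \<le> ((real d + 1) * C) * M * t" .
    }
  qed
  moreover have "0 \<le> (real d + 1) * C" using C by simp
  ultimately show ?thesis by blast
qed

text \<open>The ball is centred at a maximum point of \<open>\<bar>u\<bar>\<close> over \<open>cball x r\<close>; restricting to lines, \<open>u\<close> grows
  by at most a constant factor on \<open>cball x (2 * r)\<close> and oscillates little near the maximum point.\<close>
lemma polynomial_porosity:
  fixes u :: "'a::euclidean_space \<Rightarrow> real"
  assumes u: "real_polynomial_function u" and "u a \<noteq> 0"
  obtains c where "0 < c" "c \<le> 1"
    and "\<And>x r. 0 < r \<Longrightarrow> \<exists>y. norm (y - x) \<le> r \<and> (\<forall>z. norm (z - y) < c * r \<longrightarrow> u z \<noteq> 0)"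
proof -
  obtain d where d: "\<And>x e. \<exists>q. degree q \<le> d \<and> (\<forall>t. u (x + t *\<^sub>R e) = poly q t)"
    using real_polynomial_function_along_line[OF u] by blast
  obtain C where C: "C \<ge> 0" and bounds: "\<And>(q::real poly) M. degree q \<le> d \<Longrightarrow> (\<forall>t\<in>{0..1}. \<bar>poly q t\<bar> \<le> M) \<Longrightarrow>
    (\<forall>t\<ge>0. \<bar>poly q t\<bar> \<le> C * M * (1 + t) ^ d) \<and> (\<forall>t\<in>{0..1}. \<bar>poly q t - poly q 0\<bar> \<le> C * M * t)"
    using poly_bounds_from_unit_interval[of d] by blast
  have grow: "\<bar>u (x + t *\<^sub>R e)\<bar> \<le> C * M * (1 + t) ^ d" if "\<And>s. s \<in> {0..1} \<Longrightarrow> \<bar>u (x + s *\<^sub>R e)\<bar> \<le> M" "t \<ge> 0" for x e M t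
  proof -
    obtain q where "degree q \<le> d" "\<And>t. u (x + t *\<^sub>R e) = poly q t" using d by blast
    then show ?thesis using bounds[of q M] that by auto
  qed
  have osc: "\<bar>u (x + t *\<^sub>R e) - u x\<bar> \<le> C * M * t" if "\<And>s. s \<in> {0..1} \<Longrightarrow> \<bar>u (x + s *\<^sub>R e)\<bar> \<le> M" "t \<in> {0..1}" for x e M t
  proof -
    obtain q where q: "degree q \<le> d" "\<And>t. u (x + t *\<^sub>R e) = poly q t" using d by blast
    then have "u x = poly q 0" using q(2)[of 0] by simp
    then show ?thesis using q bounds[of q M] that by auto
  qed
  \<comment> \<open>\<open>C * 3 ^ d * M\<close> will bound \<open>u\<close> on the ball of doubled
    radius. The oscillation estimate adds another factor \<open>C\<close>, and below this
    \<open>c\<close> the total change stays under \<open>M\<close>.\<close>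
  define c where "c = 1 / (1 + C * (C * 3 ^ d))"
  have den: "0 < 1 + C * (C * 3 ^ d)" using C by (simp add: add_pos_nonneg)
  have "0 < c" "c \<le> 1" using den C by (auto simp: c_def)
  show thesis
  proof
    show "0 < c" "c \<le> 1" by fact+
    fix x :: 'a and r :: real assume "0 < r"
    have "continuous_on (cball x r) (\<lambda>z. \<bar>u z\<bar>)"
      using continuous_on_polymonial_function u real_polynomial_function_eq by (intro continuous_intros) blast
    then obtain y where y: "y \<in> cball x r" "\<And>z. z \<in> cball x r \<Longrightarrow> \<bar>u z\<bar> \<le> \<bar>u y\<bar>"
      using continuous_attains_sup[of "cball x r" "\<lambda>z. \<bar>u z\<bar>"] \<open>0 < r\<close> by auto
    define M where "M = \<bar>u y\<bar>"
    have near: "\<bar>u (x + s *\<^sub>R e)\<bar> \<le> M" if "norm e \<le> r" "s \<in> {0..1}" for s e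
      unfolding M_def
    proof (rule y(2))
      have "\<bar>s\<bar> * norm e \<le> 1 * r" using that by (intro mult_mono) auto
      then show "x + s *\<^sub>R e \<in> cball x r" by (simp add: dist_norm)
    qed
    \<comment> \<open>If \<open>u\<close> vanished on the whole ball, the growth bound along lines
      would make it vanish at \<open>a\<close> as well.\<close>
    have "M > 0"
    proof (rule ccontr)
      assume "\<not> M > 0"
      then have "M = 0" by (simp add: M_def)
      define t where "t = norm (a - x) / r"
      have "norm ((1 / t) *\<^sub>R (a - x)) \<le> r" using \<open>0 < r\<close> by (simp add: t_def)
      then have "\<bar>u (x + t *\<^sub>R (1 / t) *\<^sub>R (a - x))\<bar> \<le> C * M * (1 + t) ^ d"
        by (rule grow[OF near]) (use \<open>0 < r\<close> in \<open>auto simp: t_def\<close>)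
      moreover have "x + t *\<^sub>R (1 / t) *\<^sub>R (a - x) = a" using \<open>0 < r\<close> by (cases "a = x") (auto simp: t_def)
      ultimately show False using \<open>M = 0\<close> \<open>u a \<noteq> 0\<close> by simp
    qed
    have far: "\<bar>u z\<bar> \<le> C * 3 ^ d * M" if "norm (z - x) \<le> 2 * r" for z
    proof -
      have "\<bar>u (x + 2 *\<^sub>R (1 / 2) *\<^sub>R (z - x))\<bar> \<le> C * M * (1 + 2) ^ d"
        by (rule grow[OF near]) (use that in auto)
      then show ?thesis by (simp add: mult_ac)
    qed
    have "u z \<noteq> 0" if z: "norm (z - y) < c * r" for z
    proof -
      define t where "t = norm (z - y) / r"
      have t: "0 \<le> t" "t < c" using z \<open>0 < r\<close> by (auto simp: t_def field_simps)
      define e where "e = (1 / t) *\<^sub>R (z - y)"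
      have e: "norm e \<le> r" using \<open>0 < r\<close> by (simp add: e_def t_def)
      have "\<bar>u (y + t *\<^sub>R e) - u y\<bar> \<le> C * (C * 3 ^ d * M) * t"
      proof (rule osc)
        fix s :: real assume "s \<in> {0..1}"
        then have "\<bar>s\<bar> * norm e \<le> 1 * r" using e by (intro mult_mono) auto
        then show "\<bar>u (y + s *\<^sub>R e)\<bar> \<le> C * 3 ^ d * M"
          using y(1) norm_triangle_ineq[of "y - x" "s *\<^sub>R e"]
          by (intro far) (simp add: dist_norm norm_minus_commute add_diff_eq diff_add_eq)
      qed (use t \<open>c \<le> 1\<close> in auto)
      also have "y + t *\<^sub>R e = z" using \<open>0 < r\<close> by (cases "z = y") (auto simp: e_def t_def)
      also have "C * (C * 3 ^ d * M) * t \<le> C * (C * 3 ^ d * M) * c" 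
        using t C \<open>M > 0\<close> by (intro mult_left_mono) auto
      also have "\<dots> = M * (C * (C * 3 ^ d) * c)" by simp
      also have "\<dots> < M * 1"
        using den \<open>M > 0\<close> by (intro mult_strict_left_mono) (auto simp: c_def field_simps)
      finally show ?thesis by (auto simp: M_def)
    qed
    then show "\<exists>y. norm (y - x) \<le> r \<and> (\<forall>z. norm (z - y) < c * r \<longrightarrow> u z \<noteq> 0)"
      using y(1) by (intro exI[of _ y]) (auto simp: dist_norm norm_minus_commute)
  qed
qed

text \<open>After subtracting the chord through the endpoints, a violation of convexity would be a
  positive interior maximum, which midpoint convexity excludes.\<close>

lemma midpoint_convex_on:
  fixes \<phi> :: "real \<Rightarrow> real"
  assumes cont: "continuous_on UNIV \<phi>" and mid: "\<And>a b. \<phi> ((a + b) / 2) \<le> (\<phi> a + \<phi> b) / 2"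
  shows "convex_on UNIV \<phi>"
proof (rule convex_on_linorderI)
  fix \<theta> x y :: real
  assume \<theta>: "0 < \<theta>" "\<theta> < 1" and "x < y"
  define m where "m = (\<phi> y - \<phi> x) / (y - x)"
  define L where "L t = \<phi> x + (t - x) * m" for t
  define \<psi> where "\<psi> t = \<phi> t - L t" for t
  have \<psi>xy: "\<psi> x = 0" "\<psi> y = 0" using \<open>x < y\<close> by (auto simp: \<psi>_def L_def m_def)
  have L_mid: "L ((a + b) / 2) = (L a + L b) / 2" for a b
    unfolding L_def by (simp add: field_simps)
  have \<psi>_mid: "\<psi> ((a + b) / 2) \<le> (\<psi> a + \<psi> b) / 2" for a b
    using mid[of a b] L_mid[of a b] by (simp add: \<psi>_def field_simps)
  have cont\<psi>: "continuous_on S \<psi>" for S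
    unfolding \<psi>_def[abs_def] L_def by (intro continuous_intros continuous_on_subset[OF cont]) auto
  have "\<psi> z \<le> 0" if z: "z \<in> {x..y}" for z
  proof (rule ccontr)
    assume "\<not> \<psi> z \<le> 0"
    obtain m where m: "m \<in> {x..y}" "\<And>t. t \<in> {x..y} \<Longrightarrow> \<psi> t \<le> \<psi> m"
      using continuous_attains_sup[OF compact_Icc, of x y \<psi>] cont\<psi> \<open>x < y\<close> by auto
    have "\<psi> m > 0" using m(2)[OF z] \<open>\<not> \<psi> z \<le> 0\<close> by linarith
    define T where "T = {t \<in> {x..y}. \<psi> t = \<psi> m}"
    have "compact T"
    proof -
      have "closed {t. \<psi> t = \<psi> m}" by (intro closed_Collect_eq cont\<psi> continuous_intros)
      moreover have "T = {x..y} \<inter> {t. \<psi> t = \<psi> m}" by (auto simp: T_def)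
      ultimately show ?thesis by (simp add: compact_Int_closed)
    qed
    moreover have "T \<noteq> {}" using m by (auto simp: T_def)
    \<comment> \<open>At the leftmost maximum point the left neighbour lies strictly lower, so the
      midpoint inequality fails for neighbours at equal distance.\<close>
    ultimately obtain t0 where t0: "t0 \<in> T" "\<And>t. t \<in> T \<Longrightarrow> t0 \<le> t"
      using compact_attains_inf[of T] by blast
    have "t0 \<noteq> x" "t0 \<noteq> y" using t0(1) \<psi>xy \<open>\<psi> m > 0\<close> by (auto simp: T_def)
    then have t0': "x < t0" "t0 < y" using t0(1) by (auto simp: T_def)
    define \<delta> where "\<delta> = min (t0 - x) (y - t0)"
    have "\<delta> > 0" "t0 - \<delta> \<in> {x..y}" "t0 + \<delta> \<in> {x..y}" using t0' by (auto simp: \<delta>_def)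
    have "\<psi> (t0 - \<delta>) \<noteq> \<psi> m" using t0(2)[of "t0 - \<delta>"] \<open>\<delta> > 0\<close> \<open>t0 - \<delta> \<in> {x..y}\<close> by (auto simp: T_def)
    then have "\<psi> (t0 - \<delta>) < \<psi> m" using m(2)[OF \<open>t0 - \<delta> \<in> {x..y}\<close>] by linarith
    moreover have "\<psi> (t0 + \<delta>) \<le> \<psi> m" by (rule m(2)) fact
    moreover have "\<psi> t0 = \<psi> m" using t0(1) by (simp add: T_def)
    moreover have "\<psi> t0 \<le> (\<psi> (t0 - \<delta>) + \<psi> (t0 + \<delta>)) / 2"
      using \<psi>_mid[of "t0 - \<delta>" "t0 + \<delta>"] by simp
    ultimately show False
      by (metis (no_types) add_less_le_mono field_sum_of_halves not_le add_divide_distrib divide_strict_right_mono zero_less_numeral)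
  qed
  moreover have "(1 - \<theta>) * x + \<theta> * y \<in> {x..y}"
  proof -
    have "\<theta> * x \<le> \<theta> * y" "(1 - \<theta>) * x \<le> (1 - \<theta>) * y" using \<theta> \<open>x < y\<close> by simp_all
    then show ?thesis by (auto simp: algebra_simps)
  qed
  ultimately have "\<phi> ((1 - \<theta>) * x + \<theta> * y) \<le> L ((1 - \<theta>) * x + \<theta> * y)" by (auto simp: \<psi>_def)
  also have "\<dots> = (1 - \<theta>) * \<phi> x + \<theta> * \<phi> y"
  proof -
    have "(1 - \<theta>) * x + \<theta> * y - x = \<theta> * (y - x)" by (simp add: algebra_simps)
    moreover have "(y - x) * m = \<phi> y - \<phi> x" using \<open>x < y\<close> by (simp add: m_def)
    ultimately have "L ((1 - \<theta>) * x + \<theta> * y) = \<phi> x + \<theta> * (\<phi> y - \<phi> x)"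
      unfolding L_def by (simp add: mult.assoc)
    then show ?thesis by (simp add: algebra_simps)
  qed
  finally show "\<phi> ((1 - \<theta>) *\<^sub>R x + \<theta> *\<^sub>R y) \<le> (1 - \<theta>) * \<phi> x + \<theta> * \<phi> y" by simp
qed auto

text \<open>The infimum of difference quotients to the right serves as slope. It stands in for the
  derivative of \<open>ln \<Phi>\<close>, so \<open>\<Phi>\<close> need not be
  differentiated.\<close>

lemma convex_on_subgradient:
  fixes \<phi> :: "real \<Rightarrow> real"
  assumes "convex_on UNIV \<phi>"
  obtains s where "\<And>x y. s x * (y - x) \<le> \<phi> y - \<phi> x" "mono s"
proof -
  obtain s where s: "\<And>x y. s x * (y - x) \<le> \<phi> y - \<phi> x"
  proof
    show "Inf ((\<lambda>t. (\<phi> x - \<phi> t) / (x - t)) ` ({x<..} \<inter> UNIV)) * (y - x) \<le> \<phi> y - \<phi> x" for x y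
      using convex_le_Inf_differential[OF assms, of x y] by simp
  qed
  moreover have "mono s"
  proof
    fix x y :: real assume "x \<le> y"
    show "s x \<le> s y"
    proof (cases "x = y")
      case False
      have "s x * (y - x) \<le> s y * (y - x)" using s[of x y] s[of y x] by (simp add: algebra_simps)
      then show ?thesis using False \<open>x \<le> y\<close> by (simp add: mult_le_cancel_right)
    qed simp
  qed
  ultimately show thesis by (rule that)
qed

text \<open>If every window \<open>[b, b + M * K / s b]\<close> increased \<open>s\<close> by a factor \<open>1 + \<epsilon>\<close>, iterating would make
  \<open>s\<close> blow up at a finite point: \<open>a n + c / s (a n)\<close> is nonincreasing along the iteration.\<close>
lemma exists_window_of_slow_growth:
  fixes s :: "real \<Rightarrow> real"
  assumes "mono s" and unbounded: "\<And>S. \<exists>a. S < s a"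
    and pos: "0 < K" "0 < M" "0 < \<epsilon>" "0 < h0"
  obtains b h where "0 < h" "h \<le> h0" "s b * h = K" "s (b + M * h) \<le> (1 + \<epsilon>) * s b"
proof (rule ccontr)
  assume contra: "\<not> thesis"
  note window = that
  have no: "(1 + \<epsilon>) * s b < s (b + M * h)" if "0 < h" "h \<le> h0" "s b * h = K" for b h
    using window[OF that] contra by (meson not_le)
  obtain a0 where a0: "K / h0 < s a0" using unbounded by blast
  have "0 < s a0" using a0 pos by (meson divide_pos_pos less_trans)
  have step: "(1 + \<epsilon>) * s b < s (b + M * (K / s b))" if "s a0 \<le> s b" for b
  proof (rule no)
    have "0 < s b" using that \<open>0 < s a0\<close> by linarith
    then show "0 < K / s b" "s b * (K / s b) = K" using pos by auto
    have "K / h0 < s b" using that a0 by linarith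
    then show "K / s b \<le> h0" using \<open>0 < s b\<close> pos by (simp add: field_simps)
  qed
  define a where "a = rec_nat a0 (\<lambda>_ b. b + M * (K / s b))"
  have a_0: "a 0 = a0" and a_Suc: "a (Suc n) = a n + M * (K / s (a n))" for n by (simp_all add: a_def)
  have s_ge: "(1 + \<epsilon>) ^ n * s a0 \<le> s (a n) \<and> s a0 \<le> s (a n)" for n
  proof (induction n)
    case (Suc n)
    have "(1 + \<epsilon>) * s (a n) < s (a (Suc n))" unfolding a_Suc using Suc by (intro step) auto
    moreover have "(1 + \<epsilon>) * ((1 + \<epsilon>) ^ n * s a0) \<le> (1 + \<epsilon>) * s (a n)" using Suc pos by (intro mult_left_mono) auto
    moreover have "1 * s (a n) \<le> (1 + \<epsilon>) * s (a n)" using Suc pos \<open>0 < s a0\<close> by (intro mult_right_mono) auto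
    ultimately show ?case using Suc by (auto simp: mult.assoc)
  qed (simp add: a_0)
  \<comment> \<open>The solution of \<open>c / (1 + \<epsilon>) = c - M * K\<close>: the drop of
    \<open>c / s (a n)\<close> then pays for the step to \<open>a (Suc n)\<close>.\<close>
  define c where "c = M * K * (1 + \<epsilon>) / \<epsilon>"
  have "c > 0" using pos by (simp add: c_def)
  have "a n + c / s (a n) \<le> a0 + c / s a0" for n
  proof (induction n)
    case (Suc n)
    have sn: "0 < s (a n)" using s_ge[of n] \<open>0 < s a0\<close> by linarith
    have "(1 + \<epsilon>) * s (a n) < s (a (Suc n))" unfolding a_Suc using s_ge[of n] by (intro step) auto
    moreover have "0 < (1 + \<epsilon>) * s (a n)" using sn pos by simp
    ultimately have "c / s (a (Suc n)) \<le> c / ((1 + \<epsilon>) * s (a n))"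
      using \<open>c > 0\<close> by (intro divide_left_mono) auto
    also have "\<dots> = c / s (a n) - M * (K / s (a n))"
    proof -
      have "c / (1 + \<epsilon>) = M * K / \<epsilon>" using pos by (simp add: c_def)
      moreover have "c = M * K / \<epsilon> + M * K" using pos by (simp add: c_def field_simps)
      ultimately have "c / (1 + \<epsilon>) = c - M * K" by simp
      then show ?thesis by (simp add: divide_divide_eq_left[symmetric] diff_divide_distrib)
    qed
    finally show ?case unfolding a_Suc using Suc by simp
  qed (simp add: a_0)
  then have "a n \<le> a0 + c / s a0" for n
    using s_ge[of n] \<open>0 < s a0\<close> \<open>c > 0\<close> by (smt (verit) divide_nonneg_pos)
  then have bound: "(1 + \<epsilon>) ^ n * s a0 \<le> s (a0 + c / s a0)" for n
    using s_ge[of n] monoD[OF \<open>mono s\<close>] by (meson order.trans)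
  obtain n where "s (a0 + c / s a0) / s a0 < (1 + \<epsilon>) ^ n"
    using real_arch_pow[of "1 + \<epsilon>"] pos by auto
  then show False using bound[of n] \<open>0 < s a0\<close> by (simp add: pos_divide_less_eq)
qed

section \<open>Doubling, Harnack's inequality and three balls\<close>

context quadratic_kernel
begin

lemma J_swap_and_continuous:
  fixes F :: "real ^ 'n \<Rightarrow> real ^ 'n \<Rightarrow> real"
  assumes F: "continuous_on UNIV (\<lambda>(x, z). F x z)"
  shows "J (\<lambda>x. J (\<lambda>z. F x z)) = J (\<lambda>z. J (\<lambda>x. F x z))"
    and "continuous_on UNIV (\<lambda>x. J (\<lambda>z. F x z))"
    and "continuous_on UNIV (\<lambda>z. J (\<lambda>x. F x z))"
proof -
  let ?K = "cbox (- One) One :: (real ^ 'n) set"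
  have c1: "continuous_on S (\<lambda>z. F x z)" for S x
    by (rule continuous_on_compose2[OF F, where f="\<lambda>z. (x, z)", simplified]) (auto intro!: continuous_intros)
  have c2: "continuous_on S (\<lambda>x. F x z)" for S z
    by (rule continuous_on_compose2[OF F, where f="\<lambda>x. (x, z)", simplified]) (auto intro!: continuous_intros)
  have p1: "continuous_on S (\<lambda>(x, z). F x z * w z)" for S
    using continuous_on_mult[OF F continuous_on_w[OF continuous_on_snd[OF continuous_on_id]]]
    by (auto simp: split_beta intro: continuous_on_subset)
  have p2: "continuous_on S (\<lambda>(z, x). F x z * w x)" for S
  proof -
    have "continuous_on UNIV (\<lambda>p. (\<lambda>(x, z). F x z) (snd p, fst p) * w (snd p))"
      by (intro continuous_intros continuous_on_compose2[OF F]) auto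
    then show ?thesis by (auto simp: split_beta intro: continuous_on_subset)
  qed
  have J1: "(\<lambda>x. J (\<lambda>z. F x z)) = (\<lambda>x. integral ?K (\<lambda>z. F x z * w z))" by (rule ext) (rule J_cbox[OF c1])
  have J2: "(\<lambda>z. J (\<lambda>x. F x z)) = (\<lambda>z. integral ?K (\<lambda>x. F x z * w x))" by (rule ext) (rule J_cbox[OF c2])
  show C1: "continuous_on UNIV (\<lambda>x. J (\<lambda>z. F x z))"
    unfolding J1 by (rule integral_continuous_on_param) (rule p1)
  show C2: "continuous_on UNIV (\<lambda>z. J (\<lambda>x. F x z))"
    unfolding J2 by (rule integral_continuous_on_param) (rule p2)
  have "J (\<lambda>x. J (\<lambda>z. F x z)) = integral ?K (\<lambda>x. integral ?K (\<lambda>z. F x z * w z * w x))"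
    using J_cbox[OF C1] by (simp add: J_cbox[OF c1])
  also have "\<dots> = integral ?K (\<lambda>z. integral ?K (\<lambda>x. F x z * w z * w x))"
  proof (rule integral_swap_continuous)
    have "continuous_on UNIV (\<lambda>p. (\<lambda>(x, z). F x z * w z) p * w (fst p))"
      by (intro continuous_intros p1)
    then show "continuous_on (cbox (- One, - One) (One, One)) (\<lambda>(x, z). F x z * w z * w x)"
      by (auto simp: split_beta intro: continuous_on_subset)
  qed
  also have "\<dots> = J (\<lambda>z. J (\<lambda>x. F x z))"
  proof -
    have "(\<lambda>x. F x z * w z * w x) = (\<lambda>x. F x z * w x * w z)" for z by (simp add: mult_ac)
    then show ?thesis using J_cbox[OF C2] by (simp add: J_cbox[OF c2])
  qed
  finally show "J (\<lambda>x. J (\<lambda>z. F x z)) = J (\<lambda>z. J (\<lambda>x. F x z))" .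
qed

lemma J_weight_mono:
  assumes f: "continuous_on UNIV f" "\<And>x. 0 \<le> f x" and "0 < a" "0 < b"
    and le: "\<And>x. w ((1 / a) *\<^sub>R (x - y)) \<le> 4 * w ((1 / b) *\<^sub>R (x - y'))"
  shows "a ^ CARD('n) * J (\<lambda>z. f (y + a *\<^sub>R z)) \<le> 4 * (b ^ CARD('n) * J (\<lambda>z. f (y' + b *\<^sub>R z)))"
proof -
  have "(\<integral>x. f x * w ((1 / a) *\<^sub>R (x - y)) \<partial>lborel) \<le> (\<integral>x. 4 * (f x * w ((1 / b) *\<^sub>R (x - y'))) \<partial>lborel)"
  proof (rule integral_mono)
    fix x
    have "f x * w ((1 / a) *\<^sub>R (x - y)) \<le> f x * (4 * w ((1 / b) *\<^sub>R (x - y')))"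
      by (intro mult_left_mono le f)
    then show "f x * w ((1 / a) *\<^sub>R (x - y)) \<le> 4 * (f x * w ((1 / b) *\<^sub>R (x - y')))" by simp
  qed (intro integrable_mult_w_affine integrable_mult_right f assms(3,4))+
  then show ?thesis using J_affine[OF f(1) \<open>0 < a\<close>, of y] J_affine[OF f(1) \<open>0 < b\<close>, of y'] by simp
qed

text \<open>An averaging argument over all centres \<open>x0\<close> near the unit ball: were the inequality to fail
  everywhere, integrating it over \<open>x0\<close> and swapping the integrals would contradict the global bound.\<close>
lemma exists_doubling_center:
  assumes G: "continuous_on UNIV G" "\<And>x. 0 \<le> G x" and P: "continuous_on UNIV P" "\<And>x. 0 \<le> P x"
    and "0 < r" "r \<le> R" "sqrt \<Lambda> * R \<le> \<sigma>" "2 * \<sigma> \<le> 1" "(1 + 2 * \<sigma>)\<^sup>2 \<le> \<rho>"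
    and bound: "J (\<lambda>x. G (\<rho> *\<^sub>R x)) \<le> 2 * J P" and "0 < J P"
  obtains x0 where "norm x0 \<le> 2" "J (\<lambda>z. G (x0 + R *\<^sub>R z)) < 33 * \<rho> ^ CARD('n) * J (\<lambda>z. P (x0 + r *\<^sub>R z))"
proof (rule ccontr)
  assume contra: "\<not> thesis"
  note found = that
  let ?n = "CARD('n)"
  \<comment> \<open>Shifting a weight by at most \<open>R\<close> in the unit scale enlarges its
    radius by the factor \<open>s\<close>. It is done twice, from 1 to \<open>s\<close> and from
    \<open>s\<close> to \<open>s\<^sup>2\<close>, so the final radius is at most
    \<open>\<rho>\<close>.\<close>
  define s where "s = 1 + 2 * \<sigma>"
  have "0 < sqrt \<Lambda> * R" using \<Lambda>_ge_1 \<open>0 < r\<close> \<open>r \<le> R\<close> by (intro mult_pos_pos) auto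
  then have "0 < \<sigma>" using assms(7) by linarith
  then have s: "1 \<le> s" "s \<le> 2" "s\<^sup>2 \<le> \<rho>" using assms by (auto simp: s_def)
  then have "0 < s\<^sup>2" by simp
  then have "0 < \<rho>" using s by linarith
  have contG: "continuous_on UNIV (\<lambda>(x, z). G (s *\<^sub>R x + R *\<^sub>R z))"
    unfolding split_beta by (intro continuous_on_compose2[OF G(1)] continuous_intros) auto
  have contP: "continuous_on UNIV (\<lambda>(x, z). P (s *\<^sub>R x + r *\<^sub>R z))"
    unfolding split_beta by (intro continuous_on_compose2[OF P(1)] continuous_intros) auto
  have G_le: "s ^ ?n * J (\<lambda>x. G (s *\<^sub>R x + R *\<^sub>R z)) \<le> 4 * (\<rho> ^ ?n * J (\<lambda>x. G (\<rho> *\<^sub>R x)))" if z: "norm z < 1" for z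
  proof -
    have "w ((1 / s) *\<^sub>R (x - R *\<^sub>R z)) \<le> 4 * w ((1 / \<rho>) *\<^sub>R (x - 0))" for x
    proof -
      have "sqrt \<Lambda> * norm ((1 / s) *\<^sub>R R *\<^sub>R z) \<le> \<sigma>"
      proof -
        have "norm ((1 / s) *\<^sub>R R *\<^sub>R z) \<le> 1 * (R * 1)"
          unfolding norm_scaleR using s z \<open>0 < r\<close> \<open>r \<le> R\<close> by (intro mult_mono) (auto intro!: mult_nonneg_nonneg)
        then have "sqrt \<Lambda> * norm ((1 / s) *\<^sub>R R *\<^sub>R z) \<le> sqrt \<Lambda> * R"
          using \<Lambda>_ge_1 by (intro mult_left_mono) auto
        then show ?thesis using assms(7) by linarith
      qed
      from w_shift[OF this \<open>0 < \<sigma>\<close> assms(8), of "(1 / s) *\<^sub>R (x - R *\<^sub>R z)"]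
      have "w ((1 / s) *\<^sub>R (x - R *\<^sub>R z)) \<le> 4 * w ((1 / s) *\<^sub>R ((1 / s) *\<^sub>R x))"
        unfolding s_def[symmetric] by (simp add: scaleR_right_diff_distrib)
      also have "w ((1 / s) *\<^sub>R ((1 / s) *\<^sub>R x)) \<le> w ((s\<^sup>2 / \<rho>) *\<^sub>R ((1 / s) *\<^sub>R ((1 / s) *\<^sub>R x)))"
        using s \<open>0 < \<rho>\<close> by (intro w_shrink) auto
      also have "(s\<^sup>2 / \<rho>) *\<^sub>R ((1 / s) *\<^sub>R ((1 / s) *\<^sub>R x)) = (1 / \<rho>) *\<^sub>R (x - 0)"
        using s by (simp add: power2_eq_square)
      finally show ?thesis by simp
    qed
    from J_weight_mono[OF G _ \<open>0 < \<rho>\<close> this] show ?thesis using s by (simp add: add.commute)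
  qed
  have P_le: "J P \<le> 4 * (s ^ ?n * J (\<lambda>x. P (s *\<^sub>R x + r *\<^sub>R z)))" if z: "norm z < 1" for z
  proof -
    have "w ((1 / 1) *\<^sub>R (x - 0)) \<le> 4 * w ((1 / s) *\<^sub>R (x - r *\<^sub>R z))" for x
    proof -
      have "norm (- (r *\<^sub>R z)) \<le> R * 1"
        unfolding norm_minus_cancel norm_scaleR using z \<open>0 < r\<close> \<open>r \<le> R\<close> by (intro mult_mono) auto
      then have "sqrt \<Lambda> * norm (- (r *\<^sub>R z)) \<le> sqrt \<Lambda> * R"
        using \<Lambda>_ge_1 by (intro mult_left_mono) auto
      then have "sqrt \<Lambda> * norm (- (r *\<^sub>R z)) \<le> \<sigma>" using assms(7) by linarith
      from w_shift[OF this \<open>0 < \<sigma>\<close> assms(8), of x] show ?thesis by (simp add: s_def)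
    qed
    from J_weight_mono[OF P _ _ this] show ?thesis using s by (simp add: add.commute)
  qed
  note swapG = J_swap_and_continuous[OF contG] and swapP = J_swap_and_continuous[OF contP]
  have "s ^ ?n * J (\<lambda>x. J (\<lambda>z. G (s *\<^sub>R x + R *\<^sub>R z))) = J (\<lambda>z. s ^ ?n * J (\<lambda>x. G (s *\<^sub>R x + R *\<^sub>R z)))"
    unfolding swapG(1) J_cmult ..
  also have "\<dots> \<le> J (\<lambda>z. 4 * (\<rho> ^ ?n * J (\<lambda>x. G (\<rho> *\<^sub>R x))))"
    by (intro J_mono G_le continuous_intros swapG)
  also have "\<dots> = 4 * (\<rho> ^ ?n * J (\<lambda>x. G (\<rho> *\<^sub>R x))) * J (\<lambda>_. 1)" by (rule J_const)
  also have "\<dots> \<le> 4 * (\<rho> ^ ?n * (2 * J P)) * J (\<lambda>_. 1)"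
    using bound \<open>0 < \<rho>\<close> J_one_pos by (intro mult_right_mono mult_left_mono) auto
  finally have 1: "s ^ ?n * J (\<lambda>x. J (\<lambda>z. G (s *\<^sub>R x + R *\<^sub>R z))) \<le> 8 * (\<rho> ^ ?n * J P * J (\<lambda>_. 1))" by simp
  have "J P * J (\<lambda>_. 1) = J (\<lambda>z. J P)" by (rule J_const[symmetric])
  also have "\<dots> \<le> J (\<lambda>z. 4 * (s ^ ?n * J (\<lambda>x. P (s *\<^sub>R x + r *\<^sub>R z))))"
    by (intro J_mono P_le continuous_intros swapP)
  also have "\<dots> = 4 * (s ^ ?n * J (\<lambda>x. J (\<lambda>z. P (s *\<^sub>R x + r *\<^sub>R z))))"
    unfolding swapP(1) J_cmult ..
  finally have 2: "J P * J (\<lambda>_. 1) \<le> 4 * (s ^ ?n * J (\<lambda>x. J (\<lambda>z. P (s *\<^sub>R x + r *\<^sub>R z))))" .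
  \<comment> \<open>Each of the two shifts costs a factor 4 and the hypothesis on \<open>G\<close> a
    factor 2; 33 just exceeds the product 32.\<close>
  have "J (\<lambda>x. 33 * \<rho> ^ ?n * J (\<lambda>z. P (s *\<^sub>R x + r *\<^sub>R z))) \<le> J (\<lambda>x. J (\<lambda>z. G (s *\<^sub>R x + R *\<^sub>R z)))"
  proof (rule J_mono)
    fix x :: "real ^ 'n" assume "norm x < 1"
    then have "norm (s *\<^sub>R x) \<le> 2 * 1" unfolding norm_scaleR using s by (intro mult_mono) auto
    then show "33 * \<rho> ^ ?n * J (\<lambda>z. P (s *\<^sub>R x + r *\<^sub>R z)) \<le> J (\<lambda>z. G (s *\<^sub>R x + R *\<^sub>R z))"
      using found[of "s *\<^sub>R x"] contra by force
  qed (intro continuous_intros swapG swapP)+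
  then have "s ^ ?n * (33 * \<rho> ^ ?n * J (\<lambda>x. J (\<lambda>z. P (s *\<^sub>R x + r *\<^sub>R z)))) \<le> s ^ ?n * J (\<lambda>x. J (\<lambda>z. G (s *\<^sub>R x + R *\<^sub>R z)))"
    unfolding J_cmult using s by (intro mult_left_mono) auto
  with 1 have 3: "\<rho> ^ ?n * (33 * (s ^ ?n * J (\<lambda>x. J (\<lambda>z. P (s *\<^sub>R x + r *\<^sub>R z))))) \<le> \<rho> ^ ?n * (8 * (J P * J (\<lambda>_. 1)))"
    by (simp add: mult_ac)
  then have "33 * (s ^ ?n * J (\<lambda>x. J (\<lambda>z. P (s *\<^sub>R x + r *\<^sub>R z)))) \<le> 8 * (J P * J (\<lambda>_. 1))"
    using \<open>0 < \<rho>\<close> by (simp add: mult_le_cancel_left)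
  moreover have "0 < J P * J (\<lambda>_. 1)" using \<open>0 < J P\<close> J_one_pos by simp
  ultimately show False using 2 by linarith
qed

lemma mean_value_uminus: "mean_value v \<Longrightarrow> mean_value (\<lambda>x. - v x)"
  unfolding mean_value_def using J_cmult[of "-1"] by (auto intro!: continuous_intros)

text \<open>For \<open>v\<close> of one sign, the mean on the ball of radius \<open>h\<close> about
  \<open>z\<close> is dominated by the mean on the ball of radius \<open>2 * h / \<kappa>\<close>
  about \<open>x\<close>, and both means are point values.\<close>

lemma mean_value_Harnack:
  obtains C where "1 \<le> C"
    and "\<And>v x z h. mean_value v \<Longrightarrow> 0 < h \<Longrightarrow> norm (z - x) \<le> h \<Longrightarrow>
      (\<And>y. norm (y - x) < 2 * h / \<kappa> \<Longrightarrow> v y \<noteq> 0) \<Longrightarrow> \<bar>v z\<bar> \<le> C * \<bar>v x\<bar>"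
proof
  define C where "C = 2 * (2 / \<kappa>) ^ CARD('n)"
  have "1 \<le> 2 / \<kappa>" using \<kappa>_pos \<kappa>_le by (simp add: field_simps)
  then have "1 \<le> (2 / \<kappa>) ^ CARD('n)" by (rule one_le_power)
  then show "1 \<le> C" unfolding C_def by linarith
  have pos: "v z \<le> C * v x" if v: "mean_value v" and h: "0 < h" "norm (z - x) \<le> h"
    and nonneg: "\<And>y. norm (y - x) < 2 * h / \<kappa> \<Longrightarrow> 0 \<le> v y" for v x z h
  proof -
    have "h ^ CARD('n) * J (\<lambda>y. v (z + h *\<^sub>R y)) \<le> 2 * (2 * h / \<kappa>) ^ CARD('n) * J (\<lambda>y. v (x + (2 * h / \<kappa>) *\<^sub>R y))"
      by (rule J_ball_le[OF mean_valueD(1)[OF v] nonneg]) (use h \<kappa>_pos in auto)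
    then have "h ^ CARD('n) * (v z * J (\<lambda>_. 1)) \<le> h ^ CARD('n) * (C * v x * J (\<lambda>_. 1))"
      unfolding mean_valueD(2)[OF v] by (simp add: C_def power_mult_distrib power_divide mult_ac)
    then show ?thesis using h J_one_pos by simp
  qed
  fix v :: "real ^ 'n \<Rightarrow> real" and x z :: "real ^ 'n" and h :: real
  assume v: "mean_value v" and h: "0 < h" "norm (z - x) \<le> h"
    and nz: "\<And>y. norm (y - x) < 2 * h / \<kappa> \<Longrightarrow> v y \<noteq> 0"
  let ?B = "ball x (2 * h / \<kappa>)"
  have R: "h < 2 * h / \<kappa>" using h \<kappa>_pos \<kappa>_le by (simp add: field_simps)
  then have zx: "z \<in> ?B" "x \<in> ?B" using h by (auto simp: dist_norm norm_minus_commute)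
  have nzB: "v y \<noteq> 0" if "y \<in> ?B" for y
    using that nz[of y] by (simp add: dist_norm norm_minus_commute)
  \<comment> \<open>A continuous function without zeros on a ball has a fixed sign there; the
    negative case is reduced to the positive one by passing to \<open>- v\<close>.\<close>
  have "connected (v ` ?B)"
    by (intro connected_continuous_image continuous_on_subset[OF mean_valueD(1)[OF v]] connected_ball) auto
  then have "is_interval (v ` ?B)" by (simp add: is_interval_connected_1)
  then have sign: "0 < v y \<longleftrightarrow> 0 < v x" if "y \<in> ?B" for y
    using that zx(2) nzB unfolding is_interval_1 by (smt (verit) image_eqI imageE)
  show "\<bar>v z\<bar> \<le> C * \<bar>v x\<bar>"
  proof (cases "0 < v x")
    case True
    have "v z \<le> C * v x"
      by (rule pos[OF v h]) (use sign True in \<open>auto simp: dist_norm norm_minus_commute less_imp_le\<close>)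
    then show ?thesis using True sign[OF zx(1)] by simp
  next
    case False
    have "- v z \<le> C * (- v x)"
    proof (rule pos[OF mean_value_uminus[OF v] h])
      fix y assume "norm (y - x) < 2 * h / \<kappa>"
      then show "0 \<le> - v y" using sign[of y] False by (simp add: dist_norm norm_minus_commute)
    qed
    moreover have "v z \<le> 0" using False sign[OF zx(1)] by simp
    ultimately show ?thesis using False by simp
  qed
qed

text \<open>The three-balls inequality for radii in geometric progression: dilation symmetry turns
  the square at \<open>b\<close> into a product at \<open>a\<close> and \<open>c\<close>, and
  Cauchy-Schwarz separates the factors.\<close>

lemma dilation_symmetric_log_convex:
  assumes v: "continuous_on UNIV v" "dilation_symmetric v" and "0 < a" "0 < b" "0 < c" "b\<^sup>2 = a * c"
  shows "(J (\<lambda>x. (v (y + b *\<^sub>R x))\<^sup>2))\<^sup>2 \<le> J (\<lambda>x. (v (y + a *\<^sub>R x))\<^sup>2) * J (\<lambda>x. (v (y + c *\<^sub>R x))\<^sup>2)"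
proof -
  have "J (\<lambda>x. v (y + b *\<^sub>R x) * v (y + b *\<^sub>R x)) = J (\<lambda>x. v (y + a *\<^sub>R x) * v (y + c *\<^sub>R x))"
    using v(2) assms(3-) unfolding dilation_symmetric_def power2_eq_square by blast
  moreover have "(J (\<lambda>x. v (y + a *\<^sub>R x) * v (y + c *\<^sub>R x)))\<^sup>2 \<le> J (\<lambda>x. (v (y + a *\<^sub>R x))\<^sup>2) * J (\<lambda>x. (v (y + c *\<^sub>R x))\<^sup>2)"
    by (rule J_Cauchy_Schwarz) (intro continuous_on_compose2[OF v(1)] continuous_intros; auto)+
  ultimately show ?thesis by (simp add: power2_eq_square)
qed

text \<open>Cauchy-Schwarz applied to the mean value identity, followed by a change of centre to the
  origin. It converts growth of mean squares into pointwise growth.\<close>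

lemma mean_value_square_le:
  assumes v: "mean_value v" and "0 < r" "norm z + r \<le> \<kappa> * R"
  shows "(v z)\<^sup>2 * J (\<lambda>_. 1) \<le> 2 * (R / r) ^ CARD('n) * J (\<lambda>x. (v (R *\<^sub>R x))\<^sup>2)"
proof -
  have c: "continuous_on UNIV (\<lambda>x. v (z + r *\<^sub>R x))" "continuous_on UNIV (\<lambda>x. (v x)\<^sup>2)"
    by (intro continuous_intros continuous_on_compose2[OF mean_valueD(1)[OF v]]; auto)+
  have "(v z * J (\<lambda>_. 1))\<^sup>2 \<le> J (\<lambda>x. (v (z + r *\<^sub>R x))\<^sup>2) * J (\<lambda>_. 1)"
    using J_Cauchy_Schwarz[OF c(1), of "\<lambda>_. 1"] mean_valueD(2)[OF v, of z r] by simp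
  then have "((v z)\<^sup>2 * J (\<lambda>_. 1)) * J (\<lambda>_. 1) \<le> J (\<lambda>x. (v (z + r *\<^sub>R x))\<^sup>2) * J (\<lambda>_. 1)"
    by (simp add: power2_eq_square mult_ac)
  then have "(v z)\<^sup>2 * J (\<lambda>_. 1) \<le> J (\<lambda>x. (v (z + r *\<^sub>R x))\<^sup>2)"
    using J_one_pos by (simp add: mult_le_cancel_right)
  moreover have "r ^ CARD('n) * J (\<lambda>x. (v (z + r *\<^sub>R x))\<^sup>2) \<le> 2 * R ^ CARD('n) * J (\<lambda>x. (v (0 + R *\<^sub>R x))\<^sup>2)"
    by (rule J_ball_le[OF c(2)]) (use assms in auto)
  ultimately show ?thesis using \<open>0 < r\<close> by (simp add: power_divide field_simps)
      (smt (verit) mult_left_mono mult.commute mult.left_commute zero_le_power)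
qed

end

section \<open>Homogeneous growth and porous nodal sets\<close>

text \<open>The fraction \<open>c\<close> is common to all centres and scales, so the property
  survives dilations; it retains all that is used about \<open>u\<close>.\<close>

definition porous_nodal_set :: "real \<Rightarrow> ('a::real_normed_vector \<Rightarrow> real) \<Rightarrow> bool" where
  "porous_nodal_set c v \<longleftrightarrow> (\<forall>x r. 0 < r \<longrightarrow> (\<exists>y. norm (y - x) \<le> r \<and> (\<forall>z. norm (z - y) < c * r \<longrightarrow> v z \<noteq> 0)))"

lemma porous_nodal_set_rescale:
  assumes "porous_nodal_set c v" and "0 < s"
  shows "porous_nodal_set c (\<lambda>x. v (s *\<^sub>R x))"
  unfolding porous_nodal_set_def
proof (intro allI impI)
  fix x :: 'a and r :: real assume "0 < r"
  then obtain y where y: "norm (y - s *\<^sub>R x) \<le> s * r" "\<And>z. norm (z - y) < c * (s * r) \<Longrightarrow> v z \<noteq> 0"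
    using assms unfolding porous_nodal_set_def by (meson mult_pos_pos)
  have eq: "norm (s *\<^sub>R a - b) = s * norm (a - (1 / s) *\<^sub>R b)" for a b :: 'a
  proof -
    have "s *\<^sub>R a - b = s *\<^sub>R (a - (1 / s) *\<^sub>R b)" using \<open>0 < s\<close> by (simp add: scaleR_right_diff_distrib)
    then show ?thesis using \<open>0 < s\<close> by simp
  qed
  have "norm ((1 / s) *\<^sub>R y - x) \<le> r"
    using y(1) eq[of x y] \<open>0 < s\<close> by (simp add: norm_minus_commute)
  moreover have "v (s *\<^sub>R z) \<noteq> 0" if "norm (z - (1 / s) *\<^sub>R y) < c * r" for z
  proof (rule y(2))
    have "s * norm (z - (1 / s) *\<^sub>R y) < s * (c * r)" using that \<open>0 < s\<close> by (rule mult_strict_left_mono)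
    then show "norm (s *\<^sub>R z - y) < c * (s * r)" unfolding eq by (simp add: mult_ac)
  qed
  ultimately show "\<exists>y. norm (y - x) \<le> r \<and> (\<forall>z. norm (z - y) < c * r \<longrightarrow> v (s *\<^sub>R z) \<noteq> 0)" by blast
qed

context quadratic_kernel
begin

text \<open>\<open>err = V (exp h * x) - \<mu> V x\<close> is small in the mean because the growth of \<open>V\<close> is close to that of a
  homogeneous function, but it dominates \<open>V\<close> on the balls free of zeros by Harnack's inequality.
  The three-balls inequality transfers the smallness of \<open>V\<close> there to a whole doubling ball.\<close>
lemma porous_nodal_set_excludes_rapid_homogeneous_growth:
  assumes c: "0 < c" "c \<le> 1"
  obtains K M \<epsilon> h0 where "0 < K" "0 < M" "0 < \<epsilon>" "0 < h0"
    and "\<And>V h. mean_value V \<Longrightarrow> dilation_symmetric V \<Longrightarrow> porous_nodal_set c V \<Longrightarrow>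
      0 < h \<Longrightarrow> h \<le> h0 \<Longrightarrow> 0 < J (\<lambda>x. (V x)\<^sup>2) \<Longrightarrow>
      (\<And>t. 0 \<le> t \<Longrightarrow> t \<le> M \<Longrightarrow>
        exp (K * t) * J (\<lambda>x. (V x)\<^sup>2) \<le> J (\<lambda>x. (V (exp (t * h / 2) *\<^sub>R x))\<^sup>2) \<and>
        J (\<lambda>x. (V (exp (t * h / 2) *\<^sub>R x))\<^sup>2) \<le> exp ((1 + \<epsilon>) * K * t) * J (\<lambda>x. (V x)\<^sup>2)) \<Longrightarrow> False"
proof -
  let ?n = "CARD('n)"
  obtain CH where CH: "1 \<le> CH" and Harnack: "\<And>v x z h. mean_value v \<Longrightarrow> 0 < h \<Longrightarrow> norm (z - x) \<le> h \<Longrightarrow>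
      (\<And>y. norm (y - x) < 2 * h / \<kappa> \<Longrightarrow> v y \<noteq> 0) \<Longrightarrow> \<bar>v z\<bar> \<le> CH * \<bar>v x\<bar>"
    by (rule mean_value_Harnack) (rule that; blast)
  \<comment> \<open>Twice the Harnack constant: where Harnack applies,
    \<open>\<mu> * \<bar>V x\<bar>\<close> exceeds the dilated value by at least
    \<open>CH * \<bar>V x\<bar>\<close>. A dilation by \<open>exp h\<close> advances
    \<open>t\<close> by 2, so growth of rate \<open>K\<close> multiplies the mean square by
    \<open>\<mu>\<^sup>2\<close>.\<close>
  define \<mu> where "\<mu> = 2 * CH"
  define K where "K = ln \<mu>"
  \<comment> \<open>With \<open>r = L * h\<close>, half the zero-free radius \<open>c * r\<close>
    equals the Harnack radius \<open>2 * (6 * h) / \<kappa>\<close>. The factor \<open>k\<close>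
    makes the ball of radius \<open>\<kappa> * k * r\<close> about the doubling centre contain the
    largest of the three balls.\<close>
  define L where "L = 24 / (\<kappa> * c)"
  define k where "k = (1 + 8 / (c * \<kappa>\<^sup>2)) / \<kappa>"
  \<comment> \<open>\<open>T * h\<close> is four times the shift parameter \<open>\<sigma>\<close>
    of the doubling lemma. The window must reach the dilation by \<open>exp h * \<rho>\<close>,
    which is the parameter \<open>2 * T + 2\<close>.\<close>
  define T where "T = 4 * sqrt \<Lambda> * k * L"
  define M where "M = 2 * T + 2"
  define C1 where "C1 = exp (2 * (M * K))"
  \<comment> \<open>\<open>D * (exp (\<epsilon> * (M * K)) - 1)\<close> is the constant left at the
    end of the three-balls chain; \<open>\<epsilon>\<close> is chosen to bring it down to
    1/2.\<close>
  define D where "D = 16 * 33\<^sup>2 * (k ^ ?n)\<^sup>2 * (exp 1 ^ ?n)\<^sup>2 * C1 * (2 * exp (M * K))"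
  define \<epsilon> where "\<epsilon> = min 1 (ln (1 + 1 / (2 * D)) / (M * K))"
  define E where "E = 2 * exp (M * K) * (exp (\<epsilon> * (M * K)) - 1)"
  have "0 < K" "exp K = \<mu>" using CH by (auto simp: K_def \<mu>_def)
  have \<kappa>: "0 < \<kappa>" "\<kappa> \<le> 1 / 2" using \<kappa>_pos \<kappa>_le by auto
  have \<kappa>c: "\<kappa> * c \<le> 1" "0 < \<kappa> * c" using c \<kappa> by (auto intro: mult_le_one)
  have "24 \<le> L" using \<kappa>c by (simp add: L_def pos_le_divide_eq)
  have c\<kappa>: "c * \<kappa>\<^sup>2 \<le> 1" "0 < c * \<kappa>\<^sup>2" using c \<kappa> by (auto intro!: mult_le_one power_le_one)
  have k8: "8 \<le> 8 / (c * \<kappa>\<^sup>2)" using c\<kappa> by (simp add: pos_le_divide_eq)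
  have \<kappa>k: "\<kappa> * k = 1 + 8 / (c * \<kappa>\<^sup>2)" using \<kappa> by (simp add: k_def)
  then have "9 \<le> \<kappa> * k" using k8 by simp
  have "1 \<le> k"
  proof (rule ccontr)
    assume "\<not> 1 \<le> k"
    then have "\<kappa> * k \<le> \<kappa> * 1" using \<kappa> by (intro mult_left_mono) auto
    then show False using \<open>9 \<le> \<kappa> * k\<close> \<kappa> by linarith
  qed
  have kL: "24 \<le> k * L" using mult_mono[of 1 k 24 L] \<open>1 \<le> k\<close> \<open>24 \<le> L\<close> by simp
  have "1 \<le> sqrt \<Lambda>" using \<Lambda>_ge_1 by simp
  have T_ge: "4 * (k * L) \<le> T"
    using mult_right_mono[OF \<open>1 \<le> sqrt \<Lambda>\<close>, of "k * L"] kL by (simp add: T_def)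
  have kL_L: "L \<le> k * L" using mult_right_mono[OF \<open>1 \<le> k\<close>, of L] \<open>24 \<le> L\<close> by simp
  have "0 < T" "1 \<le> T" using T_ge kL by auto
  have "0 < M" using \<open>0 < T\<close> by (simp add: M_def)
  have MK: "0 < M * K" using \<open>0 < M\<close> \<open>0 < K\<close> by simp
  have "0 < C1" by (simp add: C1_def)
  have "0 < D" unfolding D_def using \<open>0 < C1\<close> \<open>1 \<le> k\<close> by (intro mult_pos_pos) auto
  have "0 < ln (1 + 1 / (2 * D))" using \<open>0 < D\<close> by (intro ln_gt_zero) simp
  then have "0 < \<epsilon>" "\<epsilon> \<le> 1" using MK by (auto simp: \<epsilon>_def)
  have "0 < E" unfolding E_def using MK \<open>0 < \<epsilon>\<close> by (intro mult_pos_pos) auto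
  have DE: "16 * 33\<^sup>2 * (k ^ ?n)\<^sup>2 * (exp 1 ^ ?n)\<^sup>2 * C1 * E \<le> 1 / 2"
  proof -
    have "\<epsilon> * (M * K) \<le> ln (1 + 1 / (2 * D)) / (M * K) * (M * K)"
      using MK by (intro mult_right_mono) (auto simp: \<epsilon>_def)
    then have "\<epsilon> * (M * K) \<le> ln (1 + 1 / (2 * D))" using \<open>0 < M\<close> \<open>0 < K\<close> by simp
    then have "exp (\<epsilon> * (M * K)) \<le> exp (ln (1 + 1 / (2 * D)))" by simp
    also have "\<dots> = 1 + 1 / (2 * D)" using \<open>0 < D\<close> by (subst exp_ln) (auto intro: add_pos_pos)
    finally have "exp (\<epsilon> * (M * K)) - 1 \<le> 1 / (2 * D)" by simp
    then have "D * (exp (\<epsilon> * (M * K)) - 1) \<le> D * (1 / (2 * D))" using \<open>0 < D\<close> by (intro mult_left_mono) auto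
    also have "\<dots> = 1 / 2" using \<open>0 < D\<close> by simp
    also have "D * (exp (\<epsilon> * (M * K)) - 1) = 16 * 33\<^sup>2 * (k ^ ?n)\<^sup>2 * (exp 1 ^ ?n)\<^sup>2 * C1 * E"
      by (simp add: D_def E_def)
    finally show ?thesis .
  qed
  show thesis
  proof (rule that[OF \<open>0 < K\<close> \<open>0 < M\<close> \<open>0 < \<epsilon>\<close>])
    \<comment> \<open>This \<open>h0\<close> keeps \<open>\<tau>\<close> at most 1, hence
      \<open>\<rho>\<close> at most \<open>exp 1\<close> and \<open>2 * \<sigma>\<close> at most 1,
      whatever \<open>h\<close> is.\<close>
    show "0 < 1 / T" using \<open>0 < T\<close> by simp
    fix V :: "real ^ 'n \<Rightarrow> real" and h :: real
    assume V: "mean_value V" "dilation_symmetric V" "porous_nodal_set c V"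
      and h: "0 < h" "h \<le> 1 / T" and \<Phi>0: "0 < J (\<lambda>x. (V x)\<^sup>2)"
      and growth: "\<And>t. 0 \<le> t \<Longrightarrow> t \<le> M \<Longrightarrow>
        exp (K * t) * J (\<lambda>x. (V x)\<^sup>2) \<le> J (\<lambda>x. (V (exp (t * h / 2) *\<^sub>R x))\<^sup>2) \<and>
        J (\<lambda>x. (V (exp (t * h / 2) *\<^sub>R x))\<^sup>2) \<le> exp ((1 + \<epsilon>) * K * t) * J (\<lambda>x. (V x)\<^sup>2)"
    note contV = mean_valueD(1)[OF V(1)]
    note [continuous_intros] = continuous_on_compose2[OF contV]
    define \<Phi> where "\<Phi> t = J (\<lambda>x. (V (exp (t * h / 2) *\<^sub>R x))\<^sup>2)" for t
    define P where "P = J (\<lambda>x. (V x)\<^sup>2)"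
    have "0 < P" using \<Phi>0 by (simp add: P_def)
    have \<Phi>_ge: "exp (K * t) * P \<le> \<Phi> t" and \<Phi>_le: "\<Phi> t \<le> exp ((1 + \<epsilon>) * K * t) * P" if "0 \<le> t" "t \<le> M" for t
      using growth[OF that] by (auto simp: \<Phi>_def P_def)
    define \<tau> where "\<tau> = T * h"
    define \<rho> where "\<rho> = exp \<tau>"
    define r where "r = L * h"
    have "0 < \<tau>" "\<tau> \<le> 1" using h \<open>0 < T\<close> by (auto simp: \<tau>_def field_simps)
    have "h \<le> 1" using h \<open>1 \<le> T\<close> by (smt (verit) divide_le_eq_1)
    have "0 < \<rho>" "\<rho> \<le> exp 1" using \<open>\<tau> \<le> 1\<close> by (auto simp: \<rho>_def)
    have "0 < r" using h \<open>24 \<le> L\<close> by (simp add: r_def)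
    define err where "err x = V (exp h *\<^sub>R x) - \<mu> * V x" for x
    have cont_err: "continuous_on UNIV err" unfolding err_def[abs_def] by (intro continuous_intros) auto
    note [continuous_intros] = continuous_on_compose2[OF cont_err]
    have bound_V: "J (\<lambda>x. (V (\<rho> *\<^sub>R x))\<^sup>2) \<le> C1 * P"
    proof -
      have "J (\<lambda>x. (V (\<rho> *\<^sub>R x))\<^sup>2) = \<Phi> (2 * T)" by (simp add: \<Phi>_def \<rho>_def \<tau>_def)
      also have "\<dots> \<le> exp ((1 + \<epsilon>) * K * (2 * T)) * P" using \<open>0 < T\<close> by (intro \<Phi>_le) (auto simp: M_def)
      also have "exp ((1 + \<epsilon>) * K * (2 * T)) \<le> C1"
      proof -
        have "((1 + \<epsilon>) * K) * (2 * T) \<le> (2 * K) * M"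
          using \<open>\<epsilon> \<le> 1\<close> \<open>0 < \<epsilon>\<close> \<open>0 < K\<close> \<open>0 < T\<close> by (intro mult_mono) (auto simp: M_def)
        then show ?thesis by (simp add: C1_def mult_ac)
      qed
      finally show ?thesis using \<open>0 < P\<close> by (simp add: mult_right_mono)
    qed
    have bound_err: "J (\<lambda>x. (err (\<rho> *\<^sub>R x))\<^sup>2) \<le> E * P"
    proof -
      \<comment> \<open>By dilation symmetry the mixed term is \<open>\<Phi>\<close> at the middle
        parameter, so the error is a second difference of \<open>\<Phi>\<close> with weights 1,
        \<open>- 2 * \<mu>\<close> and \<open>\<mu>\<^sup>2\<close>. It would vanish if
        \<open>\<Phi>\<close> grew at the exact rate \<open>K\<close>.\<close>
      have eq: "J (\<lambda>x. (err (\<rho> *\<^sub>R x))\<^sup>2) = (\<Phi> (2 * T + 2) - 2 * \<mu> * \<Phi> (2 * T + 1)) + \<mu>\<^sup>2 * \<Phi> (2 * T)"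
      proof -
        have "exp h * \<rho> = exp ((2 * T + 2) * h / 2)" "\<rho> = exp ((2 * T) * h / 2)"
          by (simp_all add: \<rho>_def \<tau>_def exp_add[symmetric] algebra_simps)
        moreover have "J (\<lambda>x. V ((exp h * \<rho>) *\<^sub>R x) * V (\<rho> *\<^sub>R x)) = \<Phi> (2 * T + 1)"
        proof -
          let ?e = "exp ((2 * T + 1) * h / 2)"
          have "exp h * \<rho> * \<rho> = ?e * ?e"
            by (simp add: \<rho>_def \<tau>_def exp_add[symmetric] algebra_simps)
          moreover have "0 < exp h * \<rho>" using \<open>0 < \<rho>\<close> by simp
          ultimately have "J (\<lambda>x. V (0 + (exp h * \<rho>) *\<^sub>R x) * V (0 + \<rho> *\<^sub>R x)) = J (\<lambda>x. V (0 + ?e *\<^sub>R x) * V (0 + ?e *\<^sub>R x))"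
            using V(2) \<open>0 < \<rho>\<close> exp_gt_zero[of "(2 * T + 1) * h / 2"] unfolding dilation_symmetric_def by blast
          then show ?thesis by (simp add: \<Phi>_def power2_eq_square)
        qed
        moreover have "(\<lambda>x. (err (\<rho> *\<^sub>R x))\<^sup>2) = (\<lambda>x. ((V ((exp h * \<rho>) *\<^sub>R x))\<^sup>2 - (2 * \<mu>) * (V ((exp h * \<rho>) *\<^sub>R x) * V (\<rho> *\<^sub>R x))) + \<mu>\<^sup>2 * (V (\<rho> *\<^sub>R x))\<^sup>2)"
          by (rule ext) (simp add: err_def power2_eq_square algebra_simps)
        moreover have "J \<dots> = (J (\<lambda>x. (V ((exp h * \<rho>) *\<^sub>R x))\<^sup>2) - 2 * \<mu> * J (\<lambda>x. V ((exp h * \<rho>) *\<^sub>R x) * V (\<rho> *\<^sub>R x))) + \<mu>\<^sup>2 * J (\<lambda>x. (V (\<rho> *\<^sub>R x))\<^sup>2)"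
          by (subst J_add J_diff, (intro continuous_intros; auto)+)+ (simp only: J_cmult)
        ultimately show ?thesis by (simp add: \<Phi>_def)
      qed
      define a where "a = exp (M * K)"
      define \<delta> where "\<delta> = exp (\<epsilon> * (M * K))"
      have "\<Phi> (2 * T + 2) \<le> exp ((1 + \<epsilon>) * K * (2 * T + 2)) * P" using \<open>0 < T\<close> by (intro \<Phi>_le) (auto simp: M_def)
      also have "exp ((1 + \<epsilon>) * K * (2 * T + 2)) = a * \<delta>"
        unfolding a_def \<delta>_def M_def exp_add[symmetric] by (simp add: algebra_simps)
      finally have 1: "\<Phi> (2 * T + 2) \<le> a * \<delta> * P" .
      have "exp (K * (2 * T + 1)) * P \<le> \<Phi> (2 * T + 1)" using \<open>0 < T\<close> by (intro \<Phi>_ge) (auto simp: M_def)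
      then have "\<mu> * (exp (K * (2 * T + 1)) * P) \<le> \<mu> * \<Phi> (2 * T + 1)" using CH by (intro mult_left_mono) (auto simp: \<mu>_def)
      moreover have "\<mu> * exp (K * (2 * T + 1)) = a"
        unfolding a_def M_def \<open>exp K = \<mu>\<close>[symmetric] exp_add[symmetric] by (simp add: algebra_simps)
      ultimately have 2: "a * P \<le> \<mu> * \<Phi> (2 * T + 1)" by (simp add: mult.assoc[symmetric])
      have "\<Phi> (2 * T) \<le> exp ((1 + \<epsilon>) * K * (2 * T)) * P" using \<open>0 < T\<close> by (intro \<Phi>_le) (auto simp: M_def)
      then have "\<mu>\<^sup>2 * \<Phi> (2 * T) \<le> \<mu>\<^sup>2 * (exp ((1 + \<epsilon>) * K * (2 * T)) * P)" by (intro mult_left_mono) auto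
      also have "\<dots> = exp (2 * K + (1 + \<epsilon>) * K * (2 * T)) * P"
        unfolding \<open>exp K = \<mu>\<close>[symmetric] by (simp add: power2_eq_square exp_add[symmetric] algebra_simps)
      also have "\<dots> \<le> (a * \<delta>) * P"
        unfolding a_def \<delta>_def exp_add[symmetric] M_def using \<open>0 < \<epsilon>\<close> \<open>0 < K\<close> \<open>0 < P\<close>
        by (intro mult_right_mono) (auto simp: algebra_simps)
      finally have 3: "\<mu>\<^sup>2 * \<Phi> (2 * T) \<le> a * \<delta> * P" .
      have "J (\<lambda>x. (err (\<rho> *\<^sub>R x))\<^sup>2) \<le> 2 * (a * \<delta> * P) - 2 * (a * P)"
        unfolding eq using 1 2 3 by linarith
      also have "\<dots> = E * P" by (simp add: E_def a_def \<delta>_def algebra_simps)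
      finally show ?thesis .
    qed
    \<comment> \<open>Each summand is normalised to have mean at most \<open>P\<close> at radius
      \<open>\<rho>\<close>, so a single centre controls both \<open>V\<close> and
      \<open>err\<close>.\<close>
    define G where "G x = (1 / C1) * (V x)\<^sup>2 + (1 / E) * (err x)\<^sup>2" for x
    have contG: "continuous_on UNIV G" unfolding G_def[abs_def] by (intro continuous_intros) auto
    have cV2: "continuous_on UNIV (\<lambda>x. (V x)\<^sup>2)" and cE2: "continuous_on UNIV (\<lambda>x. (err x)\<^sup>2)"
      by (intro continuous_intros; auto)+
    have JG: "J (\<lambda>x. G (y + s *\<^sub>R x)) = (1 / C1) * J (\<lambda>x. (V (y + s *\<^sub>R x))\<^sup>2) + (1 / E) * J (\<lambda>x. (err (y + s *\<^sub>R x))\<^sup>2)" for y s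
      unfolding G_def
      by (subst J_add, (intro continuous_intros; auto)+) (simp only: J_cmult)
    have "J (\<lambda>x. G (\<rho> *\<^sub>R x)) \<le> 2 * J (\<lambda>x. (V x)\<^sup>2)"
    proof -
      have "(1 / C1) * J (\<lambda>x. (V (\<rho> *\<^sub>R x))\<^sup>2) \<le> P" "(1 / E) * J (\<lambda>x. (err (\<rho> *\<^sub>R x))\<^sup>2) \<le> P"
        using bound_V bound_err \<open>0 < C1\<close> \<open>0 < E\<close> by (simp_all add: pos_divide_le_eq mult.commute)
      then show ?thesis using JG[of 0 \<rho>] by (simp add: P_def)
    qed
    moreover define \<sigma> where "\<sigma> = sqrt \<Lambda> * (k * r)"
    have \<sigma>: "4 * \<sigma> = \<tau>" by (simp add: \<sigma>_def \<tau>_def T_def r_def)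
    moreover have "(1 + 2 * \<sigma>)\<^sup>2 \<le> \<rho>"
    proof -
      have "1 + 2 * \<sigma> \<le> exp (2 * \<sigma>)" by (rule exp_ge_add_one_self)
      then have "(1 + 2 * \<sigma>)\<^sup>2 \<le> (exp (2 * \<sigma>))\<^sup>2" using \<sigma> \<open>0 < \<tau>\<close> by (intro power_mono) auto
      also have "\<dots> = \<rho>" unfolding \<rho>_def \<sigma>[symmetric] by (simp add: power2_eq_square exp_add[symmetric])
      finally show ?thesis .
    qed
    moreover have "r \<le> k * r" using mult_right_mono[OF \<open>1 \<le> k\<close>, of r] \<open>0 < r\<close> by simp
    moreover have "0 \<le> G x" for x unfolding G_def using \<open>0 < C1\<close> \<open>0 < E\<close> by simp
    ultimately obtain x0 where x0: "norm x0 \<le> 2"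
      "J (\<lambda>z. G (x0 + (k * r) *\<^sub>R z)) < 33 * \<rho> ^ ?n * J (\<lambda>z. (V (x0 + r *\<^sub>R z))\<^sup>2)"
      using exists_doubling_center[of G "\<lambda>x. (V x)\<^sup>2" r "k * r" \<sigma> \<rho>] contG cV2 \<open>0 < r\<close> \<open>\<tau> \<le> 1\<close> \<Phi>0
      unfolding \<sigma>_def by (smt (verit, ccfv_threshold) zero_le_power2)
    define A where "A = J (\<lambda>z. (V (x0 + r *\<^sub>R z))\<^sup>2)"
    define R where "R = k * r"
    define Q1 where "Q1 = J (\<lambda>x. (V (x0 + R *\<^sub>R x))\<^sup>2)"
    define Q2 where "Q2 = J (\<lambda>x. (err (x0 + R *\<^sub>R x))\<^sup>2)"
    have "0 \<le> A" "0 \<le> Q1" "0 \<le> Q2" unfolding A_def Q1_def Q2_def by (auto intro!: J_nonneg)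
    have G_lt: "(1 / C1) * Q1 + (1 / E) * Q2 < 33 * \<rho> ^ ?n * A"
      using x0(2) unfolding JG A_def Q1_def Q2_def R_def .
    have nn: "0 \<le> (1 / C1) * Q1" "0 \<le> (1 / E) * Q2" using \<open>0 \<le> Q1\<close> \<open>0 \<le> Q2\<close> \<open>0 < C1\<close> \<open>0 < E\<close> by auto
    define S where "S = 33 * \<rho> ^ ?n * A"
    have "(1 / C1) * Q1 \<le> S" "(1 / E) * Q2 \<le> S" "0 < S" using G_lt nn unfolding S_def by linarith+
    then have Q1: "Q1 \<le> C1 * S" and Q2: "Q2 \<le> E * S"
      using \<open>0 < C1\<close> \<open>0 < E\<close> by (simp_all add: pos_divide_le_eq mult.commute)
    have "0 < A" using \<open>0 < S\<close> \<open>0 < \<rho>\<close> \<open>0 \<le> A\<close> by (auto simp: S_def zero_less_mult_iff)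
    obtain y where y: "norm (y - x0) \<le> r" "\<And>z. norm (z - y) < c * r \<Longrightarrow> V z \<noteq> 0"
      using V(3) \<open>0 < r\<close> unfolding porous_nodal_set_def by blast
    \<comment> \<open>\<open>s0\<close> is half the zero-free radius, \<open>s1\<close> makes the
      ball of radius \<open>\<kappa> * s1\<close> about \<open>y\<close> contain the ball of radius
      \<open>r\<close> about \<open>x0\<close>, and \<open>s2\<close> completes the geometric
      progression.\<close>
    define s0 s1 s2 where "s0 = c * r / 2" and "s1 = 2 * r / \<kappa>" and "s2 = 8 * r / (c * \<kappa>\<^sup>2)"
    have pos: "0 < s0" "0 < s1" "0 < s2" "0 < R" using \<open>0 < r\<close> c \<kappa> \<open>1 \<le> k\<close> by (auto simp: s0_def s1_def s2_def R_def)
    have s_eq: "s1\<^sup>2 = s0 * s2" using c \<kappa> by (simp add: s0_def s1_def s2_def power2_eq_square)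
    have r_le: "3 / 2 * r \<le> 1"
    proof -
      have "4 * L \<le> T" using T_ge kL_L by linarith
      then have "4 * r \<le> \<tau>" unfolding r_def \<tau>_def using mult_right_mono[of "4 * L" T h] h by simp
      then show ?thesis using \<open>\<tau> \<le> 1\<close> \<open>0 < r\<close> by linarith
    qed
    \<comment> \<open>As \<open>norm x\<close> is at most 3, the dilation by \<open>exp h\<close>
      moves \<open>x\<close> by at most \<open>6 * h\<close>; the Harnack ball needed for this
      displacement has radius \<open>s0\<close> and stays in the zero-free ball of radius
      \<open>2 * s0\<close> about \<open>y\<close>.\<close>
    have V_le_err: "(V x)\<^sup>2 \<le> (err x)\<^sup>2" if x: "norm (x - y) < s0" for x
    proof -
      have s0r: "s0 \<le> r / 2" using c \<open>0 < r\<close> by (simp add: s0_def)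
      have "norm x \<le> norm (x - y) + norm (y - x0) + norm x0"
        using norm_triangle_ineq[of "x - y" y] norm_triangle_ineq[of "y - x0" x0] by simp
      also have "\<dots> \<le> 3" using x y(1) x0(1) s0r r_le by linarith
      finally have "norm x \<le> 3" .
      have "h\<^sup>2 \<le> h" using h \<open>h \<le> 1\<close> by (simp add: power2_eq_square mult_left_le_one_le)
      then have "exp h \<le> 1 + 2 * h" using exp_bound[of h] h \<open>h \<le> 1\<close> by linarith
      then have "(exp h - 1) * norm x \<le> (2 * h) * 3" using \<open>norm x \<le> 3\<close> h by (intro mult_mono) auto
      moreover have "norm (exp h *\<^sub>R x - x) = (exp h - 1) * norm x"
      proof -
        have "exp h *\<^sub>R x - x = (exp h - 1) *\<^sub>R x" by (simp add: scaleR_left_diff_distrib)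
        then show ?thesis using h by simp
      qed
      ultimately have "norm (exp h *\<^sub>R x - x) \<le> 6 * h" by simp
      moreover have "V z \<noteq> 0" if "norm (z - x) < 2 * (6 * h) / \<kappa>" for z
      proof (rule y(2))
        have "2 * (6 * h) / \<kappa> = s0" using c \<kappa> by (simp add: s0_def r_def L_def)
        then show "norm (z - y) < c * r"
          using that x norm_triangle_ineq[of "z - x" "x - y"] by (simp add: s0_def)
      qed
      ultimately have "\<bar>V (exp h *\<^sub>R x)\<bar> \<le> CH * \<bar>V x\<bar>"
        using h by (intro Harnack[OF V(1), of "6 * h"]) auto
      moreover have "\<mu> * \<bar>V x\<bar> - \<bar>V (exp h *\<^sub>R x)\<bar> \<le> \<bar>err x\<bar>"
        using abs_triangle_ineq2[of "\<mu> * V x" "V (exp h *\<^sub>R x)"] CH by (simp add: err_def abs_mult \<mu>_def abs_minus_commute)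
      moreover have "1 * \<bar>V x\<bar> \<le> CH * \<bar>V x\<bar>" using CH by (intro mult_right_mono) auto
      ultimately have "\<bar>V x\<bar> \<le> \<bar>err x\<bar>" by (simp add: \<mu>_def)
      then show ?thesis by (simp add: abs_le_square_iff)
    qed
    define g where "g s = J (\<lambda>x. (V (y + s *\<^sub>R x))\<^sup>2)" for s
    have g_nonneg: "0 \<le> g s" for s unfolding g_def by (rule J_nonneg) simp
    have g0: "s0 ^ ?n * g s0 \<le> 2 * R ^ ?n * (E * S)"
    proof -
      have "g s0 \<le> J (\<lambda>x. (err (y + s0 *\<^sub>R x))\<^sup>2)"
        unfolding g_def
      proof (rule J_mono)
        fix z :: "real ^ 'n" assume "norm z < 1"
        then show "(V (y + s0 *\<^sub>R z))\<^sup>2 \<le> (err (y + s0 *\<^sub>R z))\<^sup>2" using pos by (intro V_le_err) simp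
      qed (intro continuous_intros; auto)+
      then have "s0 ^ ?n * g s0 \<le> s0 ^ ?n * J (\<lambda>x. (err (y + s0 *\<^sub>R x))\<^sup>2)" using pos by (intro mult_left_mono) auto
      also have "\<dots> \<le> 2 * R ^ ?n * Q2"
        unfolding Q2_def
      proof (rule J_ball_le[OF cE2])
        have "9 * r \<le> \<kappa> * R" using mult_right_mono[OF \<open>9 \<le> \<kappa> * k\<close>, of r] \<open>0 < r\<close> by (simp add: R_def mult.assoc)
        moreover have "s0 \<le> r" using c \<open>0 < r\<close> by (simp add: s0_def)
        ultimately show "norm (y - x0) + s0 \<le> \<kappa> * R" using y(1) \<open>0 < r\<close> by linarith
      qed (use pos in auto)
      also have "\<dots> \<le> 2 * R ^ ?n * (E * S)" using Q2 pos by (intro mult_left_mono) auto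
      finally show ?thesis .
    qed
    have g2: "s2 ^ ?n * g s2 \<le> 2 * R ^ ?n * (C1 * S)"
    proof -
      have "s2 ^ ?n * g s2 \<le> 2 * R ^ ?n * Q1"
        unfolding Q1_def g_def
      proof (rule J_ball_le[OF cV2])
        have "\<kappa> * R = r + s2" unfolding R_def mult.assoc[symmetric] \<kappa>k by (simp add: s2_def algebra_simps)
        then show "norm (y - x0) + s2 \<le> \<kappa> * R" using y(1) by simp
      qed (use pos in auto)
      also have "\<dots> \<le> 2 * R ^ ?n * (C1 * S)" using Q1 pos by (intro mult_left_mono) auto
      finally show ?thesis .
    qed
    have g1: "r ^ ?n * A \<le> 2 * s1 ^ ?n * g s1"
      unfolding A_def g_def
    proof (rule J_ball_le[OF cV2])
      show "norm (x0 - y) + r \<le> \<kappa> * s1" using y(1) \<kappa> by (simp add: s1_def norm_minus_commute)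
    qed (use \<open>0 < r\<close> in auto)
    have three: "(g s1)\<^sup>2 \<le> g s0 * g s2"
      unfolding g_def by (rule dilation_symmetric_log_convex[OF contV V(2) pos(1,2,3) s_eq])
    \<comment> \<open>The three radii cancel because \<open>s1\<^sup>2 = s0 * s2\<close>. Both outer
      means are bounded by multiples of \<open>S\<close>, hence of \<open>A\<close>, so the positive
      quantity on the left is bounded by half of itself.\<close>
    have "(r ^ ?n * A)\<^sup>2 \<le> (2 * s1 ^ ?n * g s1)\<^sup>2" using g1 \<open>0 \<le> A\<close> \<open>0 < r\<close> by (intro power_mono) auto
    also have "\<dots> = 4 * (s1\<^sup>2) ^ ?n * (g s1)\<^sup>2" by (simp add: power_mult_distrib power_mult[symmetric] mult.commute)
    also have "\<dots> \<le> 4 * (s1\<^sup>2) ^ ?n * (g s0 * g s2)" using three by (intro mult_left_mono) auto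
    also have "\<dots> = 4 * ((s0 ^ ?n * g s0) * (s2 ^ ?n * g s2))" unfolding s_eq by (simp add: power_mult_distrib mult_ac)
    also have "\<dots> \<le> 4 * ((2 * R ^ ?n * (E * S)) * (2 * R ^ ?n * (C1 * S)))"
      using mult_mono[OF g0 g2] g_nonneg pos \<open>0 < E\<close> \<open>0 < S\<close> by (intro mult_left_mono) simp_all
    also have "\<dots> = (16 * 33\<^sup>2 * (k ^ ?n)\<^sup>2 * (\<rho> ^ ?n)\<^sup>2 * C1 * E) * (r ^ ?n * A)\<^sup>2"
      by (simp add: S_def R_def power_mult_distrib power2_eq_square mult_ac)
    also have "\<dots> \<le> (16 * 33\<^sup>2 * (k ^ ?n)\<^sup>2 * (exp 1 ^ ?n)\<^sup>2 * C1 * E) * (r ^ ?n * A)\<^sup>2"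
      using \<open>0 < \<rho>\<close> \<open>\<rho> \<le> exp 1\<close> \<open>0 < C1\<close> \<open>0 < E\<close> \<open>1 \<le> k\<close>
      by (intro mult_right_mono mult_left_mono power_mono) auto
    also have "\<dots> \<le> 1 / 2 * (r ^ ?n * A)\<^sup>2" using DE by (intro mult_right_mono) auto
    finally have "(r ^ ?n * A)\<^sup>2 \<le> 0" by simp
    then show False using \<open>0 < r\<close> \<open>0 < A\<close> by (simp add: zero_less_mult_iff)
  qed
qed

lemma dilation_symmetric_rescale:
  assumes "dilation_symmetric v" "0 < s"
  shows "dilation_symmetric (\<lambda>x. v (s *\<^sub>R x))"
  unfolding dilation_symmetric_def
proof (intro allI impI)
  fix y and a b c d :: real
  assume "0 < a" "0 < b" "0 < c" "0 < d" "a * b = c * d"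
  then have "0 < s * a" "0 < s * b" "0 < s * c" "0 < s * d" "(s * a) * (s * b) = (s * c) * (s * d)"
    using \<open>0 < s\<close> by (simp_all add: mult_ac)
  then have "J (\<lambda>x. v (s *\<^sub>R y + (s * a) *\<^sub>R x) * v (s *\<^sub>R y + (s * b) *\<^sub>R x)) = J (\<lambda>x. v (s *\<^sub>R y + (s * c) *\<^sub>R x) * v (s *\<^sub>R y + (s * d) *\<^sub>R x))"
    using assms(1) unfolding dilation_symmetric_def by blast
  then show "J (\<lambda>x. v (s *\<^sub>R (y + a *\<^sub>R x)) * v (s *\<^sub>R (y + b *\<^sub>R x))) = J (\<lambda>x. v (s *\<^sub>R (y + c *\<^sub>R x)) * v (s *\<^sub>R (y + d *\<^sub>R x)))"
    by (simp add: scaleR_right_distrib)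
qed

lemma porous_nodal_set_imp_polynomial:
  assumes v: "mean_value v" "dilation_symmetric v" "porous_nodal_set c v" and c: "0 < c" "c \<le> 1"
  shows "real_polynomial_function v"
proof (cases "\<forall>x. v x = 0")
  case True
  then have "v = (\<lambda>_. 0)" by auto
  then show ?thesis using real_polynomial_function.intros(2) by metis
next
  case False
  then obtain z0 where z0: "v z0 \<noteq> 0" by blast
  note contv = mean_valueD(1)[OF v(1)]
  define \<Phi> where "\<Phi> t = J (\<lambda>x. (v (exp (t / 2) *\<^sub>R x))\<^sup>2)" for t
  have \<Phi>_nonneg: "0 \<le> \<Phi> t" for t unfolding \<Phi>_def by (rule J_nonneg) simp
  have \<Phi>_ln: "\<Phi> (2 * ln R) = J (\<lambda>x. (v (R *\<^sub>R x))\<^sup>2)" if "0 < R" for R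
    using that by (simp add: \<Phi>_def)
  have cont\<Phi>: "continuous_on UNIV \<Phi>"
  proof -
    have "continuous_on UNIV (\<lambda>x. (v (exp (t / 2) *\<^sub>R x))\<^sup>2)" for t
      by (intro continuous_intros continuous_on_compose2[OF contv]) auto
    then have "\<Phi> = (\<lambda>t. integral (cbox (- One) One) (\<lambda>x. (v (exp (t / 2) *\<^sub>R x))\<^sup>2 * w x))"
      unfolding \<Phi>_def by (intro ext J_cbox)
    moreover have "continuous_on UNIV (\<lambda>t. integral (cbox (- One) One) (\<lambda>x. (v (exp (t / 2) *\<^sub>R x))\<^sup>2 * w x))"
      by (rule integral_continuous_on_param)
         (auto simp: split_beta intro!: continuous_intros continuous_on_compose2[OF contv])
    ultimately show ?thesis by simp
  qed
  have \<Phi>_mid: "(\<Phi> ((a + b) / 2))\<^sup>2 \<le> \<Phi> a * \<Phi> b" for a b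
  proof -
    have "(exp ((a + b) / 2 / 2))\<^sup>2 = exp (a / 2) * exp (b / 2)"
      by (simp add: power2_eq_square exp_add[symmetric] add_divide_distrib)
    from dilation_symmetric_log_convex[OF contv v(2) _ _ _ this, of 0] show ?thesis
      by (simp add: \<Phi>_def)
  qed
  have \<Phi>_pos: "0 < \<Phi> t" for t
  proof -
    define R where "R = 2 * (norm z0 + 1) / \<kappa>"
    have "0 < R" using \<kappa>_pos by (simp add: R_def add_nonneg_pos)
    have "(v z0)\<^sup>2 * J (\<lambda>_. 1) \<le> 2 * (R / 1) ^ CARD('n) * J (\<lambda>x. (v (R *\<^sub>R x))\<^sup>2)"
      by (rule mean_value_square_le[OF v(1)]) (use \<kappa>_pos in \<open>auto simp: R_def\<close>)
    moreover have "0 < (v z0)\<^sup>2 * J (\<lambda>_. 1)" using z0 J_one_pos by simp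
    ultimately have "\<Phi> (2 * ln R) \<noteq> 0" using \<Phi>_ln[OF \<open>0 < R\<close>] by auto
    \<comment> \<open>\<open>2 * ln R\<close> is the midpoint of \<open>t\<close> and its
      reflection, so a zero of \<open>\<Phi>\<close> at \<open>t\<close> would spread to
      \<open>2 * ln R\<close>.\<close>
    moreover have "(\<Phi> (2 * ln R))\<^sup>2 \<le> \<Phi> t * \<Phi> (2 * (2 * ln R) - t)"
      using \<Phi>_mid[of t "2 * (2 * ln R) - t"] by simp
    ultimately have "\<Phi> t \<noteq> 0" by auto
    then show ?thesis using \<Phi>_nonneg[of t] by linarith
  qed
  define \<phi> where "\<phi> t = ln (\<Phi> t)" for t
  have exp\<phi>: "exp (\<phi> t) = \<Phi> t" for t using \<Phi>_pos[of t] by (simp add: \<phi>_def)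
  have "convex_on UNIV \<phi>"
  proof (rule midpoint_convex_on)
    show "continuous_on UNIV \<phi>"
      unfolding \<phi>_def[abs_def] by (intro continuous_on_ln cont\<Phi>) (use \<Phi>_pos in \<open>auto simp: less_imp_neq[symmetric]\<close>)
    fix a b
    have "exp (2 * \<phi> ((a + b) / 2)) \<le> exp (\<phi> a + \<phi> b)"
      using \<Phi>_mid[of a b] by (simp only: exp_add exp\<phi> mult_2 power2_eq_square)
    then show "\<phi> ((a + b) / 2) \<le> (\<phi> a + \<phi> b) / 2" by simp
  qed
  then obtain s where s: "\<And>x y. s x * (y - x) \<le> \<phi> y - \<phi> x" "mono s"
    by (rule convex_on_subgradient) (rule that; blast)
  show ?thesis
  proof (cases "\<exists>S. \<forall>a. s a \<le> S")
    case True
    then obtain S where S: "\<And>a. s a \<le> S" by blast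
    \<comment> \<open>Since \<open>\<Phi> (2 * ln R)\<close> is the mean square of \<open>v\<close>
      at radius \<open>R\<close>, slopes at most \<open>m\<close> give the growth
      \<open>R ^ (2 * m)\<close>, and \<open>m\<close> becomes the exponent in the Liouville
      theorem.\<close>
    define m where "m = nat \<lceil>S\<rceil>"
    have sm: "s a \<le> real m" for a using S[of a] real_nat_ceiling_ge[of S] unfolding m_def by linarith
    define D where "D = 2 * (2 / \<kappa>) ^ CARD('n) * (\<Phi> 0 * ((2 / \<kappa>) ^ m)\<^sup>2) / J (\<lambda>_. 1)"
    have "0 \<le> D" unfolding D_def using \<kappa>_pos J_one_pos \<Phi>_nonneg by (intro divide_nonneg_pos mult_nonneg_nonneg) auto
    have "\<bar>v z\<bar> \<le> sqrt D * (1 + norm z) ^ m" for z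
    proof -
      define r where "r = 1 + norm z"
      \<comment> \<open>Proportional to \<open>r\<close>, so that \<open>R / r\<close> is constant,
        and large enough that \<open>norm z + r\<close> is at most
        \<open>\<kappa> * R\<close>.\<close>
      define R where "R = (2 / \<kappa>) * r"
      have "1 \<le> r" by (simp add: r_def)
      have "1 \<le> 2 / \<kappa>" using \<kappa>_pos \<kappa>_le by (simp add: field_simps)
      then have "1 \<le> R" using \<open>1 \<le> r\<close> mult_mono[of 1 "2 / \<kappa>" 1 r] unfolding R_def by linarith
      have "\<phi> (2 * ln R) \<le> \<phi> 0 + real m * (2 * ln R)"
      proof -
        have "s (2 * ln R) * (0 - 2 * ln R) \<le> \<phi> 0 - \<phi> (2 * ln R)" by (rule s(1))
        moreover have "s (2 * ln R) * (2 * ln R) \<le> real m * (2 * ln R)"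
          using sm \<open>1 \<le> R\<close> by (intro mult_right_mono) auto
        ultimately show ?thesis by (simp add: algebra_simps)
      qed
      then have "exp (\<phi> (2 * ln R)) \<le> exp (\<phi> 0 + real m * (2 * ln R))" by simp
      also have "\<dots> = \<Phi> 0 * (R ^ m)\<^sup>2"
      proof -
        have "exp (real m * (2 * ln R)) = (exp (ln R) ^ m)\<^sup>2"
          by (simp add: power_mult[symmetric] exp_of_nat_mult[symmetric] mult_ac)
        then show ?thesis using \<open>1 \<le> R\<close> by (simp add: exp_add exp\<phi>)
      qed
      finally have "J (\<lambda>x. (v (R *\<^sub>R x))\<^sup>2) \<le> \<Phi> 0 * (R ^ m)\<^sup>2"
        using \<Phi>_ln[of R] \<open>1 \<le> R\<close> by (simp add: exp\<phi>)
      then have "2 * (R / r) ^ CARD('n) * J (\<lambda>x. (v (R *\<^sub>R x))\<^sup>2) \<le> 2 * (R / r) ^ CARD('n) * (\<Phi> 0 * (R ^ m)\<^sup>2)"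
        using \<open>1 \<le> R\<close> \<open>1 \<le> r\<close> by (intro mult_left_mono) auto
      moreover have "(v z)\<^sup>2 * J (\<lambda>_. 1) \<le> 2 * (R / r) ^ CARD('n) * J (\<lambda>x. (v (R *\<^sub>R x))\<^sup>2)"
        by (rule mean_value_square_le[OF v(1)]) (use \<kappa>_pos in \<open>auto simp: R_def r_def add_pos_nonneg\<close>)
      moreover have "R / r = 2 / \<kappa>" using \<open>1 \<le> r\<close> by (simp add: R_def)
      ultimately have "(v z)\<^sup>2 * J (\<lambda>_. 1) \<le> 2 * (2 / \<kappa>) ^ CARD('n) * (\<Phi> 0 * (R ^ m)\<^sup>2)" by simp
      also have "\<dots> = D * (r ^ m)\<^sup>2 * J (\<lambda>_. 1)"
        using J_one_pos unfolding D_def R_def power_mult_distrib by simp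
      finally have "(v z)\<^sup>2 \<le> D * (r ^ m)\<^sup>2" using J_one_pos by (simp add: mult_le_cancel_right)
      also have "\<dots> = (sqrt D * r ^ m)\<^sup>2" using \<open>0 \<le> D\<close> by (simp add: power_mult_distrib)
      finally have "\<bar>v z\<bar> \<le> \<bar>sqrt D * r ^ m\<bar>" by (simp only: abs_le_square_iff)
      then show ?thesis using \<open>0 \<le> D\<close> \<open>1 \<le> r\<close> by (simp add: r_def abs_mult)
    qed
    then show ?thesis by (rule mean_value_polynomial_growth[OF v(1)])
  next
    case False
    then have unbounded: "\<exists>a. S < s a" for S by (meson not_le)
    obtain K M \<epsilon> h0 where pos: "0 < K" "0 < M" "0 < \<epsilon>" "0 < h0" and no: "\<And>V h. mean_value V \<Longrightarrow> dilation_symmetric V \<Longrightarrow> porous_nodal_set c V \<Longrightarrow>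
      0 < h \<Longrightarrow> h \<le> h0 \<Longrightarrow> 0 < J (\<lambda>x. (V x)\<^sup>2) \<Longrightarrow>
      (\<And>t. 0 \<le> t \<Longrightarrow> t \<le> M \<Longrightarrow>
        exp (K * t) * J (\<lambda>x. (V x)\<^sup>2) \<le> J (\<lambda>x. (V (exp (t * h / 2) *\<^sub>R x))\<^sup>2) \<and>
        J (\<lambda>x. (V (exp (t * h / 2) *\<^sub>R x))\<^sup>2) \<le> exp ((1 + \<epsilon>) * K * t) * J (\<lambda>x. (V x)\<^sup>2)) \<Longrightarrow> False"
      by (rule porous_nodal_set_excludes_rapid_homogeneous_growth[OF c]) (rule that; blast)
    obtain b h where h: "0 < h" "h \<le> h0" and sb: "s b * h = K" "s (b + M * h) \<le> (1 + \<epsilon>) * s b"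
      using exists_window_of_slow_growth[OF s(2) unbounded pos] by metis
    \<comment> \<open>Dilating by \<open>exp (b / 2)\<close> moves the start of the window to
      parameter 0.\<close>
    define V where "V x = v (exp (b / 2) *\<^sub>R x)" for x
    have JV: "J (\<lambda>x. (V (exp (t * h / 2) *\<^sub>R x))\<^sup>2) = \<Phi> (b + t * h)" for t
      by (simp add: V_def \<Phi>_def exp_add[symmetric] add_divide_distrib)
    have JV0: "J (\<lambda>x. (V x)\<^sup>2) = \<Phi> b" using JV[of 0] by simp
    have False
    proof (rule no[of V h])
      show "mean_value V" using mean_value_rescale[OF v(1), of 0 "exp (b / 2)"] by (simp add: V_def[abs_def])
      show "dilation_symmetric V" unfolding V_def[abs_def] by (rule dilation_symmetric_rescale[OF v(2)]) simp
      show "porous_nodal_set c V" unfolding V_def[abs_def] by (rule porous_nodal_set_rescale[OF v(3)]) simp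
      show "0 < J (\<lambda>x. (V x)\<^sup>2)" unfolding JV0 by (rule \<Phi>_pos)
      fix t assume t: "0 \<le> t" "t \<le> M"
      have "s b * (b + t * h - b) \<le> \<phi> (b + t * h) - \<phi> b" by (rule s(1))
      then have "K * t + \<phi> b \<le> \<phi> (b + t * h)" unfolding sb(1)[symmetric] by (simp add: algebra_simps)
      then have 1: "exp (K * t + \<phi> b) \<le> exp (\<phi> (b + t * h))" by simp
      have "s (b + t * h) \<le> s (b + M * h)" using t h by (intro monoD[OF s(2)] add_left_mono mult_right_mono) auto
      then have "s (b + t * h) * (t * h) \<le> ((1 + \<epsilon>) * s b) * (t * h)"
        using sb(2) t h by (intro mult_right_mono) auto
      also have "\<dots> = (1 + \<epsilon>) * K * t" using sb(1) by (simp add: mult_ac)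
      finally have "s (b + t * h) * (t * h) \<le> (1 + \<epsilon>) * K * t" .
      moreover have "s (b + t * h) * (b - (b + t * h)) \<le> \<phi> b - \<phi> (b + t * h)" by (rule s(1))
      ultimately have "\<phi> (b + t * h) \<le> (1 + \<epsilon>) * K * t + \<phi> b" by (simp add: algebra_simps)
      then have 2: "exp (\<phi> (b + t * h)) \<le> exp ((1 + \<epsilon>) * K * t + \<phi> b)" by simp
      show "exp (K * t) * J (\<lambda>x. (V x)\<^sup>2) \<le> J (\<lambda>x. (V (exp (t * h / 2) *\<^sub>R x))\<^sup>2) \<and>
        J (\<lambda>x. (V (exp (t * h / 2) *\<^sub>R x))\<^sup>2) \<le> exp ((1 + \<epsilon>) * K * t) * J (\<lambda>x. (V x)\<^sup>2)"
        using 1 2 unfolding JV JV0 exp_add exp\<phi> by blast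
    qed (use h in auto)
    then show ?thesis ..
  qed
qed

end

theorem corollary1p15:
  fixes A A' :: "real ^ 'n ^ 'n" and u v :: "real ^ 'n \<Rightarrow> real"
  assumes "positive_definite A" and "positive_definite A'"
    and "divergence_form_solution A u" and "divergence_form_solution A' v"
    and "\<exists>x. u x \<noteq> 0"
    and "nodal_set v \<subseteq> nodal_set u"
    and "real_polynomial_function u"
  shows "real_polynomial_function v"
proof -
  obtain B \<Lambda> m where kernel: "quadratic_kernel B \<Lambda>" and "0 < m"
    and SB: "\<And>x. symmetric_part A' *v (B *v x) = m *\<^sub>R x"
    using exists_quadratic_kernel[OF assms(2)] by blast
  interpret quadratic_kernel B \<Lambda> by (rule kernel)
  obtain g H where v: "classical_solution (symmetric_part A') v g H"
    using divergence_form_solutionE[OF assms(4)] by blast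
  note solution = v symmetric_part_inner_commute SB \<open>0 < m\<close>
  \<comment> \<open>If \<open>u\<close> vanished identically, the inclusion of nodal sets would not
    restrict \<open>v\<close> at all.\<close>
  obtain a where "u a \<noteq> 0" using assms(5) by blast
  from polynomial_porosity[OF assms(7) this] obtain c where c: "0 < c" "c \<le> 1"
    and porous: "\<And>x r. 0 < r \<Longrightarrow> \<exists>y. norm (y - x) \<le> r \<and> (\<forall>z. norm (z - y) < c * r \<longrightarrow> u z \<noteq> 0)"
    by blast
  have "v z \<noteq> 0" if "u z \<noteq> 0" for z
    using assms(6) that unfolding nodal_set_def by blast
  then have "porous_nodal_set c v"
    using porous unfolding porous_nodal_set_def by meson
  then show ?thesis
    using porous_nodal_set_imp_polynomial[OF classical_solution_mean_value[OF solution]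
      classical_solution_dilation_symmetric[OF solution] _ c] by blast
qed

end
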